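(* Let $k\in\mathbb{Z}_+$, let $U=I+W\in B(\mathcal{H})$ be continuously invertible with $W\in\mathfrak{S}_2(\mathcal{H},\mathcal{P})$, and let $V_0\in\mathfrak{S}_2(\mathcal{H},\mathcal{P})$ be such that $UD(L_0)=D(L)$, $LU=U(L_0-V_0)$, and the subspaces $\mathcal{H}_{(k)}$ and $\mathcal{H}_\ell$, $|\ell|>k$, are invariant for $V_0$. Then the spectrum of $L$ satisfies $$\sigma(L)=\sigma_{(k)}\cup\Big(\bigcup_{|\ell|>k}\Big(\Big\{i\frac{2\pi\ell}{\omega}\Big\}+\sigma_\ell\Big)\Big),$$ where $\sigma_{(k)}$ is the spectrum of the restriction of $L_0-V_0$ to $\mathcal{H}_{(k)}$, and $\sigma_\ell=\sigma(-V_{0,\ell})$, $|\ell|>k$, with $V_{0,\ell}$ the restriction of $V_0$ to $\mathcal{H}_\ell$. Moreover, $$\sum_{|\ell|>k}|\sigma_\ell|^2<\infty,\qquad\text{where } |\sigma_\ell|=\max_{\lambda\in\sigma_\ell}|\lambda|.$$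
   Context: Setting. Let $\omega>0$, let $H\ne\{0\}$ be a complex Hilbert space, and let $\mathcal{H}=L^2=L^2([0,\omega],H)$ with inner product $\langle x,y\rangle=\frac1\omega\int_0^\omega\langle x(s),y(s)\rangle_H\,ds$. $W_2^1$ is the Sobolev space of continuous functions in $L^2$ with derivative in $L^2$. Let $\mathcal{V}:[0,\omega]\to B(H)$ be strongly measurable with $s\mapsto\mathcal{V}(s)x$ in $L^2$ for every $x\in H$, and let $\widehat{\mathcal{V}}(n)x=\frac1\omega\int_0^\omega\mathcal{V}(s)x\,e^{-i2\pi ns/\omega}ds$, $n\in\mathbb{Z}$. Assume $\sum_{n\in\mathbb{Z}}\|\widehat{\mathcal{V}}(n)\|^2<\infty$ and $\sum_{j,\ell\in\mathbb{Z}}\big\|\sum_{n\neq\ell}\frac{\widehat{\mathcal{V}}(j+n)\widehat{\mathcal{V}}(\ell+n)}{\ell-n}\big\|^2<\infty$. Let $L_0=\frac{d}{ds}$ with domain $D(L_0)=\{y\in W_2^1: y(0)=y(\omega)\}$, $(Vy)(s)=\mathcal{V}(s)y(\omega-s)$ for $y\in D(L_0)$, and $L=L_0-V$ with $D(L)=D(L_0)$. Projections. For $\ell\in\mathbb{Z}$ let $(P_\ell x)(s)=\widehat{x}(\ell)e^{i2\pi\ell s/\omega}$, $\widehat{x}(\ell)=\frac1\omega\int_0^\omega x(\tau)e^{-i2\pi\ell\tau/\omega}d\tau$ (the spectral projections of $L_0$), $\mathcal{H}_\ell=\mathrm{Im}\,P_\ell$, $\mathcal{P}=\{P_\ell:\ell\in\mathbb{Z}\}$,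 and for $m\in\mathbb{Z}_+=\mathbb{N}\cup\{0\}$ let $P_{(m)}=\sum_{|\ell|\le m}P_\ell$, $\mathcal{H}_{(m)}=\mathrm{Im}\,P_{(m)}$. $\mathfrak{S}_2(\mathcal{H},\mathcal{P})$ is the set of $X\in B(\mathcal{H})$ with $\|X\|_{2,\mathcal{P}}^2=\sum_{j,\ell\in\mathbb{Z}}\|P_jXP_\ell\|^2<\infty$ (operator norms inside the sum). (Such $k,U,V_0$ always exist.) *)

theory Defs
  imports "HOL-Analysis.Analysis"
begin

section \<open>Complex Hilbert spaces\<close>

class scaleC =
  fixes scaleC :: "complex \<Rightarrow> 'a \<Rightarrow> 'a"  (infixr \<open>*\<^sub>C\<close> 75)

class complex_vector = scaleC + ab_group_add +
  assumes scaleC_add_right: "a *\<^sub>C (x + y) = a *\<^sub>C x + a *\<^sub>C y"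
    and scaleC_add_left: "(a + b) *\<^sub>C x = a *\<^sub>C x + b *\<^sub>C x"
    and scaleC_scaleC: "a *\<^sub>C (b *\<^sub>C x) = (a * b) *\<^sub>C x"
    and scaleC_one: "1 *\<^sub>C x = x"

text \<open>The inner product is linear in the first argument. Completeness, the topology and the
  underlying real normed space come from \<^class>\<open>banach\<close>.\<close>

class complex_hilbert = complex_vector + banach +
  fixes cinner :: "'a \<Rightarrow> 'a \<Rightarrow> complex"
  assumes scaleR_eq_scaleC: "r *\<^sub>R x = complex_of_real r *\<^sub>C x"
    and cinner_commute: "cinner x y = cnj (cinner y x)"
    and cinner_add_left: "cinner (x + y) z = cinner x z + cinner y z"
    and cinner_scaleC_left: "cinner (c *\<^sub>C x) y = c * cinner x y"
    and cinner_self_nonneg: "0 \<le> Re (cinner x x)"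
    and norm_eq_sqrt_cinner: "norm x = sqrt (Re (cinner x x))"

instantiation complex :: complex_hilbert
begin

definition scaleC_complex :: "complex \<Rightarrow> complex \<Rightarrow> complex"
  where "scaleC_complex c x = c * x"

definition cinner_complex :: "complex \<Rightarrow> complex \<Rightarrow> complex"
  where "cinner_complex x y = x * cnj y"

instance
  by standard
    (simp_all add: scaleC_complex_def cinner_complex_def algebra_simps scaleR_conv_of_real
      cmod_def power2_eq_square)

end

definition bounded_clinear :: "('h::complex_hilbert \<Rightarrow> 'h) \<Rightarrow> bool" where
  "bounded_clinear T \<longleftrightarrow> bounded_linear T \<and> (\<forall>c x. T (c *\<^sub>C x) = c *\<^sub>C T x)"


section \<open>Bochner integral without a separability assumption\<close>

text \<open>The library's \<^const>\<open>has_bochner_integral\<close> requires a second countable codomain. The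
  definition below is the same one with Borel measurability replaced by strong measurability
  (a.e. limit of simple functions). It is meant for complete measures; it is used
  here only with Lebesgue measure on intervals.\<close>

definition strongly_measurable :: "'a measure \<Rightarrow> ('a \<Rightarrow> 'b::real_normed_vector) \<Rightarrow> bool" where
  "strongly_measurable M f \<longleftrightarrow>
     (\<exists>s. (\<forall>i::nat. simple_function M (s i)) \<and> (AE x in M. (\<lambda>i. s i x) \<longlonglongrightarrow> f x))"

definition has_bint :: "'a measure \<Rightarrow> ('a \<Rightarrow> 'b::real_normed_vector) \<Rightarrow> 'b \<Rightarrow> bool" where
  "has_bint M f I \<longleftrightarrow> strongly_measurable M f \<and>
     (\<exists>s. (\<forall>i::nat. Bochner_Integration.simple_bochner_integrable M (s i)) \<and>
          (\<lambda>i. \<integral>\<^sup>+x. ennreal (norm (f x - s i x)) \<partial>M) \<longlonglongrightarrow> 0 \<and>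
          (\<lambda>i. Bochner_Integration.simple_bochner_integral M (s i)) \<longlonglongrightarrow> I)"

definition bint :: "'a measure \<Rightarrow> ('a \<Rightarrow> 'b::real_normed_vector) \<Rightarrow> 'b" where
  "bint M f = (THE I. has_bint M f I)"

lemma has_bochner_integral_imp_has_bint:
  assumes "has_bochner_integral M f I"
  shows "has_bint M f I"
proof -
  from assms obtain s where f: "f \<in> borel_measurable M"
    and s: "\<And>i::nat. Bochner_Integration.simple_bochner_integrable M (s i)"
      "(\<lambda>i. \<integral>\<^sup>+x. ennreal (norm (f x - s i x)) \<partial>M) \<longlonglongrightarrow> 0"
      "(\<lambda>i. Bochner_Integration.simple_bochner_integral M (s i)) \<longlonglongrightarrow> I"
    by (auto elim!: has_bochner_integral.cases)
  obtain F where "\<forall>i. simple_function M (F i)" "\<forall>x\<in>space M. (\<lambda>i. F i x) \<longlonglongrightarrow> f x"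
    using borel_measurable_implies_sequence_metric[OF f, of undefined] by blast
  then have "strongly_measurable M f"
    unfolding strongly_measurable_def by (intro exI[of _ F]) auto
  with s show ?thesis
    unfolding has_bint_def by blast
qed

text \<open>\<open>fcoeff \<omega> f n\<close> is the Fourier coefficient of \<open>f\<close> on \<open>[0, \<omega>]\<close>.\<close>

definition fcoeff :: "real \<Rightarrow> (real \<Rightarrow> 'h::complex_hilbert) \<Rightarrow> int \<Rightarrow> 'h" where
  "fcoeff \<omega> f n = complex_of_real (1 / \<omega>) *\<^sub>C
     bint (lebesgue_on {0..\<omega>})
       (\<lambda>s. exp (- (\<i> * complex_of_real (2 * pi * of_int n * s / \<omega>))) *\<^sub>C f s)"


section \<open>The space of square integrable functions on an interval\<close>

text \<open>Arbitrary functions on the real line modulo equality Lebesgue-almost everywhere.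
  The space \<open>L\<^sup>2([0, \<omega>], H)\<close> is the subspace \<open>L2 \<omega>\<close> of this vector space defined below, where
  functions on \<open>[0, \<omega>]\<close> are extended by zero.\<close>

quotient_type 'h aefun = "real \<Rightarrow> 'h" / "\<lambda>f g. AE s in lebesgue. f s = g s"
proof (rule equivpI)
  show "reflp (\<lambda>f g :: real \<Rightarrow> 'h. AE s in lebesgue. f s = g s)"
    by (simp add: reflp_def)
  show "symp (\<lambda>f g :: real \<Rightarrow> 'h. AE s in lebesgue. f s = g s)"
    by (simp add: symp_def eq_commute)
  show "transp (\<lambda>f g :: real \<Rightarrow> 'h. AE s in lebesgue. f s = g s)"
    unfolding transp_def by (intro allI impI) (erule (1) AE_mp[OF _ AE_mp], simp)
qed

instantiation aefun :: (complex_vector) complex_vector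
begin

lift_definition zero_aefun :: "'a aefun" is "\<lambda>_. 0" .

lift_definition plus_aefun :: "'a aefun \<Rightarrow> 'a aefun \<Rightarrow> 'a aefun" is "\<lambda>f g s. f s + g s"
  by (erule (1) AE_mp[OF _ AE_mp]) simp

lift_definition minus_aefun :: "'a aefun \<Rightarrow> 'a aefun \<Rightarrow> 'a aefun" is "\<lambda>f g s. f s - g s"
  by (erule (1) AE_mp[OF _ AE_mp]) simp

lift_definition uminus_aefun :: "'a aefun \<Rightarrow> 'a aefun" is "\<lambda>f s. - f s"
  by (erule AE_mp) simp

lift_definition scaleC_aefun :: "complex \<Rightarrow> 'a aefun \<Rightarrow> 'a aefun" is "\<lambda>c f s. c *\<^sub>C f s"
  by (erule AE_mp) simp

instance
  by standard
    (transfer; simp add: algebra_simps scaleC_add_right scaleC_add_left scaleC_scaleC scaleC_one)+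

end

text \<open>\<open>rep_aefun x\<close> is a representative of the class \<open>x\<close>; everything below that is defined
  through it depends on the class only. \<open>cls \<omega> f\<close> is the class of \<open>f\<close> restricted to \<open>[0, \<omega>]\<close>.\<close>

definition cls :: "real \<Rightarrow> (real \<Rightarrow> 'h::complex_hilbert) \<Rightarrow> 'h aefun" where
  "cls \<omega> f = abs_aefun (\<lambda>s. if s \<in> {0..\<omega>} then f s else 0)"

definition square_integrable :: "real \<Rightarrow> (real \<Rightarrow> 'h::complex_hilbert) \<Rightarrow> bool" where
  "square_integrable \<omega> f \<longleftrightarrow> strongly_measurable (lebesgue_on {0..\<omega>}) f \<and>
     (\<integral>\<^sup>+s. ennreal ((norm (f s))\<^sup>2) \<partial>lebesgue_on {0..\<omega>}) < \<infinity>"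

definition L2 :: "real \<Rightarrow> 'h::complex_hilbert aefun set" where
  "L2 \<omega> = {cls \<omega> f | f. square_integrable \<omega> f}"

definition l2_inner :: "real \<Rightarrow> 'h::complex_hilbert aefun \<Rightarrow> 'h aefun \<Rightarrow> complex" where
  "l2_inner \<omega> x y = complex_of_real (1 / \<omega>) *
     (LINT s|lebesgue_on {0..\<omega>}. cinner (rep_aefun x s) (rep_aefun y s))"

definition l2_norm :: "real \<Rightarrow> 'h::complex_hilbert aefun \<Rightarrow> real" where
  "l2_norm \<omega> x = sqrt (Re (l2_inner \<omega> x x))"


section \<open>Operators\<close>

text \<open>Operators on \<open>L\<^sup>2([0, \<omega>], H)\<close> are functions on \<^typ>\<open>'h aefun\<close> of which only the values on
  \<open>L2 \<omega>\<close> (or on the domain, for unbounded operators) matter.\<close>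

definition bounded_ops :: "real \<Rightarrow> ('h::complex_hilbert aefun \<Rightarrow> 'h aefun) set" where
  "bounded_ops \<omega> = {X. (\<forall>x\<in>L2 \<omega>. X x \<in> L2 \<omega>) \<and>
     (\<forall>x\<in>L2 \<omega>. \<forall>y\<in>L2 \<omega>. X (x + y) = X x + X y) \<and>
     (\<forall>c. \<forall>x\<in>L2 \<omega>. X (c *\<^sub>C x) = c *\<^sub>C X x) \<and>
     (\<exists>C. \<forall>x\<in>L2 \<omega>. l2_norm \<omega> (X x) \<le> C * l2_norm \<omega> x)}"

definition op_norm :: "real \<Rightarrow> ('h::complex_hilbert aefun \<Rightarrow> 'h aefun) \<Rightarrow> real" where
  "op_norm \<omega> X = (SUP x\<in>{x \<in> L2 \<omega>. l2_norm \<omega> x \<le> 1}. l2_norm \<omega> (X x))"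

definition continuously_invertible ::
  "real \<Rightarrow> ('h::complex_hilbert aefun \<Rightarrow> 'h aefun) \<Rightarrow> bool" where
  "continuously_invertible \<omega> X \<longleftrightarrow>
     (\<exists>Y\<in>bounded_ops \<omega>. \<forall>x\<in>L2 \<omega>. Y (X x) = x \<and> X (Y x) = x)"

definition P :: "real \<Rightarrow> int \<Rightarrow> 'h::complex_hilbert aefun \<Rightarrow> 'h aefun" where
  "P \<omega> l x = cls \<omega> (\<lambda>s. exp (\<i> * complex_of_real (2 * pi * of_int l * s / \<omega>)) *\<^sub>C
     fcoeff \<omega> (rep_aefun x) l)"

definition P_upto :: "real \<Rightarrow> nat \<Rightarrow> 'h::complex_hilbert aefun \<Rightarrow> 'h aefun" where
  "P_upto \<omega> m x = (\<Sum>l | \<bar>l\<bar> \<le> int m. P \<omega> l x)"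

definition Hsub :: "real \<Rightarrow> int \<Rightarrow> 'h::complex_hilbert aefun set" where
  "Hsub \<omega> l = P \<omega> l ` L2 \<omega>"

definition Hsub_upto :: "real \<Rightarrow> nat \<Rightarrow> 'h::complex_hilbert aefun set" where
  "Hsub_upto \<omega> m = P_upto \<omega> m ` L2 \<omega>"

definition S2 :: "real \<Rightarrow> ('h::complex_hilbert aefun \<Rightarrow> 'h aefun) set" where
  "S2 \<omega> = {X \<in> bounded_ops \<omega>.
     (\<lambda>(j, l). (op_norm \<omega> (P \<omega> j \<circ> X \<circ> P \<omega> l))\<^sup>2) summable_on (UNIV :: (int \<times> int) set)}"

text \<open>Spectrum of an operator \<open>A\<close> with domain \<open>D \<subseteq> X\<close> in the space \<open>X\<close> normed by \<open>N\<close>.\<close>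

definition spectrum ::
  "('v::complex_vector \<Rightarrow> real) \<Rightarrow> 'v set \<Rightarrow> 'v set \<Rightarrow> ('v \<Rightarrow> 'v) \<Rightarrow> complex set" where
  "spectrum N X D A = {z. \<not> (bij_betw (\<lambda>x. A x - z *\<^sub>C x) D X \<and>
     (\<exists>C. \<forall>y\<in>X. N (inv_into D (\<lambda>x. A x - z *\<^sub>C x) y) \<le> C * N y))}"

definition max_modulus :: "complex set \<Rightarrow> real" where
  "max_modulus S = (GREATEST r. r \<in> cmod ` S)"


section \<open>The operators \<open>L\<^sub>0\<close>, \<open>V\<close> and \<open>L\<close>\<close>

text \<open>\<open>W21_deriv \<omega> f z\<close>: \<open>f\<close> is (on \<open>[0, \<omega>]\<close>) the continuous representative of an element of
  the Sobolev space with derivative \<open>z\<close>, that is, \<open>f\<close> is an indefinite integral of \<open>z\<close>.\<close>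

definition W21_deriv ::
  "real \<Rightarrow> (real \<Rightarrow> 'h::complex_hilbert) \<Rightarrow> 'h aefun \<Rightarrow> bool" where
  "W21_deriv \<omega> f z \<longleftrightarrow> continuous_on {0..\<omega>} f \<and> z \<in> L2 \<omega> \<and>
     (\<forall>t\<in>{0..\<omega>}. has_bint (lebesgue_on {0..t}) (rep_aefun z) (f t - f 0))"

definition dom_L0 :: "real \<Rightarrow> 'h::complex_hilbert aefun set" where
  "dom_L0 \<omega> = {cls \<omega> f | f. (\<exists>z. W21_deriv \<omega> f z) \<and> f 0 = f \<omega>}"

definition L0 :: "real \<Rightarrow> 'h::complex_hilbert aefun \<Rightarrow> 'h aefun" where
  "L0 \<omega> y = (THE z. \<exists>f. y = cls \<omega> f \<and> W21_deriv \<omega> f z)"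

definition V_op ::
  "real \<Rightarrow> (real \<Rightarrow> 'h::complex_hilbert \<Rightarrow> 'h) \<Rightarrow> 'h aefun \<Rightarrow> 'h aefun" where
  "V_op \<omega> \<V> y = cls \<omega> (\<lambda>s. \<V> s (rep_aefun y (\<omega> - s)))"

definition L_op ::
  "real \<Rightarrow> (real \<Rightarrow> 'h::complex_hilbert \<Rightarrow> 'h) \<Rightarrow> 'h aefun \<Rightarrow> 'h aefun" where
  "L_op \<omega> \<V> y = L0 \<omega> y - V_op \<omega> \<V> y"

definition V_hat ::
  "real \<Rightarrow> (real \<Rightarrow> 'h::complex_hilbert \<Rightarrow> 'h) \<Rightarrow> int \<Rightarrow> 'h \<Rightarrow> 'h" where
  "V_hat \<omega> \<V> n x = fcoeff \<omega> (\<lambda>s. \<V> s x) n"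

text \<open>The inner operator series over \<open>n \<noteq> l\<close> of the second condition on the potential. Once the
  squared norms of the Fourier coefficients are summable, it converges absolutely in operator
  norm, so that summing it pointwise makes no difference.\<close>

definition V_conv ::
  "real \<Rightarrow> (real \<Rightarrow> 'h::complex_hilbert \<Rightarrow> 'h) \<Rightarrow> int \<Rightarrow> int \<Rightarrow> 'h \<Rightarrow> 'h" where
  "V_conv \<omega> \<V> j l x = (\<Sum>\<^sub>\<infinity>n\<in>UNIV - {l}.
     (1 / of_int (l - n)) *\<^sub>C V_hat \<omega> \<V> (j + n) (V_hat \<omega> \<V> (l + n) x))"

definition admissible_potential ::
  "real \<Rightarrow> (real \<Rightarrow> 'h::complex_hilbert \<Rightarrow> 'h) \<Rightarrow> bool" where
  "admissible_potential \<omega> \<V> \<longleftrightarrow>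
     (\<forall>s\<in>{0..\<omega>}. bounded_clinear (\<V> s)) \<and>
     (\<forall>x. square_integrable \<omega> (\<lambda>s. \<V> s x)) \<and>
     (\<lambda>n. (onorm (V_hat \<omega> \<V> n))\<^sup>2) summable_on UNIV \<and>
     (\<lambda>(j, l). (onorm (V_conv \<omega> \<V> j l))\<^sup>2) summable_on UNIV"

end

theory Submission
  imports Defs "HOL-Complex_Analysis.Cauchy_Integral_Formula"
begin

text \<open>\<open>U\<close> intertwines \<open>L\<close> with \<open>L\<^sub>0 - V\<^sub>0\<close>, so both have the same spectrum. On the level of Fourier
  coefficients \<open>L\<^sub>0 - V\<^sub>0\<close> is block diagonal, and it acts on
  \<open>\<H>\<^sub>l\<close> as \<open>2\<pi>il/\<omega> - V\<^sub>0\<close>. A point outside the spectra of all blocks has block resolvents of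
  norm \<open>O(1/\<bar>l\<bar>)\<close>, because \<open>V\<^sub>0\<close> is bounded. Hence the block solutions of \<open>(L\<^sub>0 - V\<^sub>0 - z) x = y\<close> have
  absolutely summable norms and sum up to a continuous function \<open>x\<close>; comparing coefficients,
  \<open>y + V\<^sub>0 x + z x\<close> is its derivative. Finally \<open>\<sigma>\<^sub>l\<close> is nonempty and compact, and it lies in the disc of
  radius \<open>\<parallel>P\<^sub>l V\<^sub>0 P\<^sub>l\<parallel>\<close>, which is square summable because \<open>V\<^sub>0\<close> lies in \<open>S2\<close>.\<close>


section \<open>Complex Hilbert spaces\<close>

text \<open>Invariance of the blocks says only how \<open>V0\<close> acts on finite sums of block
  vectors. To read the coefficients of \<open>V0 x\<close> off block by block, \<open>x\<close> has
  to be a norm limit of its finite truncations, and this is arranged through absolute summability of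
  the coefficients. Elements of the domain have it because the coefficient of \<open>x\<close> at l
  is at most a multiple of that of \<open>L0 x\<close> divided by |l|; the assembled block solutions
  have it because of the factor 1/|l|. In both cases Cauchy-Schwarz is applied to square summable
  weights and Bessel's inequality. The abstract argument thus lives on coefficient sequences and
  works from uniqueness, Bessel's inequality and the existence of vectors with given absolutely
  summable coefficients. H may be nonseparable and of infinite dimension. Hence measurability means
  almost everywhere approximation by simple functions, and statements on vector functions are
  reduced to the scalar functions \<open>cinner (f s) y\<close>. Moreover \<sigma>_l is the spectrum
  of a bounded operator, not of a matrix, so its nonemptiness rests on Liouville's theorem.\<close>

interpretation complex_vector: vector_space "scaleC :: complex \<Rightarrow> 'v::complex_vector \<Rightarrow> 'v"
  by standard (simp_all add: scaleC_add_right scaleC_add_left scaleC_scaleC scaleC_one)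

lemma cinner_add_right: "cinner x (y + z) = cinner x y + cinner x z"
  by (metis cinner_add_left cinner_commute complex_cnj_add)

lemma cinner_scaleC_right: "cinner x (c *\<^sub>C y) = cnj c * cinner x y"
  by (metis cinner_scaleC_left cinner_commute complex_cnj_mult)

lemma cinner_zero_left [simp]: "cinner 0 y = 0"
  using cinner_add_left[of 0 0 y] by simp

lemma cinner_zero_right [simp]: "cinner x 0 = 0"
  using cinner_add_right[of x 0 0] by simp

lemma cinner_minus_left: "cinner (- x) y = - cinner x y"
  using cinner_add_left[of x "- x" y] by (simp add: eq_neg_iff_add_eq_0 add.commute)

lemma cinner_minus_right: "cinner x (- y) = - cinner x y"
  using cinner_add_right[of x y "- y"] by (simp add: eq_neg_iff_add_eq_0 add.commute)

lemma cinner_diff_left: "cinner (x - y) z = cinner x z - cinner y z"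
  using cinner_add_left[of x "- y" z] by (simp add: cinner_minus_left)

lemma cinner_diff_right: "cinner x (y - z) = cinner x y - cinner x z"
  using cinner_add_right[of x y "- z"] by (simp add: cinner_minus_right)

lemma cinner_sum_right: "cinner x (\<Sum>i\<in>I. f i) = (\<Sum>i\<in>I. cinner x (f i))"
  by (induction I rule: infinite_finite_induct) (simp_all add: cinner_add_right)

lemma cinner_self: "cinner x x = complex_of_real ((norm x)\<^sup>2)"
proof -
  have "Im (cinner x x) = 0"
    by (metis cinner_commute complex_cnj_cancel_iff cnj.sel(2) equal_neg_zero)
  then show ?thesis
    by (simp add: complex_eq_iff norm_eq_sqrt_cinner cinner_self_nonneg)
qed

lemma cinner_self_eq_0_iff [simp]: "cinner x x = 0 \<longleftrightarrow> x = 0"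
  by (simp add: cinner_self)

lemma cinner_eqI:
  assumes "\<And>y. cinner a y = cinner b y" shows "a = b"
proof -
  have "cinner (a - b) (a - b) = 0"
    unfolding cinner_diff_left assms by simp
  then show ?thesis by simp
qed

lemma norm_scaleC: "norm (c *\<^sub>C x) = cmod c * norm (x :: 'h::complex_hilbert)"
proof -
  have "cinner (c *\<^sub>C x) (c *\<^sub>C x) = (c * cnj c) * cinner x x"
    by (simp add: cinner_scaleC_left cinner_scaleC_right)
  then have "complex_of_real ((norm (c *\<^sub>C x))\<^sup>2) = complex_of_real ((cmod c * norm x)\<^sup>2)"
    unfolding cinner_self complex_norm_square[symmetric] power_mult_distrib by simp
  then have "(norm (c *\<^sub>C x))\<^sup>2 = (cmod c * norm x)\<^sup>2"
    using of_real_eq_iff by blast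
  then show ?thesis
    by (simp add: power2_eq_iff_nonneg)
qed

lemma norm_diff_square:
  "(norm (x - y))\<^sup>2 = (norm x)\<^sup>2 + (norm y)\<^sup>2 - 2 * Re (cinner x y)" for x y :: "'h::complex_hilbert"
proof -
  have "complex_of_real ((norm (x - y))\<^sup>2) = (norm x)\<^sup>2 + (norm y)\<^sup>2 - (cinner x y + cnj (cinner x y))"
    unfolding cinner_self[symmetric, of "x - y"] cinner_diff_left cinner_diff_right
    by (simp add: cinner_self cinner_commute[of y x])
  then have "Re (complex_of_real ((norm (x - y))\<^sup>2)) = Re \<dots>"
    by (rule arg_cong)
  then show ?thesis
    by (simp add: complex_add_cnj)
qed

lemma norm_cinner_le: "cmod (cinner x y) \<le> norm x * norm (y :: 'h::complex_hilbert)"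
proof (cases "y = 0")
  case False
  \<comment> \<open>\<open>c *\<^sub>C y\<close> is the orthogonal projection of \<open>x\<close>
    onto the line of \<open>y\<close>; the inequality is nonnegativity of the squared
    distance.\<close>
  define c where "c = cinner x y / complex_of_real ((norm y)\<^sup>2)"
  have nc: "cmod c = cmod (cinner x y) / (norm y)\<^sup>2"
    by (simp add: c_def norm_divide norm_power)
  have "cinner x (c *\<^sub>C y) = complex_of_real ((cmod (cinner x y))\<^sup>2 / (norm y)\<^sup>2)"
    using complex_norm_square[of "cinner x y"]
    by (simp add: cinner_scaleC_right c_def mult.commute)
  then have "Re (cinner x (c *\<^sub>C y)) = (cmod (cinner x y))\<^sup>2 / (norm y)\<^sup>2"
    by simp
  moreover have "(norm (c *\<^sub>C y))\<^sup>2 = (cmod (cinner x y))\<^sup>2 / (norm y)\<^sup>2"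
    using False by (simp add: norm_scaleC nc power_mult_distrib power_divide power2_eq_square)
  ultimately have "(norm (x - c *\<^sub>C y))\<^sup>2 = (norm x)\<^sup>2 - (cmod (cinner x y))\<^sup>2 / (norm y)\<^sup>2"
    by (simp add: norm_diff_square)
  then have "(cmod (cinner x y))\<^sup>2 / (norm y)\<^sup>2 \<le> (norm x)\<^sup>2"
    using zero_le_power2[of "norm (x - c *\<^sub>C y)"] by linarith
  then have "(cmod (cinner x y))\<^sup>2 \<le> (norm x * norm y)\<^sup>2"
    using False by (simp add: divide_le_eq power_mult_distrib)
  then show ?thesis
    by (rule power2_le_imp_le) simp
qed simp

lemma scaleR_scaleC_commute: "r *\<^sub>R (c *\<^sub>C x) = c *\<^sub>C (r *\<^sub>R x)" for x :: "'h::complex_hilbert"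
  by (simp add: scaleR_eq_scaleC scaleC_scaleC mult.commute)

lemma bounded_bilinear_scaleC:
  "bounded_bilinear (scaleC :: complex \<Rightarrow> 'h::complex_hilbert \<Rightarrow> 'h)"
proof
  show "\<exists>K. \<forall>a b. norm (a *\<^sub>C (b::'h)) \<le> norm a * norm b * K"
    by (intro exI[of _ 1]) (simp add: norm_scaleC)
  show "(r *\<^sub>R a) *\<^sub>C (b::'h) = r *\<^sub>R (a *\<^sub>C b)" for r a b
    unfolding scaleR_eq_scaleC[of r "a *\<^sub>C b"] scaleC_scaleC scaleR_conv_of_real ..
qed (simp_all add: scaleC_add_left scaleC_add_right scaleR_scaleC_commute)

lemma bounded_bilinear_cinner:
  "bounded_bilinear (cinner :: 'h::complex_hilbert \<Rightarrow> 'h \<Rightarrow> complex)"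
proof
  show "\<exists>K. \<forall>a b. norm (cinner a (b::'h)) \<le> norm a * norm b * K"
    by (intro exI[of _ 1]) (simp add: norm_cinner_le)
  show "cinner (r *\<^sub>R a) (b::'h) = r *\<^sub>R cinner a b"
    "cinner a (r *\<^sub>R b) = r *\<^sub>R cinner a b" for r and a b :: 'h
    unfolding scaleR_eq_scaleC[of r a] scaleR_eq_scaleC[of r b] cinner_scaleC_left cinner_scaleC_right
      scaleR_conv_of_real by simp_all
qed (simp_all add: cinner_add_left cinner_add_right)

lemma bounded_linear_cinner_left: "bounded_linear (\<lambda>x. cinner x y)"
  by (rule bounded_bilinear.bounded_linear_left[OF bounded_bilinear_cinner])

lemma bounded_linear_scaleC_right: "bounded_linear (\<lambda>x::'h::complex_hilbert. c *\<^sub>C x)"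
  by (rule bounded_bilinear.bounded_linear_right[OF bounded_bilinear_scaleC])

section \<open>Spectra\<close>

text \<open>A bound on the inverse is a lower bound on the operator, since \<open>inv_into\<close>
  is the two-sided inverse once the map is bijective. In this form no inverse has to be written
  down.\<close>

lemma notin_spectrum_iff:
  "z \<notin> spectrum N X D A \<longleftrightarrow> bij_betw (\<lambda>x. A x - z *\<^sub>C x) D X \<and>
     (\<exists>C. \<forall>x\<in>D. N x \<le> C * N (A x - z *\<^sub>C x))"
proof -
  let ?f = "\<lambda>x. A x - z *\<^sub>C x"
  have "(\<forall>y\<in>X. N (inv_into D ?f y) \<le> C * N y) \<longleftrightarrow> (\<forall>x\<in>D. N x \<le> C * N (?f x))"
    if "bij_betw ?f D X" for C
  proof
    assume *: "\<forall>y\<in>X. N (inv_into D ?f y) \<le> C * N y"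
    show "\<forall>x\<in>D. N x \<le> C * N (?f x)"
    proof
      fix x assume x: "x \<in> D"
      then have "?f x \<in> X" "inv_into D ?f (?f x) = x"
        using that bij_betwE bij_betw_inv_into_left by (fast, fast)
      then show "N x \<le> C * N (?f x)"
        using * by metis
    qed
  next
    assume *: "\<forall>x\<in>D. N x \<le> C * N (?f x)"
    show "\<forall>y\<in>X. N (inv_into D ?f y) \<le> C * N y"
    proof
      fix y assume y: "y \<in> X"
      then have "inv_into D ?f y \<in> D" "?f (inv_into D ?f y) = y"
        using that inv_into_into[of y ?f D] bij_betw_inv_into_right[of ?f D X y]
        by (auto simp: bij_betw_def)
      then show "N (inv_into D ?f y) \<le> C * N y"
        using * by metis
    qed
  qed
  then show ?thesis
    unfolding spectrum_def by auto
qed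

lemma notin_spectrumI:
  assumes "bij_betw (\<lambda>x. A x - z *\<^sub>C x) D X" "\<And>x. x \<in> D \<Longrightarrow> N x \<le> C * N (A x - z *\<^sub>C x)"
  shows "z \<notin> spectrum N X D A"
  using assms unfolding notin_spectrum_iff by blast

text \<open>Conjugation by an isometric bijection \<open>\<phi>\<close>. It serves to replace a
  one-frequency subspace by the coefficient space itself.\<close>

lemma spectrum_transport:
  assumes \<phi>: "bij_betw \<phi> X' X" and N: "\<And>x. x \<in> X' \<Longrightarrow> N (\<phi> x) = N' x"
    and A: "\<And>z x. x \<in> X' \<Longrightarrow> A (\<phi> x) - z *\<^sub>C \<phi> x = \<phi> (A' x - z *\<^sub>C x)"
    and closed: "\<And>z x. x \<in> X' \<Longrightarrow> A' x - z *\<^sub>C x \<in> X'"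
  shows "spectrum N X X A = spectrum N' X' X' A'"
proof -
  have "z \<notin> spectrum N X X A \<longleftrightarrow> z \<notin> spectrum N' X' X' A'" for z
  proof -
    let ?f = "\<lambda>x. A x - z *\<^sub>C x" and ?g = "\<lambda>x. A' x - z *\<^sub>C x"
    have "bij_betw ?f X X \<longleftrightarrow> bij_betw (?f \<circ> \<phi>) X' X"
      using \<phi> bij_betw_comp_iff by blast
    also have "\<dots> \<longleftrightarrow> bij_betw (\<phi> \<circ> ?g) X' X"
      by (rule bij_betw_cong) (simp add: A)
    also have "\<dots> \<longleftrightarrow> bij_betw ?g X' X'"
      using bij_betw_comp_iff2[OF \<phi>, of ?g X'] closed by blast
    finally have 1: "bij_betw ?f X X \<longleftrightarrow> bij_betw ?g X' X'" .
    have "X = \<phi> ` X'"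
      using \<phi> by (simp add: bij_betw_def)
    then have "(\<forall>x\<in>X. N x \<le> C * N (?f x)) \<longleftrightarrow> (\<forall>x\<in>X'. N' x \<le> C * N' (?g x))" for C
      by (simp add: N A closed)
    with 1 show ?thesis
      unfolding notin_spectrum_iff by simp
  qed
  then show ?thesis by blast
qed

lemma spectrum_shift:
  "spectrum N X D (\<lambda>x. a *\<^sub>C x + A x) = (\<lambda>z. a + z) ` spectrum N X D A"
proof -
  have "z \<in> spectrum N X D (\<lambda>x. a *\<^sub>C x + A x) \<longleftrightarrow> z - a \<in> spectrum N X D A" for z
    by (simp add: spectrum_def complex_vector.scale_left_diff_distrib algebra_simps)
  moreover have "z \<in> (\<lambda>z. a + z) ` spectrum N X D A \<longleftrightarrow> z - a \<in> spectrum N X D A" for z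
    by (auto intro!: image_eqI[of _ _ "z - a"])
  ultimately show ?thesis by blast
qed

lemma spectrum_cong:
  assumes "\<And>x. x \<in> D \<Longrightarrow> A x = B x"
  shows "spectrum N X D A = spectrum N X D B"
proof -
  have "z \<notin> spectrum N X D A \<longleftrightarrow> z \<notin> spectrum N X D B" for z
    unfolding notin_spectrum_iff using assms by (simp cong: bij_betw_cong)
  then show ?thesis by blast
qed

subsection \<open>Bounded operators on a Hilbert space\<close>

text \<open>The equation \<open>B x + E x = y\<close> is the fixed point equation
  \<open>x = inv B (y - E x)\<close>, whose right-hand side has Lipschitz constant
  \<open>C * e\<close>. This does the work of the Neumann series. The bound comes from absorbing
  \<open>C * e * norm x\<close> into the left-hand side.\<close>

lemma perturbed_bijection:
  fixes B E :: "'h::complex_hilbert \<Rightarrow> 'h"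
  assumes B: "linear B" "bij B" "\<And>x. norm x \<le> C * norm (B x)"
    and E: "linear E" "\<And>x. norm (E x) \<le> e * norm x" and "0 \<le> C" "0 \<le> e" "C * e < 1"
  shows "bij (\<lambda>x. B x + E x)" "norm x \<le> C / (1 - C * e) * norm (B x + E x)"
proof -
  have bound: "norm x \<le> C / (1 - C * e) * norm (B x + E x)" for x
  proof -
    have "norm x \<le> C * norm ((B x + E x) - E x)"
      using B(3) by simp
    also have "\<dots> \<le> C * (norm (B x + E x) + e * norm x)"
      using norm_triangle_ineq4[of "B x + E x" "E x"] E(2)[of x] \<open>0 \<le> C\<close>
      by (intro mult_left_mono) auto
    finally have "(1 - C * e) * norm x \<le> C * norm (B x + E x)"
      by (simp add: algebra_simps)
    then show ?thesis
      using \<open>C * e < 1\<close> by (simp add: field_simps)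
  qed
  then show "norm x \<le> C / (1 - C * e) * norm (B x + E x)" .
  have lin: "linear (\<lambda>x. B x + E x)"
    by (intro linear_compose_add B E)
  have "inj (\<lambda>x. B x + E x)"
  proof (subst linear_injective_0[OF lin], intro allI impI)
    fix x assume "B x + E x = 0"
    with bound[of x] show "x = 0" by simp
  qed
  moreover have "surj (\<lambda>x. B x + E x)"
  proof (rule surjI)
    fix y
    define F where "F x = inv B (y - E x)" for x
    have BF: "B (F x) = y - E x" for x
      unfolding F_def using \<open>bij B\<close> by (simp add: bij_is_surj surj_f_inv_f)
    have "dist (F u) (F v) \<le> (C * e) * dist u v" for u v
    proof -
      have "dist (F u) (F v) \<le> C * norm (B (F u - F v))"
        unfolding dist_norm by (rule B)
      also have "B (F u - F v) = E (v - u)"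
        by (simp add: linear_diff[OF B(1)] linear_diff[OF E(1)] BF)
      also have "norm (E (v - u)) \<le> e * norm (v - u)"
        by (rule E)
      finally show ?thesis
        using \<open>0 \<le> C\<close> by (simp add: mult.assoc mult_left_mono dist_norm norm_minus_commute)
    qed
    then have "\<exists>!x. F x = x"
      by (intro banach_fix_type[of "C * e"]) (use assms in auto)
    then have "\<exists>x. F x = x"
      by blast
    then have F: "F (SOME x. F x = x) = (SOME x. F x = x)"
      by (rule someI_ex)
    \<comment> \<open>\<open>surjI\<close> asks for an explicit preimage, so the fixed point is
      named by \<open>SOME\<close>, with \<open>F\<close> unfolded.\<close>
    show "B (SOME x. inv B (y - E x) = x) + E (SOME x. inv B (y - E x) = x) = y"
      using BF[of "SOME x. F x = x"] unfolding F by (simp add: F_def)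
  qed
  ultimately show "bij (\<lambda>x. B x + E x)"
    by (simp add: bij_def)
qed

context
  fixes T :: "'h::complex_hilbert \<Rightarrow> 'h" and b :: real
  assumes T: "bounded_clinear T" and T_bound: "\<And>x. norm (T x) \<le> b * norm x"
begin

lemma linear_resolvent: "linear (\<lambda>x. T x - z *\<^sub>C x)"
  using T unfolding bounded_clinear_def
  by (intro linear_compose_sub bounded_linear.linear bounded_linear_scaleC_right) auto

text \<open>\<open>T - z\<close> is seen as multiplication by \<open>- z\<close>, whose inverse is
  bounded by \<open>1 / cmod z\<close>, perturbed by \<open>T\<close>.\<close>

lemma resolvent_large:
  assumes "cmod z > b" "0 \<le> b"
  shows "bij (\<lambda>x. T x - z *\<^sub>C x)" "norm x \<le> 1 / (cmod z - b) * norm (T x - z *\<^sub>C x)"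
proof -
  have z: "z \<noteq> 0"
    using assms by auto
  have bij: "bij (\<lambda>x::'h. (- z) *\<^sub>C x)"
    by (rule bij_betw_byWitness[where f' = "\<lambda>x. (- 1 / z) *\<^sub>C x"]) (use z in \<open>auto simp: scaleC_scaleC scaleC_one\<close>)
  have *: "(\<lambda>x. T x - z *\<^sub>C x) = (\<lambda>x. (- z) *\<^sub>C x + T x)"
    by (simp add: fun_eq_iff)
  have P: "norm x \<le> 1 / cmod z * norm ((- z) *\<^sub>C x)" for x :: 'h
    using z by (simp add: norm_scaleC)
  have T': "linear T"
    using T by (simp add: bounded_clinear_def bounded_linear.linear)
  note p = perturbed_bijection[OF bounded_linear.linear[OF bounded_linear_scaleC_right] bij P T' T_bound]
  show "bij (\<lambda>x. T x - z *\<^sub>C x)"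
    unfolding * by (rule p) (use assms z in \<open>auto simp: divide_less_eq\<close>)
  have "norm x \<le> (1 / cmod z) / (1 - 1 / cmod z * b) * norm ((- z) *\<^sub>C x + T x)"
    by (rule p) (use assms z in \<open>auto simp: divide_less_eq\<close>)
  also have "(1 / cmod z) / (1 - 1 / cmod z * b) = 1 / (cmod z - b)"
    using z assms by (simp add: field_simps)
  finally show "norm x \<le> 1 / (cmod z - b) * norm (T x - z *\<^sub>C x)"
    by simp
qed

text \<open>\<open>T - w\<close> is \<open>T - z\<close> perturbed by the multiple
  \<open>z - w\<close> of the identity, so the resolvent bound stays under control near
  \<open>z\<close>. Openness of the resolvent set and continuity of the resolvent both come from
  here.\<close>

lemma resolvent_near:
  assumes "bij (\<lambda>x. T x - z *\<^sub>C x)" "\<And>x. norm x \<le> C * norm (T x - z *\<^sub>C x)" "0 \<le> C"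
    and "C * cmod (w - z) < 1"
  shows "bij (\<lambda>x. T x - w *\<^sub>C x)"
    "norm x \<le> C / (1 - C * cmod (w - z)) * norm (T x - w *\<^sub>C x)"
proof -
  have *: "T x - w *\<^sub>C x = (T x - z *\<^sub>C x) + (z - w) *\<^sub>C x" for x
    by (simp add: complex_vector.scale_left_diff_distrib)
  have E: "norm ((z - w) *\<^sub>C x) \<le> cmod (w - z) * norm x" for x :: 'h
    by (simp add: norm_scaleC norm_minus_commute)
  note p = perturbed_bijection[OF linear_resolvent assms(1,2)
      bounded_linear.linear[OF bounded_linear_scaleC_right] E assms(3) _ assms(4)]
  show "bij (\<lambda>x. T x - w *\<^sub>C x)"
    unfolding * by (rule p) auto
  show "norm x \<le> C / (1 - C * cmod (w - z)) * norm (T x - w *\<^sub>C x)"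
    unfolding * by (rule p) auto
qed

lemma closed_spectrum: "closed (spectrum norm UNIV UNIV T)"
  unfolding closed_def
proof (subst open_contains_ball, intro ballI)
  fix z assume "z \<in> - spectrum norm UNIV UNIV T"
  then obtain C where bij: "bij (\<lambda>x. T x - z *\<^sub>C x)" and C: "\<And>x. norm x \<le> C * norm (T x - z *\<^sub>C x)"
    by (auto simp: notin_spectrum_iff)
  \<comment> \<open>\<open>C\<close> may be zero or negative; \<open>\<bar>C\<bar> + 1\<close> is
    positive, so its inverse can serve as the radius of a ball.\<close>
  have C': "norm x \<le> (\<bar>C\<bar> + 1) * norm (T x - z *\<^sub>C x)" for x
    by (rule order_trans[OF C]) (simp add: mult_right_mono)
  have "w \<in> - spectrum norm UNIV UNIV T" if "w \<in> ball z (1 / (\<bar>C\<bar> + 1))" for w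
  proof -
    have "(\<bar>C\<bar> + 1) * cmod (w - z) < 1"
      using that by (simp add: dist_norm norm_minus_commute field_simps)
    then show ?thesis
      using notin_spectrumI[where N = norm and A = T and D = UNIV, OF resolvent_near[OF bij C', of w]] by simp
  qed
  then show "\<exists>e>0. ball z e \<subseteq> - spectrum norm UNIV UNIV T"
    by (intro exI[of _ "1 / (\<bar>C\<bar> + 1)"]) auto
qed

lemma spectrum_subset_cball:
  assumes "0 \<le> b"
  shows "spectrum norm UNIV UNIV T \<subseteq> cball 0 b"
proof
  fix z assume "z \<in> spectrum norm UNIV UNIV T"
  then show "z \<in> cball 0 b"
    using notin_spectrumI[where N = norm and A = T and D = UNIV, OF resolvent_large[OF _ assms, of z]]
    by (cases "cmod z \<le> b") auto
qed

text \<open>If the spectrum were empty, the matrix elements of the resolvent would be entire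
  functions vanishing at infinity.\<close>

lemma spectrum_nonempty:
  assumes "0 \<le> b" and "\<exists>x::'h. x \<noteq> 0"
  shows "spectrum norm UNIV UNIV T \<noteq> {}"
proof
  assume "spectrum norm UNIV UNIV T = {}"
  then have notin: "z \<notin> spectrum norm UNIV UNIV T" for z
    by blast
  define R where "R z = inv (\<lambda>x. T x - z *\<^sub>C x)" for z
  have bij: "bij (\<lambda>x. T x - z *\<^sub>C x)" for z
    using notin by (simp add: notin_spectrum_iff)
  have R: "T (R z y) - z *\<^sub>C R z y = y" for z y
    unfolding R_def using bij[of z, THEN bij_is_surj] by (rule surj_f_inv_f)
  have R': "R z (T x - z *\<^sub>C x) = x" for z x
    unfolding R_def using bij[of z, THEN bij_is_inj] by (rule inv_f_f)
  have "\<exists>C\<ge>0. \<forall>x. norm x \<le> C * norm (T x - z *\<^sub>C x)" for z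
  proof -
    obtain C where C: "\<And>x. norm x \<le> C * norm (T x - z *\<^sub>C x)"
      using notin by (auto simp: notin_spectrum_iff)
    have "norm x \<le> \<bar>C\<bar> * norm (T x - z *\<^sub>C x)" for x
      by (rule order_trans[OF C]) (simp add: mult_right_mono)
    then show ?thesis
      by (intro exI[of _ "\<bar>C\<bar>"]) auto
  qed
  then obtain C where C: "C z \<ge> 0" "norm x \<le> C z * norm (T x - z *\<^sub>C x)" for z x
    by metis
  have lin: "R z (y + y') = R z y + R z y'" "R z (c *\<^sub>C y) = c *\<^sub>C R z y" for z y y' c
  proof -
    have T': "T (x + y) = T x + T y" "T (c *\<^sub>C x) = c *\<^sub>C T x" for x y
      using T by (auto simp: bounded_clinear_def linear_add bounded_linear.linear)
    have "T (R z y + R z y') - z *\<^sub>C (R z y + R z y') =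
        (T (R z y) - z *\<^sub>C R z y) + (T (R z y') - z *\<^sub>C R z y')"
      by (simp add: T' scaleC_add_right algebra_simps)
    then show "R z (y + y') = R z y + R z y'"
      using R'[of z "R z y + R z y'"] by (simp add: R)
    have "T (c *\<^sub>C R z y) - z *\<^sub>C (c *\<^sub>C R z y) = c *\<^sub>C (T (R z y) - z *\<^sub>C R z y)"
      by (simp add: T' complex_vector.scale_right_diff_distrib scaleC_scaleC mult.commute)
    then show "R z (c *\<^sub>C y) = c *\<^sub>C R z y"
      using R'[of z "c *\<^sub>C R z y"] by (simp add: R)
  qed
  \<comment> \<open>First resolvent identity, obtained by applying \<open>R w\<close> to
    \<open>y\<close> written as \<open>(T u - w *\<^sub>C u) + (w - z) *\<^sub>C u\<close> with
    \<open>u = R z y\<close>. Continuity and differentiability in \<open>z\<close> both follow from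
    it.\<close>
  have resolvent_eq: "R w y = R z y + (w - z) *\<^sub>C R w (R z y)" for w z y
  proof -
    have "y = (T (R z y) - w *\<^sub>C R z y) + (w - z) *\<^sub>C R z y"
      using R[of z y] by (simp add: complex_vector.scale_left_diff_distrib)
    then have "R w y = R w ((T (R z y) - w *\<^sub>C R z y) + (w - z) *\<^sub>C R z y)"
      by (rule arg_cong)
    then show ?thesis
      by (simp only: lin R')
  qed
  \<comment> \<open>Near \<open>z\<close> the norm of \<open>R w (R z y)\<close> stays bounded, so
    by the resolvent identity \<open>R w y - R z y\<close> is of order
    \<open>cmod (w - z)\<close>.\<close>
  have tends: "((\<lambda>w. R w y) \<longlongrightarrow> R z y) (at z)" for z y
  proof (rule LIM_zero_cancel, rule Lim_null_comparison)
    let ?g = "\<lambda>w. C z / (1 - C z * cmod (w - z)) * (cmod (w - z) * norm (R z y))"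
    have "((\<lambda>w. C z * cmod (w - z)) \<longlongrightarrow> C z * cmod (z - z)) (at z)"
      by (intro tendsto_intros)
    then have "\<forall>\<^sub>F w in at z. C z * cmod (w - z) < 1"
      by (rule order_tendstoD(2)) simp
    then show "\<forall>\<^sub>F w in at z. norm (R w y - R z y) \<le> ?g w"
    proof eventually_elim
      case (elim w)
      have "norm (R w (R z y)) \<le> C z / (1 - C z * cmod (w - z)) * norm (T (R w (R z y)) - w *\<^sub>C R w (R z y))"
        by (rule resolvent_near[OF bij]) (use C elim in auto)
      then have "cmod (w - z) * norm (R w (R z y)) \<le>
          cmod (w - z) * (C z / (1 - C z * cmod (w - z)) * norm (R z y))"
        by (intro mult_left_mono) (simp_all add: R)
      then show "norm (R w y - R z y) \<le> ?g w"
        by (subst resolvent_eq[of w y z]) (simp add: norm_scaleC mult_ac)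
    qed
    have "(?g \<longlongrightarrow> C z / (1 - C z * cmod (z - z)) * (cmod (z - z) * norm (R z y))) (at z)"
      by (intro tendsto_intros) auto
    then show "(?g \<longlongrightarrow> 0) (at z)"
      by simp
  qed
  have "R z y = 0" for z and y :: 'h
  proof -
    have "cinner (R z y) w = 0" for w :: 'h
    proof (rule Liouville_weak_0[where f = "\<lambda>z. cinner (R z y) w"])
      show "(\<lambda>z. cinner (R z y) w) holomorphic_on UNIV"
      proof (rule holomorphic_onI)
        fix z
        have "((\<lambda>x. cinner (R x (R z y)) w) \<longlongrightarrow> cinner (R z (R z y)) w) (at z)"
          by (intro bounded_linear.tendsto[OF bounded_linear_cinner_left] tends)
        \<comment> \<open>By the resolvent identity the difference quotient at \<open>x\<close> is
          \<open>cinner (R x (R z y)) w\<close>, so its limit is an instance of the continuity just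
          shown.\<close>
        then have "((\<lambda>x. (cinner (R x y) w - cinner (R z y) w) / (x - z)) \<longlongrightarrow> cinner (R z (R z y)) w) (at z)"
        proof (rule LIM_equal2[OF zero_less_one, rotated])
          show "(cinner (R x y) w - cinner (R z y) w) / (x - z) = cinner (R x (R z y)) w"
            if "x \<noteq> z" for x
            using that unfolding resolvent_eq[of x y z]
            by (simp add: cinner_add_left cinner_scaleC_left)
        qed
        then show "(\<lambda>z. cinner (R z y) w) field_differentiable at z within UNIV"
          unfolding field_differentiable_def has_field_derivative_iff by blast
      qed
      have "filterlim (\<lambda>z. - b + cmod z) at_top at_infinity"
        by (rule filterlim_tendsto_add_at_top[OF tendsto_const filterlim_norm_at_top])
      then have "((\<lambda>z. 1 / (- b + cmod z)) \<longlongrightarrow> 0) at_infinity"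
        by (rule real_tendsto_divide_at_top[OF tendsto_const])
      then have lim: "((\<lambda>z. norm y * norm w * (1 / (- b + cmod z))) \<longlongrightarrow> norm y * norm w * 0) at_infinity"
        by (rule tendsto_mult_left)
      have bound: "\<forall>\<^sub>F z in at_infinity. norm (cinner (R z y) w) \<le> norm y * norm w * (1 / (- b + cmod z))"
      proof -
        have "\<forall>\<^sub>F z::complex in at_infinity. b + 1 \<le> cmod z"
          by (auto simp: eventually_at_infinity)
        then show ?thesis
        proof eventually_elim
          case (elim z)
          have "norm (cinner (R z y) w) \<le> norm (R z y) * norm w"
            by (rule norm_cinner_le)
          also have "norm (R z y) \<le> 1 / (cmod z - b) * norm (T (R z y) - z *\<^sub>C R z y)"
            by (rule resolvent_large) (use elim assms in auto)
          also have "\<dots> = 1 / (cmod z - b) * norm y"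
            by (simp add: R)
          finally show ?case
            by (simp add: mult_ac mult_right_mono)
        qed
      qed
      show "((\<lambda>z. cinner (R z y) w) \<longlongrightarrow> 0) at_infinity"
        using Lim_null_comparison[OF bound] lim by simp
    qed
    \<comment> \<open>The choice \<open>w = R z y\<close> turns the vanishing matrix element into
      the squared norm of \<open>R z y\<close>.\<close>
    from this[of "R z y"] show ?thesis
      by simp
  qed
  \<comment> \<open>A vanishing resolvent at \<open>0\<close> gives \<open>y = T 0 = 0\<close> for
    every \<open>y\<close>.\<close>
  then have "y = 0" for y :: 'h
    using R[of 0 y] T by (simp add: bounded_clinear_def linear_0 bounded_linear.linear)
  with assms show False
    by blast
qed

lemma spectral_radius_attained:
  assumes "0 \<le> b" and "\<exists>x::'h. x \<noteq> 0"
  shows "\<exists>z\<in>spectrum norm UNIV UNIV T. \<forall>z'\<in>spectrum norm UNIV UNIV T. cmod z' \<le> cmod z"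
proof -
  have "compact (spectrum norm UNIV UNIV T)"
    using spectrum_subset_cball[OF assms(1)] closed_spectrum
    by (metis bounded_cball bounded_subset compact_eq_bounded_closed)
  then show ?thesis
    using continuous_attains_sup[of "spectrum norm UNIV UNIV T" cmod] spectrum_nonempty[OF assms]
    by (auto intro: continuous_intros)
qed

end

text \<open>\<open>B - z\<close> is \<open>A - z\<close> conjugated by \<open>U\<close>, which maps
  both \<open>D\<close> and \<open>X\<close> onto themselves; one constant \<open>c\<close> bounds
  \<open>U\<close> and its inverse. A resolvent bound \<open>C\<close> on one side becomes
  \<open>c * \<bar>C\<bar> * c\<close> on the other, the absolute value allowing for a negative
  \<open>C\<close>.\<close>

lemma spectrum_similar:
  assumes U: "inj_on U X" "U ` D = D" "U ` X = X" and "D \<subseteq> X"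
    and c: "\<And>x. x \<in> X \<Longrightarrow> N (U x) \<le> c * N x" "\<And>x. x \<in> X \<Longrightarrow> N x \<le> c * N (U x)"
    and "0 \<le> c" and N: "\<And>x. x \<in> X \<Longrightarrow> 0 \<le> N x"
    and AB: "\<And>z x. x \<in> D \<Longrightarrow> B (U x) - z *\<^sub>C U x = U (A x - z *\<^sub>C x)"
    and A: "\<And>z x. x \<in> D \<Longrightarrow> A x - z *\<^sub>C x \<in> X"
  shows "spectrum N X D B = spectrum N X D A"
proof -
  have "z \<notin> spectrum N X D B \<longleftrightarrow> z \<notin> spectrum N X D A" for z
  proof -
    let ?f = "\<lambda>x. B x - z *\<^sub>C x" and ?g = "\<lambda>x. A x - z *\<^sub>C x"
    have D: "bij_betw U D D" and X: "bij_betw U X X"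
      using U \<open>D \<subseteq> X\<close> by (auto simp: bij_betw_def inj_on_subset)
    have "bij_betw ?f D X \<longleftrightarrow> bij_betw (?f \<circ> U) D X"
      using D bij_betw_comp_iff by blast
    also have "\<dots> \<longleftrightarrow> bij_betw (U \<circ> ?g) D X"
      by (rule bij_betw_cong) (simp add: AB)
    also have "\<dots> \<longleftrightarrow> bij_betw ?g D X"
      using bij_betw_comp_iff2[OF X, of ?g D] A by blast
    finally have 1: "bij_betw ?f D X \<longleftrightarrow> bij_betw ?g D X" .
    have "(\<exists>C. \<forall>x\<in>D. N x \<le> C * N (?f x)) \<longleftrightarrow> (\<exists>C. \<forall>x\<in>D. N (U x) \<le> C * N (U (?g x)))"
      using U(2) by (metis (no_types, lifting) AB image_iff)
    also have "\<dots> \<longleftrightarrow> (\<exists>C. \<forall>x\<in>D. N x \<le> C * N (?g x))"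
    proof
      assume "\<exists>C. \<forall>x\<in>D. N (U x) \<le> C * N (U (?g x))"
      then obtain C where C: "N (U x) \<le> C * N (U (?g x))" if "x \<in> D" for x
        by blast
      have "N x \<le> (c * \<bar>C\<bar> * c) * N (?g x)" if x: "x \<in> D" for x
      proof -
        have "N x \<le> c * N (U x)"
          using x \<open>D \<subseteq> X\<close> c(2) by blast
        also have "\<dots> \<le> c * (\<bar>C\<bar> * (c * N (?g x)))"
        proof (intro mult_left_mono \<open>0 \<le> c\<close>)
          have "U (?g x) \<in> X"
            using A[OF x] U(3) by blast
          then have "C * N (U (?g x)) \<le> \<bar>C\<bar> * N (U (?g x))"
            by (intro mult_right_mono N) auto
          also have "\<dots> \<le> \<bar>C\<bar> * (c * N (?g x))"
            using c(1)[OF A[OF x]] by (intro mult_left_mono) auto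
          finally show "N (U x) \<le> \<bar>C\<bar> * (c * N (?g x))"
            using C[OF x] by linarith
        qed
        finally show ?thesis by (simp add: mult.assoc)
      qed
      then show "\<exists>C. \<forall>x\<in>D. N x \<le> C * N (?g x)" by blast
    next
      assume "\<exists>C. \<forall>x\<in>D. N x \<le> C * N (?g x)"
      then obtain C where C: "N x \<le> C * N (?g x)" if "x \<in> D" for x
        by blast
      have "N (U x) \<le> (c * \<bar>C\<bar> * c) * N (U (?g x))" if x: "x \<in> D" for x
      proof -
        have "N (U x) \<le> c * N x"
          using x \<open>D \<subseteq> X\<close> c(1) by blast
        also have "\<dots> \<le> c * (\<bar>C\<bar> * (c * N (U (?g x))))"
        proof (intro mult_left_mono \<open>0 \<le> c\<close>)
          have "C * N (?g x) \<le> \<bar>C\<bar> * N (?g x)"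
            using A[OF x] by (intro mult_right_mono N) auto
          also have "\<dots> \<le> \<bar>C\<bar> * (c * N (U (?g x)))"
            using c(2)[OF A[OF x]] by (intro mult_left_mono) auto
          finally show "N x \<le> \<bar>C\<bar> * (c * N (U (?g x)))"
            using C[OF x] by linarith
        qed
        finally show ?thesis by (simp add: mult.assoc)
      qed
      then show "\<exists>C. \<forall>x\<in>D. N (U x) \<le> C * N (U (?g x))" by blast
    qed
    finally show ?thesis
      unfolding notin_spectrum_iff using 1 by simp
  qed
  then show ?thesis by blast
qed

section \<open>Square summability over the integers\<close>

text \<open>The integers are covered by the nonnegative and the nonpositive ones, which overlap in
  \<open>0\<close>; the term there is \<open>0\<close> because \<open>1 / 0 = 0\<close>.\<close>

lemma summable_on_int_inverse_square: "(\<lambda>l::int. (1 / of_int l)\<^sup>2 :: real) summable_on UNIV"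
proof -
  have nat: "(\<lambda>n::nat. (1 / real n)\<^sup>2) summable_on UNIV"
    using inverse_power_summable[of 2, where 'a = real]
    by (intro norm_summable_imp_summable_on) (simp add: power_divide inverse_eq_divide)
  have 1: "(\<lambda>l::int. (1 / of_int l)\<^sup>2 :: real) summable_on range int"
    using nat by (subst summable_on_reindex) (simp_all add: comp_def)
  have 2: "(\<lambda>l::int. (1 / of_int l)\<^sup>2 :: real) summable_on range (\<lambda>n. - int n)"
    using nat by (subst summable_on_reindex) (simp_all add: comp_def inj_on_def)
  have "UNIV = range int \<union> range (\<lambda>n. - int n)"
  proof -
    have "l \<in> range int \<union> range (\<lambda>n. - int n)" for l
      by (cases l rule: int_cases2) auto
    then show ?thesis by blast
  qed
  then show ?thesis
    using summable_on_union[OF 1 2] by simp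
qed

lemma summable_on_finite_support:
  fixes f :: "'a \<Rightarrow> real"
  assumes "finite F" shows "(\<lambda>x. if x \<in> F then f x else 0) summable_on UNIV"
  using summable_on_cong_neutral[of F UNIV "\<lambda>x. if x \<in> F then f x else 0" "\<lambda>x. if x \<in> F then f x else 0"] assms
  by auto

section \<open>Spaces described by coefficient sequences\<close>

text \<open>Models \<open>L2\<close> by its Fourier coefficients. The norm is a plain function
  \<open>N\<close> because the vectors form a subset of a type of classes of arbitrary functions,
  which carries no norm. Existence of a vector is demanded for absolutely summable coefficients;
  there the Fourier series converges uniformly, which also yields the norm bound in
  \<open>ex_hat\<close>.\<close>

locale coefficient_space =
  fixes X :: "'v::complex_vector set" and N :: "'v \<Rightarrow> real"
    and hat :: "'v \<Rightarrow> int \<Rightarrow> 'h::complex_hilbert"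
  assumes add_in: "\<And>x y. x \<in> X \<Longrightarrow> y \<in> X \<Longrightarrow> x + y \<in> X"
    and scaleC_in: "\<And>c x. x \<in> X \<Longrightarrow> c *\<^sub>C x \<in> X"
    and N_nonneg: "\<And>x. x \<in> X \<Longrightarrow> 0 \<le> N x"
    and hat_add: "\<And>x y l. x \<in> X \<Longrightarrow> y \<in> X \<Longrightarrow> hat (x + y) l = hat x l + hat y l"
    and hat_scaleC: "\<And>x c l. x \<in> X \<Longrightarrow> hat (c *\<^sub>C x) l = c *\<^sub>C hat x l"
    and hat_eq_0: "\<And>x. x \<in> X \<Longrightarrow> (\<And>l. hat x l = 0) \<Longrightarrow> x = 0"
    and bessel: "\<And>x F. x \<in> X \<Longrightarrow> finite F \<Longrightarrow> (\<Sum>l\<in>F. (norm (hat x l))\<^sup>2) \<le> (N x)\<^sup>2"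
    and ex_hat: "\<And>c. (\<lambda>l. norm (c l)) summable_on UNIV \<Longrightarrow>
      \<exists>x\<in>X. (\<forall>l. hat x l = c l) \<and> N x \<le> (\<Sum>\<^sub>\<infinity>l. norm (c l))"
begin

lemma diff_in: "x \<in> X \<Longrightarrow> y \<in> X \<Longrightarrow> x - y \<in> X"
  using add_in[of x "(-1) *\<^sub>C y"] scaleC_in[of y "-1"] by simp

lemma hat_diff: "x \<in> X \<Longrightarrow> y \<in> X \<Longrightarrow> hat (x - y) l = hat x l - hat y l"
  using hat_add[of x "(-1) *\<^sub>C y"] hat_scaleC[of y "-1"] scaleC_in[of y "-1"] by simp

lemma hat_inject: "x \<in> X \<Longrightarrow> y \<in> X \<Longrightarrow> (\<And>l. hat x l = hat y l) \<Longrightarrow> x = y"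
  using hat_eq_0[of "x - y"] by (simp add: diff_in hat_diff)

lemma zero_in [simp]: "0 \<in> X" and hat_zero [simp]: "hat 0 l = 0"
proof -
  obtain x where x: "x \<in> X" using ex_hat[of "\<lambda>_. 0"] by auto
  show "0 \<in> X" using diff_in[OF x x] by simp
  show "hat 0 l = 0" using hat_diff[OF x x, of l] by simp
qed

lemma norm_hat_le: "x \<in> X \<Longrightarrow> norm (hat x l) \<le> N x"
  using bessel[of x "{l}"] by (auto intro: power2_le_imp_le N_nonneg)

text \<open>The vector that \<open>ex_hat\<close> builds from the coefficients of \<open>x\<close>
  is \<open>x\<close> itself, by uniqueness. The bound takes the place of an infinite triangle
  inequality for \<open>N\<close>.\<close>

lemma N_le_infsum:
  assumes "x \<in> X" "(\<lambda>l. norm (hat x l)) summable_on UNIV"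
  shows "N x \<le> (\<Sum>\<^sub>\<infinity>l. norm (hat x l))"
  using ex_hat[OF assms(2)] hat_inject[OF assms(1)] by metis

lemma N_le_sum:
  assumes "x \<in> X" "finite F" "\<And>l. l \<notin> F \<Longrightarrow> hat x l = 0"
  shows "N x \<le> (\<Sum>l\<in>F. norm (hat x l))"
proof -
  have "(\<lambda>l. norm (hat x l)) summable_on UNIV \<longleftrightarrow> (\<lambda>l. norm (hat x l)) summable_on F"
    by (rule summable_on_cong_neutral) (use assms in auto)
  then have "(\<lambda>l. norm (hat x l)) summable_on UNIV"
    using assms by simp
  moreover have "(\<Sum>\<^sub>\<infinity>l. norm (hat x l)) = (\<Sum>\<^sub>\<infinity>l\<in>F. norm (hat x l))"
    by (rule infsum_cong_neutral) (use assms in auto)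
  ultimately show ?thesis
    using N_le_infsum[OF assms(1)] assms by simp
qed

text \<open>Described by vanishing coefficients, so that membership can be checked coefficientwise.
  For one index and for a ball of indices it is later identified with the ranges \<open>Hsub\<close>
  and \<open>Hsub_upto\<close> of the projections.\<close>

definition span_of :: "int set \<Rightarrow> 'v set" where
  "span_of B = {x \<in> X. \<forall>l. l \<notin> B \<longrightarrow> hat x l = 0}"

lemma span_ofD: "x \<in> span_of B \<Longrightarrow> x \<in> X" "x \<in> span_of B \<Longrightarrow> l \<notin> B \<Longrightarrow> hat x l = 0"
  by (auto simp: span_of_def)

lemma span_of_diff_scaleC: "x \<in> span_of B \<Longrightarrow> y \<in> span_of B \<Longrightarrow> x - c *\<^sub>C y \<in> span_of B"
  by (auto simp: span_of_def diff_in scaleC_in hat_diff hat_scaleC)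

text \<open>\<open>norm_hat_le\<close> and \<open>N_le_sum\<close> give the two inequalities. Hence
  reading off the coefficient identifies \<open>span_of {l}\<close> isometrically with the
  coefficient space.\<close>

lemma N_single: "x \<in> span_of {l} \<Longrightarrow> N x = norm (hat x l)"
  using N_le_sum[of x "{l}"] norm_hat_le[of x l] by (auto simp: span_of_def intro!: antisym)

lemma ex_proj:
  assumes "finite B"
  shows "\<exists>y\<in>X. \<forall>l. hat y l = (if l \<in> B then hat x l else 0)"
proof -
  have "(\<lambda>l. norm (if l \<in> B then hat x l else 0)) = (\<lambda>l. if l \<in> B then norm (hat x l) else 0)"
    by auto
  then have "(\<lambda>l. norm (if l \<in> B then hat x l else 0)) summable_on UNIV"
    using summable_on_finite_support[OF assms] by simp
  from ex_hat[OF this] show ?thesis by blast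
qed

text \<open>Meant for finite \<open>B\<close>: then the truncated sequence is absolutely summable,
  so such a vector exists, and it is unique by \<open>hat_inject\<close>.\<close>

definition proj :: "int set \<Rightarrow> 'v \<Rightarrow> 'v" where
  "proj B x = (SOME y. y \<in> X \<and> (\<forall>l. hat y l = (if l \<in> B then hat x l else 0)))"

lemma proj:
  assumes "finite B"
  shows "proj B x \<in> X" "hat (proj B x) l = (if l \<in> B then hat x l else 0)"
proof -
  have "\<exists>y. y \<in> X \<and> (\<forall>l. hat y l = (if l \<in> B then hat x l else 0))"
    using ex_proj[OF assms] by blast
  from someI_ex[OF this] show "proj B x \<in> X" "hat (proj B x) l = (if l \<in> B then hat x l else 0)"
    unfolding proj_def by auto
qed

lemma proj_in_span_of: "finite B \<Longrightarrow> proj B x \<in> span_of B"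
  by (simp add: span_of_def proj)

text \<open>Each of the \<open>card B\<close> coefficients is at most \<open>N x\<close>. The bound
  is applied to one fixed ball of indices, so its growth with \<open>B\<close> does no harm.\<close>

lemma N_proj_le:
  assumes "finite B" "x \<in> X"
  shows "N (proj B x) \<le> of_nat (card B) * N x"
proof -
  have "N (proj B x) \<le> (\<Sum>l\<in>B. norm (hat x l))"
    using N_le_sum[of "proj B x" B] assms by (simp add: proj)
  also have "\<dots> \<le> of_nat (card B) * N x"
    using sum_bounded_above[of B "\<lambda>l. norm (hat x l)" "N x"] norm_hat_le assms by auto
  finally show ?thesis .
qed

lemma ex_small_tail:
  assumes x: "x \<in> X" "(\<lambda>l. norm (hat x l)) summable_on UNIV" and "0 < e"
  shows "\<exists>F. finite F \<and> (\<forall>G. finite G \<longrightarrow> F \<subseteq> G \<longrightarrow> N (x - proj G x) < e)"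
proof -
  let ?a = "\<lambda>l. norm (hat x l)"
  have "(?a has_sum infsum ?a UNIV) UNIV"
    using x by (simp add: has_sum_infsum)
  then have "\<forall>\<^sub>F F in finite_subsets_at_top UNIV. dist (sum ?a F) (infsum ?a UNIV) < e"
    unfolding has_sum_def using \<open>0 < e\<close> by (rule tendstoD)
  then obtain F where F: "finite F" "\<And>G. finite G \<Longrightarrow> F \<subseteq> G \<Longrightarrow> dist (sum ?a G) (infsum ?a UNIV) < e"
    unfolding eventually_finite_subsets_at_top by auto
  have "N (x - proj G x) < e" if G: "finite G" "F \<subseteq> G" for G
  proof -
    have hat: "norm (hat (x - proj G x) l) = (if l \<in> - G then ?a l else 0)" for l
      using x G by (simp add: hat_diff proj)
    have *: "(\<lambda>l. if l \<in> - G then ?a l else 0) summable_on UNIV \<longleftrightarrow> ?a summable_on (- G)"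
      by (rule summable_on_cong_neutral) auto
    have sG: "?a summable_on (- G)"
      using x(2) summable_on_subset_banach by blast
    have "(\<Sum>\<^sub>\<infinity>l. norm (hat (x - proj G x) l)) = infsum ?a (- G)"
      unfolding hat by (rule infsum_cong_neutral) auto
    also have "\<dots> = infsum ?a UNIV - infsum ?a G"
      using infsum_Diff[of ?a UNIV G] x(2) G by (simp add: Compl_eq_Diff_UNIV)
    also have "\<dots> < e"
      using F(2)[OF G] G by (simp add: dist_real_def)
    finally show ?thesis
      using N_le_infsum[of "x - proj G x"] x G sG * by (simp add: diff_in proj hat)
  qed
  with F show ?thesis by blast
qed

text \<open>Cauchy-Schwarz combined with Bessel's inequality. It turns a bound of coefficients by
  square summable weights times coefficients of some vector into absolute summability.\<close>

lemma weighted_sum_le: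
  assumes x: "x \<in> X" and m: "(\<lambda>l. (m l)\<^sup>2) summable_on UNIV" and F: "finite F"
  shows "(\<Sum>l\<in>F. m l * norm (hat x l)) \<le> sqrt (\<Sum>\<^sub>\<infinity>l. (m l)\<^sup>2) * N x"
proof -
  have "(\<Sum>l\<in>F. m l * norm (hat x l)) \<le> (\<Sum>l\<in>F. \<bar>m l\<bar> * \<bar>norm (hat x l)\<bar>)"
    by (intro sum_mono) (simp add: mult_right_mono)
  also have "\<dots> \<le> L2_set m F * L2_set (\<lambda>l. norm (hat x l)) F"
    by (rule L2_set_mult_ineq)
  also have "\<dots> \<le> sqrt (\<Sum>\<^sub>\<infinity>l. (m l)\<^sup>2) * N x"
  proof (rule mult_mono)
    show "L2_set m F \<le> sqrt (\<Sum>\<^sub>\<infinity>l. (m l)\<^sup>2)"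
      unfolding L2_set_def using m F by (intro real_sqrt_le_mono finite_sum_le_infsum) auto
    show "L2_set (\<lambda>l. norm (hat x l)) F \<le> N x"
      unfolding L2_set_def using bessel[OF x F] N_nonneg[OF x] by (simp add: real_le_lsqrt)
  qed (auto simp: L2_set_nonneg infsum_nonneg)
  finally show ?thesis .
qed

lemma ex_hat_bounded:
  assumes "\<And>F. finite F \<Longrightarrow> (\<Sum>l\<in>F. norm (c l)) \<le> M"
  shows "(\<lambda>l. norm (c l)) summable_on UNIV" "\<exists>x\<in>X. (\<forall>l. hat x l = c l) \<and> N x \<le> M"
proof -
  show s: "(\<lambda>l. norm (c l)) summable_on UNIV"
    by (rule nonneg_bounded_partial_sums_imp_summable_on[where C = M]) (use assms in \<open>auto intro!: eventually_finite_subsets_at_top_weakI\<close>)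
  have "(\<Sum>\<^sub>\<infinity>l. norm (c l)) \<le> M"
    by (rule infsum_le_finite_sums[OF s]) (use assms in auto)
  with ex_hat[OF s] show "\<exists>x\<in>X. (\<forall>l. hat x l = c l) \<and> N x \<le> M"
    by force
qed

lemma ex_single: "\<exists>x\<in>X. \<forall>j. hat x j = (if j = l then c else 0)"
proof -
  have "(\<lambda>j. norm (if j = l then c else 0)) = (\<lambda>j. if j \<in> {l} then norm c else 0)"
    by auto
  then have "(\<lambda>j. norm (if j = l then c else 0)) summable_on UNIV"
    using summable_on_finite_support[of "{l}" "\<lambda>_. norm c"] by simp
  from ex_hat[OF this] show ?thesis
    by blast
qed

definition single :: "int \<Rightarrow> 'h \<Rightarrow> 'v" where
  "single l c = (SOME x. x \<in> X \<and> (\<forall>j. hat x j = (if j = l then c else 0)))"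

lemma single: "single l c \<in> X" "hat (single l c) j = (if j = l then c else 0)"
proof -
  have "\<exists>x. x \<in> X \<and> (\<forall>j. hat x j = (if j = l then c else 0))"
    using ex_single by blast
  from someI_ex[OF this] show "single l c \<in> X" "hat (single l c) j = (if j = l then c else 0)"
    unfolding single_def by auto
qed

lemma single_hat: "x \<in> span_of {l} \<Longrightarrow> single l (hat x l) = x"
  by (rule hat_inject) (auto simp: single span_of_def)

lemma bij_betw_single: "bij_betw (single l) UNIV (span_of {l})"
  by (rule bij_betw_byWitness[where f' = "\<lambda>x. hat x l"])
    (auto simp: single single_hat span_of_def)

end

text \<open>\<open>L\<close> is a diagonal operator with entries \<open>\<mu> l\<close> on its
  maximal domain, as \<open>D_iff\<close> says; \<open>\<kappa>\<close> is a linear lower growth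
  rate of the entries. For the derivative, \<open>\<mu> l\<close> is 2\<pi>il/\<omega> and
  \<open>\<kappa>\<close> is 2\<pi>/\<omega>.\<close>

locale block_operator = coefficient_space X N hat
  for X :: "'v::complex_vector set" and N and hat :: "'v \<Rightarrow> int \<Rightarrow> 'h::complex_hilbert" +
  fixes D :: "'v set" and L V :: "'v \<Rightarrow> 'v" and \<mu> :: "int \<Rightarrow> complex" and \<kappa> b :: real and k :: nat
  assumes \<kappa>: "0 < \<kappa>" "\<And>l. \<kappa> * \<bar>of_int l\<bar> \<le> cmod (\<mu> l)"
    and D_iff: "\<And>x. x \<in> D \<longleftrightarrow> x \<in> X \<and> (\<exists>z\<in>X. \<forall>l. hat z l = \<mu> l *\<^sub>C hat x l)"
    and L_in: "\<And>x. x \<in> D \<Longrightarrow> L x \<in> X"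
    and hat_L: "\<And>x l. x \<in> D \<Longrightarrow> hat (L x) l = \<mu> l *\<^sub>C hat x l"
    and V_in: "\<And>x. x \<in> X \<Longrightarrow> V x \<in> X"
    and V_add: "\<And>x y. x \<in> X \<Longrightarrow> y \<in> X \<Longrightarrow> V (x + y) = V x + V y"
    and V_scaleC: "\<And>c x. x \<in> X \<Longrightarrow> V (c *\<^sub>C x) = c *\<^sub>C V x"
    and V_bound: "\<And>x. x \<in> X \<Longrightarrow> N (V x) \<le> b * N x" and b: "0 \<le> b"
    and V_upto: "V ` span_of {l. \<bar>l\<bar> \<le> int k} \<subseteq> span_of {l. \<bar>l\<bar> \<le> int k}"
    and V_single: "\<And>l. \<bar>l\<bar> > int k \<Longrightarrow> V ` span_of {l} \<subseteq> span_of {l}"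
begin

text \<open>The cells of the partition of the integers into the ball of radius \<open>k\<close> and
  singletons, each indexed by its members. The ball is thus named by \<open>2 * k + 1\<close>
  indices, and \<open>block_cong\<close> says that these names agree.\<close>

definition block :: "int \<Rightarrow> int set" where
  "block l = (if \<bar>l\<bar> \<le> int k then {l. \<bar>l\<bar> \<le> int k} else {l})"

lemma finite_upto [simp]: "finite {l. \<bar>l\<bar> \<le> int k}"
proof -
  have "{l. \<bar>l\<bar> \<le> int k} = {- int k..int k}" by auto
  then show ?thesis by simp
qed

lemma finite_block [simp]: "finite (block l)" and in_block [simp]: "l \<in> block l"
  by (simp_all add: block_def)

lemma block_cong: "j \<in> block l \<Longrightarrow> block j = block l"
  by (auto simp: block_def split: if_splits)

lemma V_block: "x \<in> span_of (block l) \<Longrightarrow> V x \<in> span_of (block l)"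
  using V_upto V_single[of l] by (auto simp: block_def split: if_splits)

section \<open>Action of the perturbation on coefficients\<close>

lemma V_diff: "x \<in> X \<Longrightarrow> y \<in> X \<Longrightarrow> V (x - y) = V x - V y"
  using V_add[of x "(-1) *\<^sub>C y"] V_scaleC[of y "-1"] scaleC_in[of y "-1"] by simp

lemma V_zero: "V 0 = 0"
  using V_diff[of 0 0] by simp

text \<open>The truncation set contains the whole ball and is therefore a union of blocks.
  \<open>V\<close> keeps every block piece in its block, and the piece in the block of
  \<open>l\<close> is zero. The induction adds one singleton block at a time.\<close>

lemma hat_V_proj_eq_0:
  assumes "finite F" "x \<in> X" "\<And>j. j \<in> block l \<Longrightarrow> hat x j = 0"
  shows "hat (V (proj ({l. \<bar>l\<bar> \<le> int k} \<union> F) x)) l = 0"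
  using assms(1)
proof (induction F rule: finite_induct)
  case empty
  let ?B = "{l. \<bar>l\<bar> \<le> int k}"
  show ?case
  proof (cases "\<bar>l\<bar> \<le> int k")
    case True
    have "proj ?B x = 0"
      by (rule hat_inject) (use True assms in \<open>auto simp: proj block_def\<close>)
    then show ?thesis by (simp add: V_zero)
  next
    case False
    have "V (proj ?B x) \<in> span_of ?B"
      using V_upto proj_in_span_of[OF finite_upto] by blast
    with False show ?thesis by (simp add: span_ofD)
  qed
next
  case (insert i F)
  let ?B = "{l. \<bar>l\<bar> \<le> int k}"
  show ?case
  proof (cases "\<bar>i\<bar> \<le> int k")
    case True
    then have "?B \<union> insert i F = ?B \<union> F" by auto
    with insert show ?thesis by simp
  next
    case False
    have eq: "proj (?B \<union> insert i F) x = proj (?B \<union> F) x + proj {i} x"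
      by (rule hat_inject) (use False insert in \<open>auto simp: proj add_in hat_add\<close>)
    have "hat (V (proj {i} x)) l = 0"
    proof (cases "i = l")
      case True
      have "proj {i} x = 0"
        by (rule hat_inject) (use True assms in \<open>auto simp: proj\<close>)
      then show ?thesis by (simp add: V_zero)
    next
      case ne: False
      have "V (proj {i} x) \<in> span_of {i}"
        using V_single[of i] proj_in_span_of[of "{i}"] False by auto
      with ne show ?thesis by (simp add: span_ofD)
    qed
    then show ?thesis
      unfolding eq using insert by (simp add: V_add hat_add V_in proj)
  qed
qed

text \<open>With \<open>y\<close> the part of \<open>x\<close> outside the block of
  \<open>l\<close>, the finite truncations \<open>V (proj G y)\<close> contribute nothing at
  \<open>l\<close>, and boundedness of \<open>V\<close> passes this to the limit. Absolute
  summability is what makes the truncations of \<open>y\<close> converge.\<close>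

lemma hat_V:
  assumes x: "x \<in> X" "(\<lambda>l. norm (hat x l)) summable_on UNIV"
  shows "hat (V x) l = hat (V (proj (block l) x)) l"
proof -
  define y where "y = x - proj (block l) x"
  have y: "y \<in> X"
    using x by (simp add: y_def diff_in proj)
  have hat_y: "hat y j = (if j \<in> block l then 0 else hat x j)" for j
    using x by (simp add: y_def hat_diff proj)
  have y_sum: "(\<lambda>l. norm (hat y l)) summable_on UNIV"
    by (rule summable_on_comparison_test[OF x(2)]) (simp_all add: hat_y)
  have "norm (hat (V y) l) \<le> 0"
  proof (rule field_le_epsilon)
    fix e :: real assume e: "0 < e"
    \<comment> \<open>Dividing by \<open>b + 1\<close> also covers \<open>b = 0\<close>, and
      \<open>b * (e / (b + 1))\<close> is at most \<open>e\<close>.\<close>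
    then have "0 < e / (b + 1)" using b by simp
    from ex_small_tail[OF y y_sum this] obtain F where
      F: "finite F" "\<And>G. finite G \<Longrightarrow> F \<subseteq> G \<Longrightarrow> N (y - proj G y) < e / (b + 1)"
      by blast
    define G where "G = {l. \<bar>l\<bar> \<le> int k} \<union> F"
    have G: "finite G" "N (y - proj G y) < e / (b + 1)"
      using F by (auto simp: G_def)
    have "hat (V (proj G y)) l = 0"
      unfolding G_def by (rule hat_V_proj_eq_0) (use F y hat_y in auto)
    then have "hat (V y) l = hat (V (y - proj G y)) l"
      using y G by (simp add: V_diff V_in hat_diff proj)
    then have "norm (hat (V y) l) \<le> N (V (y - proj G y))"
      using norm_hat_le y G by (simp add: V_in diff_in proj)
    also have "\<dots> \<le> b * N (y - proj G y)"
      using y G by (intro V_bound) (simp add: diff_in proj)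
    also have "\<dots> \<le> b * (e / (b + 1))"
      using G b by (intro mult_left_mono) auto
    also have "\<dots> \<le> e"
      using b e by (simp add: field_simps)
    finally show "norm (hat (V y) l) \<le> 0 + e" by simp
  qed
  then show ?thesis
    using x by (simp add: y_def V_diff hat_diff V_in proj)
qed

text \<open>For nonzero \<open>l\<close> the coefficient of \<open>x\<close> is at most that of
  \<open>L x\<close> divided by \<open>\<kappa> * \<bar>l\<bar>\<close>. These weights are square
  summable, and so are the coefficients of \<open>L x\<close> by Bessel's inequality.\<close>

lemma summable_hat_D:
  assumes x: "x \<in> D"
  shows "(\<lambda>l. norm (hat x l)) summable_on UNIV"
proof -
  have xX: "x \<in> X" using x D_iff by blast
  \<comment> \<open>The weight at \<open>0\<close> is set to \<open>1\<close>: there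
    \<open>L x\<close> need not control the coefficient, as \<open>\<mu> 0\<close> may
    vanish.\<close>
  define m where "m l = (if l = 0 then 1 else 1 / (\<kappa> * \<bar>real_of_int l\<bar>))" for l :: int
  have m: "(\<lambda>l. (m l)\<^sup>2) summable_on UNIV"
  proof (rule summable_on_comparison_test)
    show "(\<lambda>l::int. (if l \<in> {0} then 1 else 0) + (1 / \<kappa>\<^sup>2) * (1 / of_int l)\<^sup>2) summable_on UNIV"
      by (intro summable_on_add summable_on_cmult_right summable_on_int_inverse_square
          summable_on_finite_support) simp
  qed (auto simp: m_def power_divide power_mult_distrib)
  \<comment> \<open>The first term does the work for \<open>l \<noteq> 0\<close>, the second for
    \<open>l = 0\<close>, where \<open>m l = 1\<close>.\<close>
  have "norm (hat x l) \<le> m l * norm (hat (L x) l) + m l * norm (hat x l)" for l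
  proof (cases "l = 0")
    case False
    have "\<kappa> * \<bar>of_int l\<bar> * norm (hat x l) \<le> norm (hat (L x) l)"
      using \<kappa>(2)[of l] x by (simp add: hat_L norm_scaleC mult_right_mono)
    then have "norm (hat x l) \<le> m l * norm (hat (L x) l)"
      using False \<kappa>(1) by (simp add: m_def field_simps)
    moreover have "0 \<le> m l" using \<kappa>(1) by (simp add: m_def)
    ultimately show ?thesis by (simp add: add_increasing2)
  qed (simp add: m_def)
  then have "(\<Sum>l\<in>F. norm (hat x l)) \<le>
      sqrt (\<Sum>\<^sub>\<infinity>l. (m l)\<^sup>2) * N (L x) + sqrt (\<Sum>\<^sub>\<infinity>l. (m l)\<^sup>2) * N x" if "finite F" for F
    using weighted_sum_le[OF L_in[OF x] m that] weighted_sum_le[OF xX m that]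
      sum_mono[of F "\<lambda>l. norm (hat x l)" "\<lambda>l. m l * norm (hat (L x) l) + m l * norm (hat x l)"]
    by (simp add: sum.distrib)
  then show ?thesis by (rule ex_hat_bounded)
qed

lemma span_of_subset_D:
  assumes "finite B" shows "span_of B \<subseteq> D"
proof
  fix x assume x: "x \<in> span_of B"
  have "(\<lambda>l. norm (\<mu> l *\<^sub>C hat x l)) = (\<lambda>l. if l \<in> B then norm (\<mu> l *\<^sub>C hat x l) else 0)"
    using x by (auto simp: span_of_def)
  then have "(\<lambda>l. norm (\<mu> l *\<^sub>C hat x l)) summable_on UNIV"
    using summable_on_finite_support[OF assms] by simp
  from ex_hat[OF this] show "x \<in> D"
    using x by (auto simp: D_iff span_of_def)
qed

lemma L_span_of: "finite B \<Longrightarrow> x \<in> span_of B \<Longrightarrow> L x \<in> span_of B"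
  using span_of_subset_D[of B] by (auto simp: span_of_def L_in hat_L)

abbreviation A :: "'v \<Rightarrow> 'v" where "A x \<equiv> L x - V x"

lemma hat_A: "x \<in> D \<Longrightarrow> hat (A x - z *\<^sub>C x) l = (\<mu> l - z) *\<^sub>C hat x l - hat (V x) l"
proof -
  assume x: "x \<in> D"
  then have "hat (A x - z *\<^sub>C x) l = \<mu> l *\<^sub>C hat x l - hat (V x) l - z *\<^sub>C hat x l"
    using D_iff[of x] by (simp add: hat_diff hat_scaleC hat_L diff_in scaleC_in L_in V_in)
  then show ?thesis
    by (simp add: complex_vector.scale_left_diff_distrib)
qed

lemma A_in: "x \<in> D \<Longrightarrow> A x - z *\<^sub>C x \<in> X"
  using D_iff[of x] by (simp add: diff_in scaleC_in L_in V_in)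

lemma A_block: "x \<in> span_of (block l) \<Longrightarrow> A x - z *\<^sub>C x \<in> span_of (block l)"
  using span_of_diff_scaleC[OF L_span_of[OF finite_block] V_block, of x l x 1]
  by (simp add: span_of_diff_scaleC scaleC_one)

text \<open>Inside the block the equality is \<open>hat_V\<close>, available because elements of
  \<open>D\<close> have absolutely summable coefficients; outside both sides vanish. Restricting to
  a block and proving injectivity of the whole operator both rest on this commutation.\<close>

lemma proj_A:
  assumes x: "x \<in> D"
  shows "A (proj (block l) x) - z *\<^sub>C proj (block l) x = proj (block l) (A x - z *\<^sub>C x)"
proof (rule hat_inject)
  have p: "proj (block l) x \<in> span_of (block l)"
    by (simp add: proj_in_span_of)
  then have pD: "proj (block l) x \<in> D"
    using span_of_subset_D[of "block l"] by auto
  show "A (proj (block l) x) - z *\<^sub>C proj (block l) x \<in> X"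
    using A_in[OF pD] .
  show "proj (block l) (A x - z *\<^sub>C x) \<in> X"
    by (simp add: proj)
  fix j
  show "hat (A (proj (block l) x) - z *\<^sub>C proj (block l) x) j = hat (proj (block l) (A x - z *\<^sub>C x)) j"
  proof (cases "j \<in> block l")
    case True
    have "hat (V x) j = hat (V (proj (block l) x)) j"
      using hat_V[of x j] block_cong[OF True] summable_hat_D[OF x] x by (simp add: D_iff)
    with True show ?thesis
      by (simp add: hat_A[OF x] hat_A[OF pD] proj)
  next
    case False
    then show ?thesis
      using A_block[OF p, of z] by (simp add: proj span_ofD)
  qed
qed

text \<open>Injectivity and the bound are inherited by restriction. For surjectivity, a preimage in
  \<open>D\<close> of a block vector is projected to the block, where it is still a preimage by
  \<open>proj_A\<close>.\<close>

lemma notin_spectrum_block: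
  assumes "z \<notin> spectrum N X D A"
  shows "z \<notin> spectrum N (span_of (block l)) (span_of (block l)) A"
proof -
  let ?f = "\<lambda>x. A x - z *\<^sub>C x" and ?B = "span_of (block l)"
  from assms obtain C where bij: "bij_betw ?f D X" and C: "\<And>x. x \<in> D \<Longrightarrow> N x \<le> C * N (?f x)"
    unfolding notin_spectrum_iff by blast
  have sub: "?B \<subseteq> D"
    by (rule span_of_subset_D) simp
  show ?thesis
  proof (rule notin_spectrumI)
    show "bij_betw ?f ?B ?B"
    proof (rule bij_betw_imageI)
      show "inj_on ?f ?B"
        using bij sub by (auto simp: bij_betw_def intro: inj_on_subset)
      show "?f ` ?B = ?B"
      proof (intro equalityI subsetI)
        fix y assume y: "y \<in> ?B"
        then obtain x where x: "x \<in> D" "?f x = y"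
          using bij by (auto simp: bij_betw_def span_of_def image_iff set_eq_iff) (metis)
        have "?f (proj (block l) x) = proj (block l) y"
          using proj_A[OF x(1)] x(2) by simp
        also have "\<dots> = y"
          using y by (intro hat_inject) (auto simp: proj span_of_def)
        finally have "?f (proj (block l) x) = y" .
        then show "y \<in> ?f ` ?B"
          using proj_in_span_of[OF finite_block, of l x] by (intro image_eqI) simp_all
      qed (use A_block in auto)
    qed
    show "N x \<le> C * N (?f x)" if "x \<in> ?B" for x
      using C sub that by blast
  qed
qed

text \<open>On this subspace \<open>A - z\<close> is the scalar \<open>\<mu> l - z\<close> minus
  \<open>V\<close>, and \<open>\<kappa> * \<bar>l\<bar> - cmod z - b\<close> is at least half of
  \<open>\<kappa> * \<bar>l\<bar>\<close> under the assumption on \<open>l\<close>.\<close>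

lemma N_le_far:
  assumes l: "\<bar>l\<bar> > int k" "2 * (cmod z + b) \<le> \<kappa> * \<bar>of_int l\<bar>" and x: "x \<in> span_of {l}"
  shows "N x \<le> 2 / (\<kappa> * \<bar>of_int l\<bar>) * N (A x - z *\<^sub>C x)"
proof -
  have xD: "x \<in> D" and xX: "x \<in> X"
    using span_of_subset_D[of "{l}"] x by (auto simp: span_of_def)
  have bl: "block l = {l}"
    using l by (simp add: block_def)
  have y: "A x - z *\<^sub>C x \<in> span_of {l}"
    using A_block[of x l z] x by (simp add: bl)
  have "norm ((\<mu> l - z) *\<^sub>C hat x l) \<le> norm ((\<mu> l - z) *\<^sub>C hat x l - hat (V x) l) + norm (hat (V x) l)"
    using norm_triangle_ineq2[of "(\<mu> l - z) *\<^sub>C hat x l" "hat (V x) l"] by simp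
  also have "norm (hat (V x) l) \<le> b * N x"
    using norm_hat_le[of "V x" l] V_bound[OF xX] V_in[OF xX] by linarith
  finally have "cmod (\<mu> l - z) * N x \<le> N (A x - z *\<^sub>C x) + b * N x"
    by (simp add: N_single[OF x] N_single[OF y] hat_A[OF xD] norm_scaleC)
  moreover have "(\<kappa> * \<bar>of_int l\<bar> - cmod z) * N x \<le> cmod (\<mu> l - z) * N x"
    using \<kappa>(2)[of l] norm_triangle_ineq2[of "\<mu> l" z] N_nonneg[OF xX] by (intro mult_right_mono) auto
  moreover have "(\<kappa> * \<bar>of_int l\<bar> / 2) * N x \<le> (\<kappa> * \<bar>of_int l\<bar> - cmod z - b) * N x"
    using l N_nonneg[OF xX] by (intro mult_right_mono) auto
  ultimately have "(\<kappa> * \<bar>of_int l\<bar> / 2) * N x \<le> N (A x - z *\<^sub>C x)"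
    by (simp add: algebra_simps)
  moreover have "0 < \<kappa> * \<bar>real_of_int l\<bar>"
    using l \<kappa>(1) by auto
  ultimately show ?thesis
    by (simp add: field_simps)
qed

text \<open>The bound of order 1/|l| from \<open>N_le_far\<close> holds for all but finitely many
  \<open>l\<close>; the remaining blocks contribute some finite constants, which do not affect
  square summability.\<close>

lemma ex_block_bounds:
  assumes "\<And>l. \<bar>l\<bar> > int k \<Longrightarrow> z \<notin> spectrum N (span_of {l}) (span_of {l}) A"
  obtains m where "\<And>l. 0 \<le> m l" "(\<lambda>l. (m l)\<^sup>2) summable_on UNIV"
    "\<And>l x. \<bar>l\<bar> > int k \<Longrightarrow> x \<in> span_of {l} \<Longrightarrow> N x \<le> m l * N (A x - z *\<^sub>C x)"
proof -
  have "\<exists>C\<ge>0. \<bar>l\<bar> > int k \<longrightarrow> (\<forall>x\<in>span_of {l}. N x \<le> C * N (A x - z *\<^sub>C x))" for l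
  proof (cases "\<bar>l\<bar> > int k")
    case True
    with assms[of l] obtain C where C: "\<And>x. x \<in> span_of {l} \<Longrightarrow> N x \<le> C * N (A x - z *\<^sub>C x)"
      unfolding notin_spectrum_iff by blast
    have "N x \<le> \<bar>C\<bar> * N (A x - z *\<^sub>C x)" if x: "x \<in> span_of {l}" for x
    proof -
      have "0 \<le> N (A x - z *\<^sub>C x)"
        by (rule N_nonneg, rule A_in) (use x span_of_subset_D[of "{l}"] in auto)
      then have "C * N (A x - z *\<^sub>C x) \<le> \<bar>C\<bar> * N (A x - z *\<^sub>C x)"
        by (intro mult_right_mono) auto
      with C[OF x] show ?thesis by linarith
    qed
    then show ?thesis by (intro exI[of _ "\<bar>C\<bar>"]) auto
  qed (auto intro: exI[of _ 0])
  then obtain C where C: "\<And>l. 0 \<le> C l"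
    "\<And>l x. \<bar>l\<bar> > int k \<Longrightarrow> x \<in> span_of {l} \<Longrightarrow> N x \<le> C l * N (A x - z *\<^sub>C x)"
    by metis
  \<comment> \<open>From this index on
    \<open>2 * (cmod z + b) \<le> \<kappa> * \<bar>l\<bar>\<close>, which is the threshold in
    \<open>N_le_far\<close>.\<close>
  define n where "n = \<lceil>2 * (cmod z + b) / \<kappa>\<rceil>"
  define m where "m l = (if l \<in> {-n..n} then C l else 2 / (\<kappa> * \<bar>of_int l\<bar>))" for l
  show thesis
  proof (rule that)
    show "0 \<le> m l" for l
      using C \<kappa>(1) by (simp add: m_def)
    show "(\<lambda>l. (m l)\<^sup>2) summable_on UNIV"
    proof (rule summable_on_comparison_test)
      show "(\<lambda>l. (if l \<in> {-n..n} then (C l)\<^sup>2 else 0) + (4 / \<kappa>\<^sup>2) * (1 / of_int l)\<^sup>2) summable_on UNIV"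
        by (intro summable_on_add summable_on_cmult_right summable_on_int_inverse_square
            summable_on_finite_support) simp
    qed (auto simp: m_def power_divide power_mult_distrib)
    fix l x assume l: "\<bar>l\<bar> > int k" and x: "x \<in> span_of {l}"
    show "N x \<le> m l * N (A x - z *\<^sub>C x)"
    proof (cases "l \<in> {-n..n}")
      case True
      then show ?thesis using C(2)[OF l x] by (simp add: m_def)
    next
      case False
      then have "n \<le> \<bar>l\<bar>" by auto
      then have "2 * (cmod z + b) / \<kappa> \<le> of_int \<bar>l\<bar>"
        unfolding n_def by (simp add: ceiling_le_iff)
      then have "2 * (cmod z + b) \<le> \<kappa> * \<bar>of_int l\<bar>"
        using \<kappa>(1) by (simp add: field_simps)
      from N_le_far[OF l this x] False show ?thesis
        by (auto simp add: m_def)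
    qed
  qed
qed

lemma notin_spectrum_of_blocks:
  assumes upto: "z \<notin> spectrum N (span_of {l. \<bar>l\<bar> \<le> int k}) (span_of {l. \<bar>l\<bar> \<le> int k}) A"
    and single: "\<And>l. \<bar>l\<bar> > int k \<Longrightarrow> z \<notin> spectrum N (span_of {l}) (span_of {l}) A"
  shows "z \<notin> spectrum N X D A"
proof -
  let ?f = "\<lambda>x. A x - z *\<^sub>C x" and ?B0 = "{l. \<bar>l\<bar> \<le> int k}"
  have bij: "bij_betw ?f (span_of (block l)) (span_of (block l))" for l
    using upto single[of l] by (auto simp: block_def notin_spectrum_iff)
  obtain C where C: "\<And>x. x \<in> span_of ?B0 \<Longrightarrow> N x \<le> C * N (?f x)"
    using upto unfolding notin_spectrum_iff by blast
  obtain m where m: "\<And>l. 0 \<le> m l" "(\<lambda>l. (m l)\<^sup>2) summable_on UNIV"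
    "\<And>l x. \<bar>l\<bar> > int k \<Longrightarrow> x \<in> span_of {l} \<Longrightarrow> N x \<le> m l * N (?f x)"
    using ex_block_bounds[OF single] by blast
  \<comment> \<open>First summand: \<open>2 * k + 1\<close> coefficients in the ball, each at most
    \<open>\<bar>C\<bar> * (2 * k + 1) * N y\<close>, where the inner factor comes from the norm
    bound of the ball projection. Second summand: Cauchy-Schwarz for the singleton blocks.\<close>
  define M where "M = (2 * real k + 1) * (\<bar>C\<bar> * (2 * real k + 1)) + sqrt (\<Sum>\<^sub>\<infinity>l. (m l)\<^sup>2)"
  have solve: "\<exists>x\<in>D. ?f x = y \<and> N x \<le> M * N y" if y: "y \<in> X" for y
  proof -
    have "\<exists>u. u \<in> span_of (block l) \<and> ?f u = proj (block l) y" for l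
      using bij[of l] proj_in_span_of[of "block l" y] by (auto simp: bij_betw_def image_iff set_eq_iff) metis
    then obtain u where u: "\<And>l. u l \<in> span_of (block l)" "\<And>l. ?f (u l) = proj (block l) y"
      by metis
    \<comment> \<open>Indices of one block pose the same equation in the same space, so injectivity
      gives the same solution. Thus the sequence \<open>c\<close>, which takes its entry at
      \<open>l\<close> from \<open>u l\<close>, restricts on each block to the coefficients of one
      vector.\<close>
    have u_cong: "u j = u l" if j: "j \<in> block l" for j l
    proof -
      have "?f (u j) = ?f (u l)" "u j \<in> span_of (block l)"
        using u[of j] u[of l] block_cong[OF j] by simp_all
      then show ?thesis
        using bij[of l] u(1)[of l] by (auto simp: bij_betw_def dest: inj_onD)
    qed
    have uX: "u l \<in> X" and uD: "u l \<in> D" for l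
      using u(1)[of l] span_of_subset_D[of "block l"] by (auto simp: span_of_def)
    define c where "c l = hat (u l) l" for l
    have near: "norm (c l) \<le> \<bar>C\<bar> * (2 * real k + 1) * N y" if l: "\<bar>l\<bar> \<le> int k" for l
    proof -
      have B: "block l = ?B0" using l by (simp add: block_def)
      have "norm (c l) \<le> N (u l)"
        unfolding c_def by (rule norm_hat_le[OF uX])
      also have "\<dots> \<le> C * N (proj ?B0 y)"
        using C[of "u l"] u[of l] by (simp add: B)
      also have "\<dots> \<le> \<bar>C\<bar> * N (proj ?B0 y)"
        by (intro mult_right_mono N_nonneg) (auto simp: proj)
      also have "\<dots> \<le> \<bar>C\<bar> * ((2 * real k + 1) * N y)"
      proof (intro mult_left_mono)
        have "?B0 = {- int k..int k}" by auto
        then have "card ?B0 = 2 * k + 1" by simp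
        then show "N (proj ?B0 y) \<le> (2 * real k + 1) * N y"
          using N_proj_le[of ?B0 y] y by (simp add: add.commute)
      qed simp
      finally show ?thesis by (simp add: mult.assoc)
    qed
    have far: "norm (c l) \<le> m l * norm (hat y l)" if l: "\<not> \<bar>l\<bar> \<le> int k" for l
    proof -
      have B: "block l = {l}" using l by (simp add: block_def)
      have "norm (c l) = N (u l)"
        unfolding c_def using N_single[of "u l" l] u(1)[of l] by (simp add: B)
      also have "\<dots> \<le> m l * N (proj {l} y)"
        using m(3)[of l "u l"] u[of l] l by (simp add: B)
      also have "N (proj {l} y) = norm (hat y l)"
        using N_single[OF proj_in_span_of[of "{l}" y]] by (simp add: proj)
      finally show ?thesis .
    qed
    \<comment> \<open>Bounding all finite partial sums gives absolute summability and the resolvent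
      bound \<open>M * N y\<close> in one go.\<close>
    have sum_le: "(\<Sum>l\<in>F. norm (c l)) \<le> M * N y" if F: "finite F" for F
    proof -
      have "(\<Sum>l\<in>F. norm (c l)) \<le> (\<Sum>l\<in>F. (if l \<in> ?B0 then \<bar>C\<bar> * (2 * real k + 1) * N y else 0) + m l * norm (hat y l))"
      proof (rule sum_mono)
        fix l
        show "norm (c l) \<le> (if l \<in> ?B0 then \<bar>C\<bar> * (2 * real k + 1) * N y else 0) + m l * norm (hat y l)"
          using near[of l] far[of l] m(1)[of l] by (auto intro: add_increasing2)
      qed
      also have "\<dots> = (\<Sum>l\<in>F \<inter> ?B0. \<bar>C\<bar> * (2 * real k + 1) * N y) + (\<Sum>l\<in>F. m l * norm (hat y l))"
        using F by (simp only: sum.distrib sum.inter_restrict)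
      also have "\<dots> \<le> (2 * real k + 1) * (\<bar>C\<bar> * (2 * real k + 1) * N y) + sqrt (\<Sum>\<^sub>\<infinity>l. (m l)\<^sup>2) * N y"
      proof (intro add_mono weighted_sum_le[OF y m(2) F])
        have "?B0 = {- int k..int k}" by auto
        then have "card ?B0 = 2 * k + 1" by simp
        moreover have "card (F \<inter> ?B0) \<le> card ?B0"
          by (intro card_mono) auto
        ultimately have "real (card (F \<inter> ?B0)) \<le> 2 * real k + 1" by linarith
        then show "(\<Sum>l\<in>F \<inter> ?B0. \<bar>C\<bar> * (2 * real k + 1) * N y) \<le> (2 * real k + 1) * (\<bar>C\<bar> * (2 * real k + 1) * N y)"
          using N_nonneg[OF y] by (simp add: mult_right_mono)
      qed
      also have "\<dots> = M * N y"
        by (simp add: M_def algebra_simps)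
      finally show ?thesis .
    qed
    obtain x where x: "x \<in> X" "\<And>l. hat x l = c l" "N x \<le> M * N y"
      using ex_hat_bounded(2)[OF sum_le] by blast
    have x_sum: "(\<lambda>l. norm (hat x l)) summable_on UNIV"
      using ex_hat_bounded(1)[OF sum_le] by (simp add: x(2))
    \<comment> \<open>The block projections of the assembled \<open>x\<close> recover the block
      solutions, so that \<open>hat_V\<close> expresses the coefficients of \<open>V x\<close>
      through \<open>V (u l)\<close>.\<close>
    have px: "proj (block l) x = u l" for l
    proof (rule hat_inject)
      show "hat (proj (block l) x) j = hat (u l) j" for j
        using u_cong[of j l] u(1)[of l] by (simp add: proj x(2) c_def span_ofD)
    qed (simp_all add: proj uX)
    \<comment> \<open>Read at the coefficient \<open>l\<close>, the block equation says that
      \<open>y + V x + z *\<^sub>C x\<close> has the coefficients that \<open>L x\<close> should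
      have. By \<open>D_iff\<close> this puts \<open>x\<close> into \<open>D\<close>.\<close>
    have key: "hat (y + V x + z *\<^sub>C x) l = \<mu> l *\<^sub>C hat x l" for l
    proof -
      have "hat y l = hat (?f (u l)) l"
        by (simp add: u(2) proj)
      also have "\<dots> = (\<mu> l - z) *\<^sub>C hat x l - hat (V x) l"
        using hat_V[OF x(1) x_sum, of l] by (simp add: hat_A[OF uD] px x(2) c_def)
      finally show ?thesis
        using x(1) y by (simp add: hat_add hat_scaleC add_in scaleC_in V_in
            complex_vector.scale_left_diff_distrib)
    qed
    have in_X: "y + V x + z *\<^sub>C x \<in> X"
      using x(1) y by (simp add: add_in scaleC_in V_in)
    then have xD: "x \<in> D"
      using D_iff key x(1) by blast
    have "L x = y + V x + z *\<^sub>C x"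
      by (rule hat_inject) (auto simp: L_in xD in_X hat_L key)
    with x xD show ?thesis by (intro bexI[of _ x]) auto
  qed
  have inj: "inj_on ?f D"
  proof (rule inj_onI)
    fix x x' assume x: "x \<in> D" "x' \<in> D" "?f x = ?f x'"
    have "proj (block l) x = proj (block l) x'" for l
    proof -
      have "?f (proj (block l) x) = ?f (proj (block l) x')"
        using x by (simp add: proj_A)
      then show ?thesis
        using bij[of l] proj_in_span_of[of "block l"] by (auto simp: bij_betw_def dest: inj_onD)
    qed
    then have "hat x l = hat x' l" for l
      using proj(2)[of "block l" x l] proj(2)[of "block l" x' l] by simp
    then show "x = x'"
      using x D_iff hat_inject by blast
  qed
  have "?f ` D = X"
    using solve A_in by (auto simp: image_iff)
  show ?thesis
  proof (rule notin_spectrumI)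
    show "bij_betw ?f D X"
      using inj \<open>?f ` D = X\<close> by (simp add: bij_betw_def)
    fix x assume x: "x \<in> D"
    obtain x' where "x' \<in> D" "?f x' = ?f x" "N x' \<le> M * N (?f x)"
      using solve[OF A_in[OF x]] by blast
    with inj x show "N x \<le> M * N (?f x)"
      by (auto dest: inj_onD)
  qed
qed

theorem spectrum_blocks:
  "spectrum N X D A = spectrum N (span_of {l. \<bar>l\<bar> \<le> int k}) (span_of {l. \<bar>l\<bar> \<le> int k}) A \<union>
     (\<Union>l\<in>{l. \<bar>l\<bar> > int k}. (\<lambda>z. \<mu> l + z) ` spectrum N (span_of {l}) (span_of {l}) (\<lambda>x. - V x))"
proof -
  have *: "(\<lambda>z. \<mu> l + z) ` spectrum N (span_of {l}) (span_of {l}) (\<lambda>x. - V x) =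
      spectrum N (span_of {l}) (span_of {l}) A" for l
  proof -
    \<comment> \<open>On a single frequency \<open>L\<close> is a scalar, so the spectrum of the
      block is a translate of that of \<open>- V\<close>.\<close>
    have "L x = \<mu> l *\<^sub>C x" if "x \<in> span_of {l}" for x
    proof (rule hat_inject)
      have x: "x \<in> D" "x \<in> X"
        using that span_of_subset_D[of "{l}"] by (auto simp: span_of_def)
      then show "L x \<in> X" "\<mu> l *\<^sub>C x \<in> X"
        by (simp_all add: L_in scaleC_in)
      show "hat (L x) j = hat (\<mu> l *\<^sub>C x) j" for j
        using x that by (cases "j = l") (simp_all add: hat_L hat_scaleC span_ofD)
    qed
    then show ?thesis
      unfolding spectrum_shift[symmetric] by (intro spectrum_cong) simp
  qed
  have "z \<notin> spectrum N X D A \<longleftrightarrow> z \<notin> spectrum N (span_of {l. \<bar>l\<bar> \<le> int k}) (span_of {l. \<bar>l\<bar> \<le> int k}) A \<and>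
     (\<forall>l. \<bar>l\<bar> > int k \<longrightarrow> z \<notin> spectrum N (span_of {l}) (span_of {l}) A)" for z
  proof safe
    assume z: "z \<notin> spectrum N X D A"
    \<comment> \<open>The index \<open>0\<close> lies in every ball, so \<open>block 0\<close> is
      the ball.\<close>
    { assume "z \<in> spectrum N (span_of {l. \<bar>l\<bar> \<le> int k}) (span_of {l. \<bar>l\<bar> \<le> int k}) A"
      then show False using notin_spectrum_block[OF z, of 0] by (simp add: block_def) }
    { fix l assume "\<bar>l\<bar> > int k" "z \<in> spectrum N (span_of {l}) (span_of {l}) A"
      then show False using notin_spectrum_block[OF z, of l] by (simp add: block_def) }
  qed (use notin_spectrum_of_blocks in blast)
  then show ?thesis
    unfolding * by blast
qed

text \<open>Through the isometry \<open>single l\<close> the restriction of \<open>- V\<close>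
  becomes a bounded operator \<open>T\<close> on the coefficient space, whose spectrum is nonempty,
  compact and contained in the disc of radius \<open>v\<close>. The assumption \<open>ne\<close>
  excludes the zero space, where the spectrum is empty.\<close>

lemma spectrum_single:
  assumes l: "\<bar>l\<bar> > int k" and v: "\<And>x. x \<in> span_of {l} \<Longrightarrow> N (V x) \<le> v * N x"
    and "0 \<le> v" and ne: "\<exists>h::'h. h \<noteq> 0"
  defines "\<sigma> \<equiv> spectrum N (span_of {l}) (span_of {l}) (\<lambda>x. - V x)"
  shows "\<exists>z\<in>\<sigma>. \<forall>z'\<in>\<sigma>. cmod z' \<le> cmod z" "\<sigma> \<subseteq> cball 0 v"
proof -
  define T where "T c = - hat (V (single l c)) l" for c
  have s: "single l c \<in> span_of {l}" "single l c \<in> X" for c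
    by (auto simp: span_of_def single)
  have Vs: "V (single l c) \<in> span_of {l}" for c
    using V_single[OF l] s(1) by blast
  have VsX: "V (single l c) \<in> X" for c
    using Vs span_ofD by blast
  have add: "single l (c + d) = single l c + single l d" for c d
    by (rule hat_inject) (auto simp: single add_in hat_add)
  have scale: "single l (a *\<^sub>C c) = a *\<^sub>C single l c" for a c
    by (rule hat_inject) (auto simp: single scaleC_in hat_scaleC)
  have bound: "norm (T c) \<le> v * norm c" for c
  proof -
    have "norm (T c) = N (V (single l c))"
      using N_single[OF Vs] by (simp add: T_def)
    also have "\<dots> \<le> v * N (single l c)"
      by (rule v[OF s(1)])
    finally show ?thesis
      using N_single[OF s(1)] by (simp add: single)
  qed
  have T_scale: "T (a *\<^sub>C c) = a *\<^sub>C T c" for a c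
    by (simp add: T_def scale V_scaleC s hat_scaleC VsX)
  have "bounded_linear T"
  proof (rule bounded_linear_intro)
    show "T (c + d) = T c + T d" for c d
      by (simp add: T_def add V_add s hat_add VsX)
    show "T (r *\<^sub>R c) = r *\<^sub>R T c" for r c
      by (simp add: scaleR_eq_scaleC T_scale)
    show "norm (T c) \<le> norm c * v" for c
      using bound[of c] by (simp add: mult.commute)
  qed
  with T_scale have T: "bounded_clinear T"
    by (simp add: bounded_clinear_def)
  have "\<sigma> = spectrum norm UNIV UNIV T"
    unfolding \<sigma>_def
  proof (rule spectrum_transport[OF bij_betw_single])
    show "N (single l c) = norm c" for c
      using N_single[OF s(1)] by (simp add: single)
    have Tx: "V (single l c) = - single l (T c)" for c
    proof (rule hat_inject[OF VsX])
      have "- single l (T c) = (-1) *\<^sub>C single l (T c)"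
        by simp
      then show "- single l (T c) \<in> X" "hat (V (single l c)) j = hat (- single l (T c)) j" for j
        using span_ofD(2)[OF Vs] by (simp_all only: scaleC_in s hat_scaleC single) (auto simp: T_def)
    qed
    have "single l c - a *\<^sub>C single l d = single l (c - a *\<^sub>C d)" for a c d
      by (rule hat_inject) (auto simp: single scaleC_in hat_scaleC diff_in hat_diff)
    then show "- V (single l c) - z *\<^sub>C single l c = single l (T c - z *\<^sub>C c)" for z c
      by (simp add: Tx)
  qed simp
  then show "\<exists>z\<in>\<sigma>. \<forall>z'\<in>\<sigma>. cmod z' \<le> cmod z" "\<sigma> \<subseteq> cball 0 v"
    using spectral_radius_attained[OF T bound \<open>0 \<le> v\<close> ne] spectrum_subset_cball[OF T bound \<open>0 \<le> v\<close>]
    by simp_all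
qed

end

section \<open>Strong measurability and the Bochner integral\<close>

lemma strongly_measurableI:
  assumes "\<And>i. simple_function M (s i)" "AE x in M. (\<lambda>i. s i x) \<longlonglongrightarrow> f x"
  shows "strongly_measurable M f"
  using assms unfolding strongly_measurable_def by blast

lemma strongly_measurableE:
  assumes "strongly_measurable M f"
  obtains s where "\<And>i::nat. simple_function M (s i)" "AE x in M. (\<lambda>i. s i x) \<longlonglongrightarrow> f x"
  using assms unfolding strongly_measurable_def by blast

lemma strongly_measurable_cong_AE:
  assumes f: "strongly_measurable M f" and eq: "AE x in M. f x = g x"
  shows "strongly_measurable M g"
proof -
  obtain s where s: "\<And>i::nat. simple_function M (s i)" "AE x in M. (\<lambda>i. s i x) \<longlonglongrightarrow> f x"
    using f by (rule strongly_measurableE) blast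
  from s(2) eq have "AE x in M. (\<lambda>i. s i x) \<longlonglongrightarrow> g x"
    by eventually_elim simp
  with s(1) show ?thesis by (rule strongly_measurableI)
qed

lemma strongly_measurable_const: "strongly_measurable M (\<lambda>_. c)"
  by (rule strongly_measurableI[of M "\<lambda>_ _. c"]) auto

lemma strongly_measurable_compose:
  assumes f: "strongly_measurable M f" and h: "\<And>x. isCont h x"
  shows "strongly_measurable M (\<lambda>x. h (f x))"
proof -
  obtain s where s: "\<And>i::nat. simple_function M (s i)" "AE x in M. (\<lambda>i. s i x) \<longlonglongrightarrow> f x"
    using f by (rule strongly_measurableE) blast
  show ?thesis
  proof (rule strongly_measurableI)
    show "simple_function M (\<lambda>x. h (s i x))" for i
      using s(1) by (rule simple_function_compose1)
    from s(2) show "AE x in M. (\<lambda>i. h (s i x)) \<longlonglongrightarrow> h (f x)"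
      by eventually_elim (rule isCont_tendsto_compose[OF h])
  qed
qed

lemma strongly_measurable_compose2:
  assumes f: "strongly_measurable M f" and g: "strongly_measurable M g"
    and h: "\<And>u v x y. u \<longlonglongrightarrow> x \<Longrightarrow> v \<longlonglongrightarrow> y \<Longrightarrow> (\<lambda>i. h (u i) (v i)) \<longlonglongrightarrow> h x y"
  shows "strongly_measurable M (\<lambda>x. h (f x) (g x))"
proof -
  obtain s where s: "\<And>i::nat. simple_function M (s i)" "AE x in M. (\<lambda>i. s i x) \<longlonglongrightarrow> f x"
    using f by (rule strongly_measurableE) blast
  obtain t where t: "\<And>i::nat. simple_function M (t i)" "AE x in M. (\<lambda>i. t i x) \<longlonglongrightarrow> g x"
    using g by (rule strongly_measurableE) blast
  show ?thesis
  proof (rule strongly_measurableI)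
    show "simple_function M (\<lambda>x. h (s i x) (t i x))" for i
      using s(1) t(1) by (rule simple_function_compose2)
    from s(2) t(2) show "AE x in M. (\<lambda>i. h (s i x) (t i x)) \<longlonglongrightarrow> h (f x) (g x)"
      by eventually_elim (rule h)
  qed
qed

lemmas strongly_measurable_add = strongly_measurable_compose2[where h = "(+)", OF _ _ tendsto_add]
  and strongly_measurable_diff = strongly_measurable_compose2[where h = "(-)", OF _ _ tendsto_diff]
  and strongly_measurable_scaleC = strongly_measurable_compose2[where h = scaleC,
    OF _ _ bounded_bilinear.tendsto[OF bounded_bilinear_scaleC]]
  and strongly_measurable_cinner = strongly_measurable_compose2[where h = cinner,
    OF _ _ bounded_bilinear.tendsto[OF bounded_bilinear_cinner]]
  and strongly_measurable_norm = strongly_measurable_compose[where h = norm, OF _ continuous_norm[OF continuous_ident]]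

lemma strongly_measurable_simple: "simple_function M f \<Longrightarrow> strongly_measurable M f"
  by (rule strongly_measurableI[of M "\<lambda>_. f"]) auto

lemma borel_measurable_imp_strongly_measurable:
  fixes f :: "'a \<Rightarrow> 'b::{real_normed_vector, second_countable_topology}"
  assumes "f \<in> borel_measurable M"
  shows "strongly_measurable M f"
proof -
  obtain F where "\<forall>i. simple_function M (F i)" "\<forall>x\<in>space M. (\<lambda>i. F i x) \<longlonglongrightarrow> f x"
    using borel_measurable_implies_sequence_metric[OF assms, of undefined] by blast
  then show ?thesis
    by (intro strongly_measurableI[of M F]) auto
qed

text \<open>Where the simple functions fail to converge, \<open>f\<close> is arbitrary. Replaced by
  \<open>0\<close> on a null set containing these points it is a pointwise limit of measurable
  functions, and completeness carries measurability back to \<open>f\<close>.\<close>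

lemma (in complete_measure) strongly_measurable_imp_borel_measurable:
  assumes "strongly_measurable M f"
  shows "f \<in> borel_measurable M"
proof -
  obtain s where s: "\<And>i::nat. simple_function M (s i)" "AE x in M. (\<lambda>i. s i x) \<longlonglongrightarrow> f x"
    using assms by (rule strongly_measurableE) blast
  then obtain Z where Z: "Z \<in> null_sets M" "{x \<in> space M. \<not> (\<lambda>i. s i x) \<longlonglongrightarrow> f x} \<subseteq> Z"
    unfolding eventually_ae_filter by blast
  define g where "g x = (if x \<in> Z then 0 else f x)" for x
  have g: "g \<in> borel_measurable M"
  proof (rule borel_measurable_LIMSEQ_metric)
    show "(\<lambda>x. if x \<in> Z then 0 else s i x) \<in> borel_measurable M" for i
      using Z s(1) by (intro borel_measurable_simple_function simple_function_If_set) auto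
    show "(\<lambda>i. if x \<in> Z then 0 else s i x) \<longlonglongrightarrow> g x" if "x \<in> space M" for x
      using that Z by (auto simp: g_def)
  qed
  have ae: "AE x in M. g x = f x"
    using AE_not_in[OF Z(1)] by eventually_elim (simp add: g_def)
  show ?thesis
  proof (rule measurableI)
    fix A :: "'b set" assume "A \<in> sets borel"
    with g have "g -` A \<inter> space M \<in> sets M"
      by (rule measurable_sets)
    moreover have "AE x in M. x \<in> g -` A \<inter> space M \<longleftrightarrow> x \<in> f -` A \<inter> space M"
      using ae by eventually_elim simp
    ultimately show "f -` A \<inter> space M \<in> sets M"
      by (metis in_sets_AE inf_le2)
  qed simp
qed

lemma complete_lebesgue_on:
  assumes "S \<in> sets lebesgue" shows "complete_measure (lebesgue_on S)"
proof
  fix A B :: "'a set" assume "B \<subseteq> A" "A \<in> null_sets (lebesgue_on S)"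
  with assms have "A \<subseteq> S" "A \<in> null_sets lebesgue"
    by (auto simp: null_sets_restrict_space)
  with \<open>B \<subseteq> A\<close> have "B \<in> sets lebesgue" "B \<subseteq> S"
    using completion.complete by blast+
  then show "B \<in> sets (lebesgue_on S)"
    using assms by (simp add: sets_restrict_space_iff)
qed

lemma strongly_measurable_subset:
  assumes f: "strongly_measurable (lebesgue_on S) f" and "T \<subseteq> S" "S \<in> sets lebesgue" "T \<in> sets lebesgue"
  shows "strongly_measurable (lebesgue_on T) f"
proof -
  obtain s where s: "\<And>i::nat. simple_function (lebesgue_on S) (s i)" "AE x in lebesgue_on S. (\<lambda>i. s i x) \<longlonglongrightarrow> f x"
    using f by (rule strongly_measurableE) blast
  show ?thesis
  proof (rule strongly_measurableI)
    show "simple_function (lebesgue_on T) (s i)" for i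
    proof -
      have "finite (s i ` T)"
        using s(1)[of i] \<open>T \<subseteq> S\<close> by (auto simp: simple_function_def intro: finite_subset[OF image_mono])
      moreover have "s i -` {s i x} \<inter> T \<in> sets (lebesgue_on T)" if "x \<in> T" for x
      proof -
        have "s i -` {s i x} \<inter> S \<in> sets (lebesgue_on S)"
          using s(1)[of i] that \<open>T \<subseteq> S\<close> by (auto simp: simple_function_def)
        then have "s i -` {s i x} \<inter> S \<inter> T \<in> sets lebesgue"
          using assms by (auto simp: sets_restrict_space_iff)
        moreover have "s i -` {s i x} \<inter> S \<inter> T = s i -` {s i x} \<inter> T"
          using \<open>T \<subseteq> S\<close> by auto
        ultimately show ?thesis
          using assms by (simp add: sets_restrict_space_iff)
      qed
      ultimately show ?thesis
        by (simp add: simple_function_def)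
    qed
    show "AE x in lebesgue_on T. (\<lambda>i. s i x) \<longlonglongrightarrow> f x"
      using s(2) assms by (auto simp: AE_restrict_space_iff)
  qed
qed

section \<open>Existence and uniqueness of the Bochner integral\<close>

lemma bint_eqI:
  assumes "has_bint M f I" "\<And>J. has_bint M f J \<Longrightarrow> J = I"
  shows "bint M f = I"
  unfolding bint_def using assms by (rule the_equality)

text \<open>Both simple functions are compared through \<open>f\<close>. Applied to a sequence
  approximating \<open>f\<close> in mean, this makes its integrals a Cauchy sequence.\<close>

lemma simple_bochner_integral_norm_diff_le:
  assumes meas: "(\<lambda>x. norm (f x - s x)) \<in> borel_measurable M" "(\<lambda>x. norm (f x - t x)) \<in> borel_measurable M"
    and s: "Bochner_Integration.simple_bochner_integrable M s"
    and t: "Bochner_Integration.simple_bochner_integrable M t"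
  shows "ennreal (norm (Bochner_Integration.simple_bochner_integral M s - Bochner_Integration.simple_bochner_integral M t)) \<le>
    (\<integral>\<^sup>+x. norm (f x - s x) \<partial>M) + (\<integral>\<^sup>+x. norm (f x - t x) \<partial>M)"
proof -
  have "ennreal (norm (Bochner_Integration.simple_bochner_integral M s - Bochner_Integration.simple_bochner_integral M t)) =
      norm (Bochner_Integration.simple_bochner_integral M (\<lambda>x. s x - t x))"
    using s t by (simp add: simple_bochner_integral_diff)
  also have "\<dots> \<le> Bochner_Integration.simple_bochner_integral M (\<lambda>x. norm (s x - t x))"
    using simple_bochner_integrable_compose2[of "(-)" M s t] s t
    by (auto intro!: simple_bochner_integral_norm_bound)
  also have "\<dots> = (\<integral>\<^sup>+x. norm (s x - t x) \<partial>M)"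
    using simple_bochner_integrable_compose2[of "\<lambda>x y. norm (x - y)" M s t] s t
    by (auto intro!: simple_bochner_integral_eq_nn_integral)
  also have "\<dots> \<le> (\<integral>\<^sup>+x. ennreal (norm (f x - s x)) + ennreal (norm (f x - t x)) \<partial>M)"
  proof (rule nn_integral_mono)
    fix x
    have "norm (s x - t x) \<le> norm (f x - s x) + norm (f x - t x)"
      by (metis dual_order.refl norm_diff_triangle_le norm_minus_commute)
    then show "ennreal (norm (s x - t x)) \<le> ennreal (norm (f x - s x)) + ennreal (norm (f x - t x))"
      by (simp flip: ennreal_plus)
  qed
  also have "\<dots> = (\<integral>\<^sup>+x. norm (f x - s x) \<partial>M) + (\<integral>\<^sup>+x. norm (f x - t x) \<partial>M)"
    using meas by (intro nn_integral_add) auto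
  finally show ?thesis .
qed

context complete_measure
begin

lemma borel_measurable_norm_diff_simple:
  assumes "strongly_measurable M f" "simple_function M s"
  shows "(\<lambda>x. norm (f x - s x)) \<in> borel_measurable M"
  by (rule strongly_measurable_imp_borel_measurable[OF strongly_measurable_norm[OF
        strongly_measurable_diff[OF assms(1) strongly_measurable_simple[OF assms(2)]]]])

lemma has_bint_bounded_linear:
  assumes T: "bounded_linear T" and "has_bint M f I"
  shows "has_bint M (\<lambda>x. T (f x)) (T I)"
proof -
  interpret T: bounded_linear T by fact
  from assms obtain s where f: "strongly_measurable M f"
    and s: "\<And>i::nat. Bochner_Integration.simple_bochner_integrable M (s i)"
      "(\<lambda>i. \<integral>\<^sup>+x. ennreal (norm (f x - s i x)) \<partial>M) \<longlonglongrightarrow> 0"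
      "(\<lambda>i. Bochner_Integration.simple_bochner_integral M (s i)) \<longlonglongrightarrow> I"
    unfolding has_bint_def by blast
  obtain K where K: "0 < K" "\<And>x. norm (T x) \<le> norm x * K"
    using T.pos_bounded by blast
  have sf: "simple_function M (s i)" for i
    using s(1) by (rule simple_bochner_integrable.cases)
  show ?thesis
    unfolding has_bint_def
  proof (intro conjI exI[of _ "\<lambda>i x. T (s i x)"] allI)
    show "strongly_measurable M (\<lambda>x. T (f x))"
      by (rule strongly_measurable_compose[OF f]) (rule linear_continuous_at[OF T])
    show "Bochner_Integration.simple_bochner_integrable M (\<lambda>x. T (s i x))" for i
      using simple_bochner_integrable_compose2[of "\<lambda>x y. T x" M "s i" "s i"] s(1) T.zero by simp
    show "(\<lambda>i. Bochner_Integration.simple_bochner_integral M (\<lambda>x. T (s i x))) \<longlonglongrightarrow> T I"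
      using T.tendsto[OF s(3)] by (simp add: simple_bochner_integral_linear[OF T.linear_axioms s(1)])
    show "(\<lambda>i. \<integral>\<^sup>+x. ennreal (norm (T (f x) - T (s i x))) \<partial>M) \<longlonglongrightarrow> 0"
    proof (rule tendsto_sandwich[where f = "\<lambda>_. 0"])
      show "\<forall>\<^sub>F i in sequentially. (\<integral>\<^sup>+x. ennreal (norm (T (f x) - T (s i x))) \<partial>M) \<le>
          ennreal K * (\<integral>\<^sup>+x. ennreal (norm (f x - s i x)) \<partial>M)"
      proof (intro always_eventually allI)
        fix i
        have "(\<integral>\<^sup>+x. ennreal (norm (T (f x) - T (s i x))) \<partial>M) \<le> (\<integral>\<^sup>+x. ennreal K * ennreal (norm (f x - s i x)) \<partial>M)"
          using K by (intro nn_integral_mono) (auto simp: T.diff[symmetric] mult.commute simp flip: ennreal_mult)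
        also have "\<dots> = ennreal K * (\<integral>\<^sup>+x. ennreal (norm (f x - s i x)) \<partial>M)"
          using borel_measurable_norm_diff_simple[OF f sf] by (intro nn_integral_cmult) auto
        finally show "(\<integral>\<^sup>+x. ennreal (norm (T (f x) - T (s i x))) \<partial>M) \<le>
          ennreal K * (\<integral>\<^sup>+x. ennreal (norm (f x - s i x)) \<partial>M)" .
      qed
      show "(\<lambda>i. ennreal K * (\<integral>\<^sup>+x. ennreal (norm (f x - s i x)) \<partial>M)) \<longlonglongrightarrow> 0"
        using ennreal_tendsto_cmult[OF _ s(2), of "ennreal K"] by simp
    qed auto
  qed
qed

lemma has_bint_imp_has_bochner_integral:
  fixes f :: "'a \<Rightarrow> 'b::{real_normed_vector, second_countable_topology}"
  assumes "has_bint M f I"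
  shows "has_bochner_integral M f I"
  using assms unfolding has_bint_def
  by (auto intro: has_bochner_integral.intros strongly_measurable_imp_borel_measurable)

lemma has_bint_cinner:
  assumes "has_bint M f I"
  shows "has_bochner_integral M (\<lambda>x. cinner (f x) y) (cinner I y)"
  by (intro has_bint_imp_has_bochner_integral has_bint_bounded_linear[OF bounded_linear_cinner_left] assms)

text \<open>Tested against any \<open>y\<close>, both values become the integral of one scalar
  function.\<close>

lemma has_bint_unique:
  fixes I :: "'h::complex_hilbert"
  assumes "has_bint M f I" "has_bint M f J"
  shows "I = J"
proof -
  have "cinner I y = cinner J y" for y
    using has_bint_cinner[OF assms(1)] has_bint_cinner[OF assms(2)] by (rule has_bochner_integral_eq)
  then have "cinner (I - J) (I - J) = 0"
    by (simp add: cinner_diff_left)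
  then show ?thesis by simp
qed

lemma bint_eq:
  fixes I :: "'h::complex_hilbert"
  shows "has_bint M f I \<Longrightarrow> bint M f = I"
  using bint_eqI has_bint_unique by metis

lemma has_bint_bint:
  fixes f :: "'a \<Rightarrow> 'h::complex_hilbert"
  assumes f: "strongly_measurable M f" and fin: "(\<integral>\<^sup>+x. norm (f x) \<partial>M) < \<infinity>"
  shows "has_bint M f (bint M f)"
proof -
  obtain s where s: "\<And>i::nat. simple_function M (s i)" "AE x in M. (\<lambda>i. s i x) \<longlonglongrightarrow> f x"
    using f by (rule strongly_measurableE) blast
  have [measurable]: "f \<in> borel_measurable M" "s i \<in> borel_measurable M" for i
    using f s(1) by (auto intro: strongly_measurable_imp_borel_measurable borel_measurable_simple_function)
  \<comment> \<open>Cutting off at \<open>2 * norm (f x)\<close> dominates the simple functions by a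
    multiple of \<open>norm (f x)\<close> and so makes them integrable. Where
    \<open>f x \<noteq> 0\<close> the cut is eventually inactive, since \<open>norm (s i x)\<close>
    tends to \<open>norm (f x)\<close>, which is below the threshold; where \<open>f x = 0\<close>
    it forces the value \<open>0\<close>.\<close>
  define t where "t i x = (if norm (s i x) \<le> 2 * norm (f x) then s i x else 0)" for i x
  have t: "simple_function M (t i)" for i
    unfolding t_def by (rule simple_function_If[OF s(1) simple_function_const]) measurable
  have t_le: "norm (t i x) \<le> 2 * norm (f x)" for i x
    by (simp add: t_def)
  have t_lim: "AE x in M. (\<lambda>i. t i x) \<longlonglongrightarrow> f x"
    using s(2)
  proof eventually_elim
    case (elim x)
    show ?case
    proof (cases "f x = 0")
      case True
      then have "t i x = 0" for i by (simp add: t_def)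
      with True show ?thesis by simp
    next
      case False
      then have "\<forall>\<^sub>F i in sequentially. norm (s i x) < 2 * norm (f x)"
        using order_tendstoD(2)[OF tendsto_norm[OF elim], of "2 * norm (f x)"] by simp
      then have "\<forall>\<^sub>F i in sequentially. s i x = t i x"
        by eventually_elim (simp add: t_def)
      with elim show ?thesis by (rule Lim_transform_eventually)
    qed
  qed
  have tb: "Bochner_Integration.simple_bochner_integrable M (t i)" for i
  proof (rule simple_bochner_integrableI_bounded[OF t])
    have "(\<integral>\<^sup>+x. norm (t i x) \<partial>M) \<le> (\<integral>\<^sup>+x. 2 * ennreal (norm (f x)) \<partial>M)"
    proof (rule nn_integral_mono)
      fix x
      show "ennreal (norm (t i x)) \<le> 2 * ennreal (norm (f x))"
        using ennreal_leI[OF t_le[of i x]] by (simp add: ennreal_mult')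
    qed
    also have "\<dots> = 2 * (\<integral>\<^sup>+x. norm (f x) \<partial>M)"
      by (rule nn_integral_cmult) measurable
    also have "\<dots> < \<infinity>"
      using fin by (simp add: ennreal_mult_less_top)
    finally show "(\<integral>\<^sup>+x. norm (t i x) \<partial>M) < \<infinity>" .
  qed
  have meas: "(\<lambda>x. norm (f x - t i x)) \<in> borel_measurable M" for i
    by (rule borel_measurable_norm_diff_simple[OF f t])
  have lim: "(\<lambda>i. \<integral>\<^sup>+x. ennreal (norm (f x - t i x)) \<partial>M) \<longlonglongrightarrow> (\<integral>\<^sup>+x. 0 \<partial>M)"
  proof (rule nn_integral_dominated_convergence)
    show "(\<lambda>x. ennreal (norm (f x - t i x))) \<in> borel_measurable M" for i
      using meas by measurable
    show "AE x in M. ennreal (norm (f x - t i x)) \<le> 3 * ennreal (norm (f x))" for i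
    proof (rule AE_I2)
      fix x
      have "norm (f x - t i x) \<le> 3 * norm (f x)"
        using norm_triangle_ineq4[of "f x" "t i x"] t_le[of i x] by linarith
      then show "ennreal (norm (f x - t i x)) \<le> 3 * ennreal (norm (f x))"
        using ennreal_leI[of "norm (f x - t i x)" "3 * norm (f x)"] by (simp add: ennreal_mult')
    qed
    have "(\<integral>\<^sup>+x. 3 * ennreal (norm (f x)) \<partial>M) = 3 * (\<integral>\<^sup>+x. norm (f x) \<partial>M)"
      by (rule nn_integral_cmult) measurable
    then show "(\<integral>\<^sup>+x. 3 * ennreal (norm (f x)) \<partial>M) < \<infinity>"
      using fin by (simp add: ennreal_mult_less_top)
    show "AE x in M. (\<lambda>i. ennreal (norm (f x - t i x))) \<longlonglongrightarrow> 0"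
      using t_lim
    proof eventually_elim
      case (elim x)
      have "(\<lambda>i. norm (f x - t i x)) \<longlonglongrightarrow> norm (f x - f x)"
        by (intro tendsto_intros elim)
      then show ?case
        using tendsto_ennrealI by fastforce
    qed
  qed auto
  let ?I = "\<lambda>i. Bochner_Integration.simple_bochner_integral M (t i)"
  have "Cauchy ?I"
  proof (rule metric_CauchyI)
    fix e :: real assume "0 < e"
    then have "\<forall>\<^sub>F i in sequentially. (\<integral>\<^sup>+x. ennreal (norm (f x - t i x)) \<partial>M) < ennreal (e / 2)"
      using order_tendstoD(2)[OF lim, of "ennreal (e / 2)"] by simp
    then obtain n where n: "\<And>i. n \<le> i \<Longrightarrow> (\<integral>\<^sup>+x. ennreal (norm (f x - t i x)) \<partial>M) < ennreal (e / 2)"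
      unfolding eventually_sequentially by blast
    have "dist (?I i) (?I j) < e" if "n \<le> i" "n \<le> j" for i j
    proof -
      have "ennreal (norm (?I i - ?I j)) < ennreal (e / 2) + ennreal (e / 2)"
        using simple_bochner_integral_norm_diff_le[OF meas meas tb tb, of i j] n[OF that(1)] n[OF that(2)]
        by (meson add_strict_mono le_less_trans)
      also have "\<dots> = ennreal e"
        using \<open>0 < e\<close> by (simp flip: ennreal_plus)
      finally show ?thesis
        by (simp add: dist_norm ennreal_less_iff)
    qed
    then show "\<exists>n. \<forall>i\<ge>n. \<forall>j\<ge>n. dist (?I i) (?I j) < e" by blast
  qed
  then obtain I where I: "?I \<longlonglongrightarrow> I"
    using Cauchy_convergent convergent_def by blast
  have "has_bint M f I"
    unfolding has_bint_def using f tb lim I by (auto intro!: exI[of _ t])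
  then show ?thesis
    by (simp add: bint_eq)
qed

text \<open>The exceptional null set depends on \<open>y\<close>. The approximating simple functions
  take countably many values altogether, so one null set serves for all of these \<open>y\<close>;
  almost everywhere \<open>f x\<close> is a limit of such values and hence orthogonal to
  itself.\<close>

lemma AE_eq_0_if_cinner_AE_eq_0:
  fixes f :: "'a \<Rightarrow> 'h::complex_hilbert"
  assumes f: "strongly_measurable M f" and 0: "\<And>y. AE x in M. cinner (f x) y = 0"
  shows "AE x in M. f x = 0"
proof -
  obtain s where s: "\<And>i::nat. simple_function M (s i)" "AE x in M. (\<lambda>i. s i x) \<longlonglongrightarrow> f x"
    using f by (rule strongly_measurableE) blast
  define Y where "Y = (\<Union>i. s i ` space M)"
  have "countable Y"
    unfolding Y_def using s(1) by (intro countable_UN) (auto simp: simple_function_def countable_finite)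
  then have "AE x in M. \<forall>y\<in>Y. cinner (f x) y = 0"
    using 0 by (subst AE_ball_countable) auto
  with s(2) AE_space show ?thesis
  proof eventually_elim
    case (elim x)
    have "(\<lambda>i. cinner (f x) (s i x)) \<longlonglongrightarrow> cinner (f x) (f x)"
      by (intro bounded_bilinear.tendsto[OF bounded_bilinear_cinner] tendsto_const elim)
    moreover have "cinner (f x) (s i x) = 0" for i
      using elim by (auto simp: Y_def)
    ultimately show ?case
      by (simp add: LIMSEQ_const_iff)
  qed
qed

end

section \<open>Scalar Fourier coefficients on an interval\<close>

locale interval =
  fixes \<omega> :: real
  assumes \<omega>: "0 < \<omega>"
begin

abbreviation M :: "real measure" where "M \<equiv> lebesgue_on {0..\<omega>}"

definition ex :: "int \<Rightarrow> real \<Rightarrow> complex" where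
  "ex l s = exp (\<i> * complex_of_real (2 * pi * of_int l * s / \<omega>))"

lemma norm_ex [simp]: "cmod (ex l s) = 1"
  by (simp add: ex_def)

lemma ex_0 [simp]: "ex 0 s = 1" and ex_at_0 [simp]: "ex l 0 = 1"
  by (simp_all add: ex_def)

lemma ex_at_\<omega> [simp]: "ex l \<omega> = 1"
proof -
  have "\<i> * complex_of_real (2 * pi * of_int l * \<omega> / \<omega>) = (2 * of_int l * pi) * \<i>"
    using \<omega> by simp
  then show ?thesis
    unfolding ex_def exp_eq_1 by auto
qed

lemma ex_add: "ex (l + m) s = ex l s * ex m s"
  by (simp add: ex_def field_simps add_divide_distrib distrib_left distrib_right flip: exp_add)

lemma cnj_ex: "cnj (ex l s) = ex (- l) s"
  by (simp add: ex_def exp_cnj)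

lemma exp_minus_eq_ex: "exp (- (\<i> * complex_of_real (2 * pi * of_int n * s / \<omega>))) = ex (- n) s"
  by (simp add: ex_def)

definition freq :: "int \<Rightarrow> complex" where "freq l = \<i> * complex_of_real (2 * pi * of_int l / \<omega>)"

lemma freq_eq_0_iff [simp]: "freq l = 0 \<longleftrightarrow> l = 0"
  using \<omega> by (simp add: freq_def)

lemma ex_derivative: "(ex l has_vector_derivative (freq l * ex l t)) (at t within S)"
proof -
  have "((\<lambda>s. exp (freq l * of_real s)) has_vector_derivative (freq l * exp (freq l * of_real t))) (at t within S)"
    by (rule has_vector_derivative_real_field) (auto intro!: derivative_eq_intros)
  moreover have "exp (freq l * of_real s) = ex l s" for s
    by (simp add: ex_def freq_def mult.assoc)
  ultimately show ?thesis by simp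
qed

lemma continuous_on_ex [continuous_intros]: "continuous_on S (ex l)"
  unfolding ex_def by (intro continuous_intros) (use \<omega> in auto)

lemma finite_measure_M: "finite_measure M"
  by (rule finite_measure_lebesgue_on) (simp add: bounded_set_imp_lmeasurable)

lemma complete_M: "complete_measure M"
  by (rule complete_lebesgue_on) simp

lemma integrable_continuous_M: "continuous_on {0..\<omega>} f \<Longrightarrow> integrable M (f :: real \<Rightarrow> complex)"
  by (rule continuous_imp_integrable_real)

lemma integrable_ex_mult:
  assumes "integrable M h" shows "integrable M (\<lambda>s. ex l s * h s)"
proof (rule Bochner_Integration.integrable_bound[OF assms])
  have "ex l \<in> borel_measurable M"
    by (rule continuous_imp_measurable_on_sets_lebesgue) (auto intro: continuous_intros)
  then show "(\<lambda>s. ex l s * h s) \<in> borel_measurable M"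
    using assms by measurable
qed (simp add: norm_mult)

lemma integral_ex: "(LINT s|M. ex l s) = (if l = 0 then complex_of_real \<omega> else 0)"
proof (cases "l = 0")
  case True
  then show ?thesis
    using \<omega> by (simp add: measure_restrict_space scaleR_conv_of_real)
next
  case False
  have "(LINT s|M. ex l s) = integral {0..\<omega>} (ex l)"
    by (intro lebesgue_integral_eq_integral integrable_continuous_M continuous_intros) auto
  moreover have "((\<lambda>s. freq l * ex l s) has_integral (ex l \<omega> - ex l 0)) {0..\<omega>}"
    using \<omega> by (intro fundamental_theorem_of_calculus ex_derivative) auto
  then have "((\<lambda>s. (1 / freq l) * (freq l * ex l s)) has_integral (1 / freq l) * (ex l \<omega> - ex l 0)) {0..\<omega>}"
    by (rule has_integral_mult_right)
  then have "(ex l has_integral 0) {0..\<omega>}"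
    using False by simp
  ultimately show ?thesis
    using False by (simp add: integral_unique)
qed

subsection \<open>Uniqueness for continuous functions\<close>

lemma ex_1_inject:
  assumes "s \<in> {0..\<omega>}" "t \<in> {0..\<omega>}" "ex 1 s = ex 1 t"
  shows "s = t \<or> {s, t} = {0, \<omega>}"
proof -
  obtain n :: int where "\<i> * complex_of_real (2 * pi * s / \<omega>) = \<i> * complex_of_real (2 * pi * t / \<omega>) + (of_int (2 * n) * pi) * \<i>"
    using assms(3) unfolding ex_def exp_eq by auto
  then have "Im (\<i> * complex_of_real (2 * pi * s / \<omega>)) = Im (\<i> * complex_of_real (2 * pi * t / \<omega>) + (of_int (2 * n) * pi) * \<i>)"
    by (rule arg_cong)
  then have "2 * pi * s / \<omega> = 2 * pi * t / \<omega> + 2 * n * pi"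
    by simp
  then have "pi * s = pi * (t + n * \<omega>)"
    using \<omega> by (simp add: field_simps)
  then have st: "s = t + n * \<omega>"
    by simp
  \<comment> \<open>\<open>s\<close> and \<open>t\<close> differ by \<open>n\<close> periods but lie
    in one closed period, so \<open>n\<close> is \<open>-1\<close>, \<open>0\<close> or
    \<open>1\<close>; the outer values force the two endpoints.\<close>
  have "\<bar>n * \<omega>\<bar> \<le> 1 * \<omega>"
    using st assms by auto
  then have "\<bar>real_of_int n\<bar> \<le> 1"
    using \<omega> by (simp add: abs_mult)
  then have "n = 0 \<or> n = 1 \<or> n = -1"
    by linarith
  then show ?thesis
    using st assms by auto
qed

lemma ex_1_surj:
  assumes "cmod w = 1" shows "\<exists>s\<in>{0..\<omega>}. ex 1 s = w"
proof
  let ?s = "\<omega> * Arg2pi w / (2 * pi)"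
  have "Arg2pi w / (2 * pi) \<le> 1"
    using Arg2pi[of w] by simp
  then have "\<omega> * (Arg2pi w / (2 * pi)) \<le> \<omega> * 1"
    using \<omega> by (intro mult_left_mono) auto
  then show "?s \<in> {0..\<omega>}"
    using Arg2pi[of w] \<omega> by auto
  have "ex 1 ?s = exp (\<i> * of_real (Arg2pi w))"
    using \<omega> by (simp add: ex_def)
  then show "ex 1 ?s = w"
    using Arg2pi_eq[of w] assms by simp
qed

text \<open>\<open>ex 1\<close> maps the compact interval onto the circle, identifying just the
  endpoints, at which \<open>u\<close> agrees. Continuity of \<open>v\<close> holds because
  preimages of closed sets under \<open>v\<close> are images of compact sets under
  \<open>ex 1\<close>.\<close>

lemma factor_through_circle:
  fixes u :: "real \<Rightarrow> real"
  assumes u: "continuous_on {0..\<omega>} u" "u 0 = u \<omega>"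
  obtains v where "continuous_on (sphere 0 1) v" "\<And>s. s \<in> {0..\<omega>} \<Longrightarrow> v (ex 1 s) = u s"
proof -
  define v where "v w = u (SOME s. s \<in> {0..\<omega>} \<and> ex 1 s = w)" for w
  have v: "v (ex 1 s) = u s" if s: "s \<in> {0..\<omega>}" for s
  proof -
    let ?t = "SOME t. t \<in> {0..\<omega>} \<and> ex 1 t = ex 1 s"
    have "?t \<in> {0..\<omega>} \<and> ex 1 ?t = ex 1 s"
      by (rule someI[of _ s]) (use s in auto)
    then have "?t = s \<or> {?t, s} = {0, \<omega>}"
      using ex_1_inject[of ?t s] s by blast
    then show ?thesis
      using u(2) by (auto simp: v_def doubleton_eq_iff)
  qed
  have "continuous_on (sphere 0 1) v"
    unfolding continuous_on_closed_vimage[OF closed_sphere]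
  proof (intro allI impI)
    fix B :: "real set" assume "closed B"
    then have "closed (u -` B \<inter> {0..\<omega>})"
      by (rule closed_vimage_Int) (use u in auto)
    then have "compact (u -` B \<inter> {0..\<omega>})"
      by (metis Int_lower2 bounded_closed_interval bounded_subset compact_eq_bounded_closed)
    then have "compact (ex 1 ` (u -` B \<inter> {0..\<omega>}))"
      by (intro compact_continuous_image continuous_intros)
    moreover have "v -` B \<inter> sphere 0 1 = ex 1 ` (u -` B \<inter> {0..\<omega>})"
    proof (intro equalityI subsetI)
      fix w assume w: "w \<in> v -` B \<inter> sphere 0 1"
      then obtain s where "s \<in> {0..\<omega>}" "ex 1 s = w"
        using ex_1_surj[of w] by auto
      with w v show "w \<in> ex 1 ` (u -` B \<inter> {0..\<omega>})" by force
    qed (use v in auto)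
    ultimately show "closed (v -` B \<inter> sphere 0 1)"
      by (simp add: compact_imp_closed)
  qed
  with v that show thesis by blast
qed

definition null_fourier :: "(real \<Rightarrow> complex) \<Rightarrow> bool" where
  "null_fourier J \<longleftrightarrow> continuous_on {0..\<omega>} J \<and> (\<forall>l. (LINT s|M. ex l s * J s) = 0)"

lemma null_fourier_ex_mult: "null_fourier J \<Longrightarrow> null_fourier (\<lambda>s. ex m s * J s)"
  unfolding null_fourier_def
  by (auto intro!: continuous_intros simp: mult.assoc[symmetric] ex_add[symmetric])

lemma null_fourier_add:
  assumes "null_fourier J" "null_fourier K" shows "null_fourier (\<lambda>s. J s + K s)"
proof -
  have "(LINT s|M. ex l s * (J s + K s)) = (LINT s|M. ex l s * J s) + (LINT s|M. ex l s * K s)" for l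
    using assms unfolding null_fourier_def distrib_left
    by (intro Bochner_Integration.integral_add integrable_continuous_M continuous_intros) auto
  with assms show ?thesis
    by (auto simp: null_fourier_def intro!: continuous_intros)
qed

lemma null_fourier_cmult:
  assumes "null_fourier J" shows "null_fourier (\<lambda>s. c * J s)"
proof -
  have "(LINT s|M. ex l s * (c * J s)) = c * (LINT s|M. ex l s * J s)" for l
    by (simp add: mult.left_commute)
  with assms show ?thesis
    by (auto simp: null_fourier_def intro!: continuous_intros)
qed

text \<open>The multipliers that preserve \<^const>\<open>null_fourier\<close> form an algebra of functions on the circle,
  so that the Stone-Weierstrass theorem applies.\<close>

lemma trigonometric_approximation:
  fixes u :: "real \<Rightarrow> real"
  assumes u: "continuous_on {0..\<omega>} u" "u 0 = u \<omega>" and "0 < e"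
  obtains g where "continuous_on {0..\<omega>} g" "\<And>s. s \<in> {0..\<omega>} \<Longrightarrow> \<bar>u s - g s\<bar> < e"
    "\<And>J. null_fourier J \<Longrightarrow> null_fourier (\<lambda>s. complex_of_real (g s) * J s)"
proof -
  obtain v where v: "continuous_on (sphere 0 1) v" "\<And>s. s \<in> {0..\<omega>} \<Longrightarrow> v (ex 1 s) = u s"
    using factor_through_circle[OF u] by blast
  define Q where "Q f \<longleftrightarrow> continuous_on (sphere 0 1) f \<and>
    (\<forall>J. null_fourier J \<longrightarrow> null_fourier (\<lambda>s. complex_of_real (f (ex 1 s)) * J s))" for f :: "complex \<Rightarrow> real"
  have Q_Re: "Q Re"
    unfolding Q_def
  proof (intro conjI allI impI)
    fix J assume "null_fourier J"
    then have "null_fourier (\<lambda>s. (1 / 2) * (ex 1 s * J s + ex (-1) s * J s))"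
      by (intro null_fourier_cmult null_fourier_add null_fourier_ex_mult)
    moreover have "(1 / 2) * (ex 1 s * J s + ex (-1) s * J s) = complex_of_real (Re (ex 1 s)) * J s" for s
      by (simp add: complex_add_cnj distrib_right[symmetric] flip: cnj_ex)
    ultimately show "null_fourier (\<lambda>s. complex_of_real (Re (ex 1 s)) * J s)"
      by simp
  qed (intro continuous_intros)
  have Q_Im: "Q Im"
    unfolding Q_def
  proof (intro conjI allI impI)
    fix J assume "null_fourier J"
    then have "null_fourier (\<lambda>s. (1 / (2 * \<i>)) * (ex 1 s * J s + (-1) * (ex (-1) s * J s)))"
      by (intro null_fourier_cmult null_fourier_add null_fourier_ex_mult)
    moreover have "(1 / (2 * \<i>)) * (ex 1 s * J s + (-1) * (ex (-1) s * J s)) = complex_of_real (Im (ex 1 s)) * J s" for s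
    proof -
      have "ex 1 s * J s + (-1) * (ex (-1) s * J s) = (ex 1 s - cnj (ex 1 s)) * J s"
        by (simp add: cnj_ex left_diff_distrib)
      also have "\<dots> = (2 * \<i>) * (complex_of_real (Im (ex 1 s)) * J s)"
        by (simp add: complex_diff_cnj)
      finally show ?thesis by simp
    qed
    ultimately show "null_fourier (\<lambda>s. complex_of_real (Im (ex 1 s)) * J s)"
      by simp
  qed (intro continuous_intros)
  have "\<exists>g. Q g \<and> (\<forall>x\<in>sphere 0 1. \<bar>v x - g x\<bar> < e)"
  proof (rule Stone_Weierstrass_HOL[OF compact_sphere])
    show "Q (\<lambda>x. c)" for c
      by (auto simp: Q_def intro: null_fourier_cmult)
    show "Q (\<lambda>x. f x + g x)" if fg: "Q f \<and> Q g" for f g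
      unfolding Q_def
    proof (intro conjI allI impI)
      fix J assume "null_fourier J"
      then have "null_fourier (\<lambda>s. complex_of_real (f (ex 1 s)) * J s + complex_of_real (g (ex 1 s)) * J s)"
        using fg by (intro null_fourier_add) (auto simp: Q_def)
      then show "null_fourier (\<lambda>s. complex_of_real (f (ex 1 s) + g (ex 1 s)) * J s)"
        by (simp add: distrib_right)
    qed (use fg in \<open>auto simp: Q_def intro: continuous_intros\<close>)
    show "Q (\<lambda>x. f x * g x)" if fg: "Q f \<and> Q g" for f g
      unfolding Q_def
    proof (intro conjI allI impI)
      fix J assume "null_fourier J"
      then have "null_fourier (\<lambda>s. complex_of_real (f (ex 1 s)) * (complex_of_real (g (ex 1 s)) * J s))"
        using fg by (auto simp: Q_def)
      then show "null_fourier (\<lambda>s. complex_of_real (f (ex 1 s) * g (ex 1 s)) * J s)"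
        by (simp add: mult.assoc)
    qed (use fg in \<open>auto simp: Q_def intro: continuous_intros\<close>)
    \<comment> \<open>\<open>Re\<close> and \<open>Im\<close> together separate the points of the
      circle.\<close>
    show "\<exists>f. Q f \<and> f x \<noteq> f y" if "x \<in> sphere 0 1 \<and> y \<in> sphere 0 1 \<and> x \<noteq> y" for x y
      using that Q_Re Q_Im complex_eqI by blast
  qed (use v \<open>0 < e\<close> in \<open>auto simp: Q_def\<close>)
  then obtain g where g: "Q g" "\<And>x. cmod x = 1 \<Longrightarrow> \<bar>v x - g x\<bar> < e"
    by auto
  show thesis
  proof (rule that)
    have "continuous_on (sphere 0 1) g"
      using g(1) by (simp add: Q_def)
    then show "continuous_on {0..\<omega>} (\<lambda>s. g (ex 1 s))"
      by (rule continuous_on_compose2[OF _ continuous_on_ex]) auto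
    show "\<bar>u s - g (ex 1 s)\<bar> < e" if "s \<in> {0..\<omega>}" for s
      using g(2)[of "ex 1 s"] v(2)[OF that] by simp
  qed (use g(1) in \<open>auto simp: Q_def\<close>)
qed

text \<open>A multiplier \<open>q\<close> approximates the conjugate of \<open>J\<close> uniformly,
  and \<open>q s * J s\<close> has integral \<open>0\<close>. So the integral of
  \<open>(cmod (J s))\<^sup>2\<close> equals that of \<open>(cnj (J s) - q s) * J s\<close>, which
  is arbitrarily small. Equal endpoint values make the approximation on the circle possible.\<close>

lemma null_fourier_eq_0:
  assumes J: "null_fourier J" "J 0 = J \<omega>" and t: "t \<in> {0..\<omega>}"
  shows "J t = 0"
proof -
  have cont: "continuous_on {0..\<omega>} J"
    using J by (simp add: null_fourier_def)
  let ?n = "LINT s|M. (cmod (J s))\<^sup>2" and ?m = "LINT s|M. cmod (J s)"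
  have bound: "?n \<le> 2 * e * ?m" if e: "0 < e" for e
  proof -
    obtain g where g: "continuous_on {0..\<omega>} g" "\<And>s. s \<in> {0..\<omega>} \<Longrightarrow> \<bar>Re (J s) - g s\<bar> < e"
      "\<And>J. null_fourier J \<Longrightarrow> null_fourier (\<lambda>s. complex_of_real (g s) * J s)"
      by (rule trigonometric_approximation[of "\<lambda>s. Re (J s)" e]) (use cont J e in \<open>auto intro: continuous_intros\<close>)
    \<comment> \<open>The sign makes \<open>g s + \<i> * h s\<close> close to the conjugate of
      \<open>J s\<close>; two errors below \<open>e\<close> add up to the factor
      \<open>2 * e\<close>.\<close>
    obtain h where h: "continuous_on {0..\<omega>} h" "\<And>s. s \<in> {0..\<omega>} \<Longrightarrow> \<bar>- Im (J s) - h s\<bar> < e"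
      "\<And>J. null_fourier J \<Longrightarrow> null_fourier (\<lambda>s. complex_of_real (h s) * J s)"
      by (rule trigonometric_approximation[of "\<lambda>s. - Im (J s)" e]) (use cont J e in \<open>auto intro: continuous_intros\<close>)
    define q where "q s = complex_of_real (g s) + \<i> * complex_of_real (h s)" for s
    have q: "continuous_on {0..\<omega>} q"
      unfolding q_def using g h by (intro continuous_intros) auto
    have "null_fourier (\<lambda>s. complex_of_real (g s) * J s + \<i> * (complex_of_real (h s) * J s))"
      by (intro null_fourier_add null_fourier_cmult g h J)
    then have 0: "(LINT s|M. q s * J s) = 0"
      unfolding null_fourier_def q_def by (auto dest: spec[of _ 0] simp: algebra_simps)
    have "complex_of_real ?n = (LINT s|M. cnj (J s) * J s)"
    proof (subst integral_of_real[symmetric])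
      show "integrable M (\<lambda>s. (cmod (J s))\<^sup>2)"
        by (intro continuous_imp_integrable_real continuous_intros cont)
    qed (simp add: complex_norm_square mult.commute del: of_real_power)
    also have "\<dots> = (LINT s|M. cnj (J s) * J s) - (LINT s|M. q s * J s)"
      by (simp add: 0)
    also have "\<dots> = (LINT s|M. (cnj (J s) - q s) * J s)"
      unfolding left_diff_distrib using cont q
      by (intro Bochner_Integration.integral_diff[symmetric] integrable_continuous_M continuous_intros)
    finally have "complex_of_real ?n = (LINT s|M. (cnj (J s) - q s) * J s)" .
    moreover have "?n = cmod (complex_of_real ?n)"
      by (simp only: norm_of_real) simp
    ultimately have "?n = cmod (LINT s|M. (cnj (J s) - q s) * J s)"
      by simp
    also have "\<dots> \<le> (LINT s|M. cmod ((cnj (J s) - q s) * J s))"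
      by (rule integral_norm_bound)
    also have "\<dots> \<le> (LINT s|M. 2 * e * cmod (J s))"
    proof (rule integral_mono)
      show "integrable M (\<lambda>s. cmod ((cnj (J s) - q s) * J s))" "integrable M (\<lambda>s. 2 * e * cmod (J s))"
        using cont q by (auto intro!: continuous_imp_integrable_real continuous_intros)
      fix s assume "s \<in> space M"
      then have s: "s \<in> {0..\<omega>}" by simp
      have "cmod (cnj (J s) - q s) \<le> \<bar>Re (cnj (J s) - q s)\<bar> + \<bar>Im (cnj (J s) - q s)\<bar>"
        by (rule cmod_le)
      also have "\<dots> \<le> 2 * e"
        using g(2)[OF s] h(2)[OF s] by (simp add: q_def)
      finally show "cmod ((cnj (J s) - q s) * J s) \<le> 2 * e * cmod (J s)"
        by (simp add: norm_mult mult_right_mono)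
    qed
    also have "\<dots> = 2 * e * ?m"
      by simp
    finally show ?thesis .
  qed
  have "?n \<le> 0"
  proof (rule field_le_epsilon)
    fix e :: real assume e: "0 < e"
    define m where "m = ?m"
    have m: "0 \<le> m" by (simp add: m_def)
    \<comment> \<open>\<open>m + 1\<close> instead of \<open>m\<close>, since \<open>m\<close> may
      be \<open>0\<close>.\<close>
    have "0 < e / (2 * (m + 1))"
      using e m by simp
    then have "?n \<le> 2 * (e / (2 * (m + 1))) * m"
      using bound unfolding m_def by blast
    also have "\<dots> \<le> e"
      using e m by (simp add: field_simps)
    finally show "?n \<le> 0 + e" by simp
  qed
  moreover have "0 \<le> ?n" by simp
  ultimately have "?n = 0" by linarith
  then have "\<forall>s\<in>{0..\<omega>}. (cmod (J s))\<^sup>2 = 0"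
    using integralL_eq_0_iff[of 0 \<omega> "\<lambda>s. (cmod (J s))\<^sup>2"] cont \<omega> by (simp add: continuous_intros)
  with t show ?thesis by auto
qed

end

context interval
begin

subsection \<open>Indefinite integrals\<close>

lemma integral_lebesgue_on_restrict:
  fixes h :: "real \<Rightarrow> complex"
  assumes "{a..b} \<subseteq> {0..\<omega>}"
  shows "(LINT t|M. (if t \<in> {a..b} then h t else 0)) = (LINT t|lebesgue_on {a..b}. h t)"
  by (rule integral_restrict) (use assms in auto)

lemma integrable_lebesgue_on_subset:
  fixes h :: "real \<Rightarrow> complex"
  assumes "integrable M h" "t \<le> \<omega>"
  shows "integrable (lebesgue_on {0..t}) h"
proof -
  have "set_integrable lebesgue {0..\<omega>} h"
    using assms by (simp add: set_integrable_def integrable_restrict_space)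
  then have "set_integrable lebesgue {0..t} h"
    by (rule set_integrable_subset) (use assms in auto)
  then show ?thesis
    by (simp add: set_integrable_def integrable_restrict_space)
qed

text \<open>Integration by parts for an \<open>h\<close> that is merely integrable, by Fubini on the
  triangle \<open>t \<le> s\<close>: the inner integral over \<open>s\<close> from \<open>t\<close>
  to \<open>\<omega>\<close> produces \<open>ex l \<omega> - ex l t\<close>, and
  \<open>ex l \<omega> = 1\<close>.\<close>

lemma integral_by_parts_ex:
  fixes h :: "real \<Rightarrow> complex"
  assumes h: "integrable M h"
  shows "(LINT s|M. freq l * ex l s * (LINT t|lebesgue_on {0..s}. h t)) =
    (LINT t|M. h t) - (LINT t|M. ex l t * h t)"
proof -
  interpret M: finite_measure M by (rule finite_measure_M)
  interpret MM: pair_sigma_finite M M ..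
  define f where "f s t = (if t \<le> s then freq l * ex l s * h t else 0)" for s t
  have [measurable]: "h \<in> borel_measurable M" using h by measurable
  have [measurable]: "ex l \<in> borel_measurable M"
    by (rule continuous_imp_measurable_on_sets_lebesgue) (auto intro: continuous_on_ex)
  have [measurable]: "(\<lambda>s. s) \<in> borel_measurable M"
    by (rule continuous_imp_measurable_on_sets_lebesgue) (auto intro: continuous_intros)
  have f_meas: "case_prod f \<in> borel_measurable (M \<Otimes>\<^sub>M M)"
    unfolding f_def by measurable
  \<comment> \<open>The triangle kernel is dominated by this function, as \<open>ex l s\<close> has
    modulus \<open>1\<close>; it is integrable on the square because \<open>M\<close> is
    finite.\<close>
  have dom: "integrable (M \<Otimes>\<^sub>M M) (\<lambda>(s, t). freq l * h t)"
  proof (rule MM.Fubini_integrable)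
    show "(\<lambda>(s, t). freq l * h t) \<in> borel_measurable (M \<Otimes>\<^sub>M M)"
      by measurable
  qed (use h in auto)
  have "integrable (M \<Otimes>\<^sub>M M) (case_prod f)"
    by (rule Bochner_Integration.integrable_bound[OF dom f_meas]) (auto simp: f_def norm_mult)
  from MM.Fubini_integral[OF this]
  have "(LINT t|M. LINT s|M. f s t) = (LINT s|M. LINT t|M. f s t)" .
  moreover have "(LINT t|M. f s t) = freq l * ex l s * (LINT t|lebesgue_on {0..s}. h t)"
    if s: "s \<in> space M" for s
  proof -
    have "(LINT t|M. f s t) = (LINT t|M. freq l * ex l s * (if t \<in> {0..s} then h t else 0))"
      by (rule Bochner_Integration.integral_cong) (auto simp: f_def)
    also have "\<dots> = freq l * ex l s * (LINT t|M. (if t \<in> {0..s} then h t else 0))"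
      by simp
    also have "(LINT t|M. (if t \<in> {0..s} then h t else 0)) = (LINT t|lebesgue_on {0..s}. h t)"
      by (rule integral_lebesgue_on_restrict) (use s in auto)
    finally show ?thesis .
  qed
  then have "(LINT s|M. LINT t|M. f s t) = (LINT s|M. freq l * ex l s * (LINT t|lebesgue_on {0..s}. h t))"
    by (intro Bochner_Integration.integral_cong) auto
  moreover have "(LINT s|M. f s t) = h t - ex l t * h t" if t: "t \<in> space M" for t
  proof -
    have "(LINT s|M. f s t) = (LINT s|M. h t * (if s \<in> {t..\<omega>} then freq l * ex l s else 0))"
      by (rule Bochner_Integration.integral_cong) (use t in \<open>auto simp: f_def\<close>)
    also have "\<dots> = h t * (LINT s|M. (if s \<in> {t..\<omega>} then freq l * ex l s else 0))"
      by simp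
    also have "(LINT s|M. (if s \<in> {t..\<omega>} then freq l * ex l s else 0)) = (LINT s|lebesgue_on {t..\<omega>}. freq l * ex l s)"
      by (rule integral_lebesgue_on_restrict) (use t in auto)
    also have "\<dots> = integral {t..\<omega>} (\<lambda>s. freq l * ex l s)"
      by (intro lebesgue_integral_eq_integral continuous_imp_integrable_real continuous_intros) auto
    also have "\<dots> = ex l \<omega> - ex l t"
      using t by (intro integral_unique fundamental_theorem_of_calculus ex_derivative) auto
    finally show ?thesis
      by (simp add: algebra_simps)
  qed
  then have "(LINT t|M. LINT s|M. f s t) = (LINT t|M. h t - ex l t * h t)"
    by (intro Bochner_Integration.integral_cong) auto
  moreover have "(LINT t|M. h t - ex l t * h t) = (LINT t|M. h t) - (LINT t|M. ex l t * h t)"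
    by (intro Bochner_Integration.integral_diff h integrable_ex_mult)
  ultimately show ?thesis by simp
qed

lemma continuous_on_indefinite_integral:
  fixes h :: "real \<Rightarrow> complex"
  assumes h: "integrable M h"
  shows "continuous_on {0..\<omega>} (\<lambda>t. LINT s|lebesgue_on {0..t}. h s)"
proof -
  have "continuous_on {0..\<omega>} (\<lambda>t. integral {0..t} h)"
    by (intro indefinite_integral_continuous_1 integrable_on_lebesgue_on h) simp
  moreover have "integral {0..t} h = (LINT s|lebesgue_on {0..t}. h s)" if "t \<in> {0..\<omega>}" for t
    using that by (intro lebesgue_integral_eq_integral[symmetric] integrable_lebesgue_on_subset[OF h]) auto
  ultimately show ?thesis
    by (rule continuous_on_eq)
qed

text \<open>The sets over which \<open>h\<close>, extended by zero, has integral zero contain the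
  half-lines and allow complements and disjoint countable unions, hence include the Borel sets by
  Dynkin's argument. A Lebesgue set differs from a Borel set by a null set, and a density with all
  integrals zero vanishes almost everywhere.\<close>

lemma AE_eq_0_if_indefinite_integral_eq_0:
  fixes h :: "real \<Rightarrow> complex"
  assumes h: "integrable M h" and 0: "\<And>t. t \<in> {0..\<omega>} \<Longrightarrow> (LINT s|lebesgue_on {0..t}. h s) = 0"
  shows "AE s in M. h s = 0"
proof -
  \<comment> \<open>Extending \<open>h\<close> by zero turns an integral over a half-line into one
    over an interval starting at \<open>0\<close>, about which the assumption speaks.\<close>
  define g where "g s = indicat_real {0..\<omega>} s *\<^sub>R h s" for s
  have g: "integrable lebesgue g"
    using h by (simp add: g_def[abs_def] integrable_restrict_space)
  have total: "(LINT s|lebesgue. g s) = 0"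
    using 0[of \<omega>] \<omega> by (simp add: g_def integral_restrict_space)
  have si: "set_integrable lebesgue A g" if "A \<in> sets lebesgue" for A
    using integrable_mult_indicator[OF that g] by (simp add: set_integrable_def)
  have borel: "(LINT s:A|lebesgue. g s) = 0" if "A \<in> sigma_sets UNIV (range (\<lambda>a::real. {..a}))" for A
  proof (rule sigma_sets_induct_disjoint[OF _ _ that])
    have ss: "sigma_sets UNIV (range (\<lambda>a::real. {..a})) = sets borel"
      by (simp add: borel_eq_atMost)
    show "Int_stable (range (\<lambda>a::real. {..a}))"
    proof (rule Int_stableI_image)
      show "\<exists>c\<in>UNIV. {..a} \<inter> {..b} = {..c}" for a b :: real
        by (rule bexI[of _ "min a b"]) auto
    qed
    show "(LINT s:B|lebesgue. g s) = 0" if "B \<in> range (\<lambda>a::real. {..a})" for B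
    proof -
      from that obtain a where B: "B = {..a}" by auto
      have "(LINT s:B|lebesgue. g s) = (LINT s|lebesgue. indicat_real {0..min a \<omega>} s *\<^sub>R h s)"
        unfolding set_lebesgue_integral_def g_def B
        by (rule Bochner_Integration.integral_cong) (auto simp: indicator_def)
      also have "\<dots> = (LINT s|lebesgue_on {0..min a \<omega>}. h s)"
        by (simp add: integral_restrict_space)
      also have "\<dots> = 0"
      proof (cases "0 \<le> a")
        case True
        then show ?thesis using \<omega> by (intro 0) auto
      next
        case False
        then have "{0..min a \<omega>} = {}" by auto
        then show ?thesis by simp
      qed
      finally show ?thesis .
    qed
    show "(LINT s:{}|lebesgue. g s) = 0"
      by (simp add: set_lebesgue_integral_def)
    show "(LINT s:UNIV - B|lebesgue. g s) = 0"
      if B: "B \<in> sigma_sets UNIV (range (\<lambda>a::real. {..a}))" "(LINT s:B|lebesgue. g s) = 0" for B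
    proof -
      have Bs: "B \<in> sets lebesgue"
        using B(1) by (simp add: ss)
      have "(LINT s:UNIV - B|lebesgue. g s) = (LINT s|lebesgue. g s - indicat_real B s *\<^sub>R g s)"
        unfolding set_lebesgue_integral_def
        by (rule Bochner_Integration.integral_cong) (auto simp: indicator_def)
      also have "\<dots> = (LINT s|lebesgue. g s) - (LINT s:B|lebesgue. g s)"
        using si[OF Bs] g unfolding set_lebesgue_integral_def set_integrable_def
        by (intro Bochner_Integration.integral_diff)
      finally show ?thesis
        using B total by simp
    qed
    show "(LINT s:(\<Union>i::nat. B i)|lebesgue. g s) = 0"
      if B: "disjoint_family B" "range B \<subseteq> sigma_sets UNIV (range (\<lambda>a::real. {..a}))"
        "\<And>i. (LINT s:B i|lebesgue. g s) = 0" for B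
    proof -
      have Bs: "B i \<in> sets lebesgue" for i
        using B(2) by (auto simp: ss)
      have "(LINT s:(\<Union>i. B i)|lebesgue. g s) = (\<Sum>i. (LINT s:B i|lebesgue. g s))"
        using B(1) Bs by (intro lebesgue_integral_countable_add si) (auto simp: disjoint_family_on_def)
      then show ?thesis
        using B(3) by simp
    qed
  qed simp
  interpret finite_measure M by (rule finite_measure_M)
  show ?thesis
  proof (rule density_zero[OF h])
    fix A :: "real set" assume "A \<in> sets M"
    then have "A \<in> sets lebesgue"
      by (simp add: sets_restrict_space_iff)
    then obtain B Z Z' where A: "A = B \<union> Z" "Z \<subseteq> Z'" "Z' \<in> null_sets lborel" "B \<in> sets lborel"
      by (rule sets_completionE)
    then have "Z' \<in> null_sets lebesgue"
      by (simp add: null_sets_completionI)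
    then have "AE s in lebesgue. s \<notin> Z'"
      by (rule AE_not_in)
    then have "AE s in lebesgue. indicat_real A s *\<^sub>R g s = indicat_real B s *\<^sub>R g s"
      by eventually_elim (use A in \<open>auto simp: indicator_def\<close>)
    moreover have "A \<in> sets lebesgue" "B \<in> sets lebesgue"
      using \<open>A \<in> sets lebesgue\<close> A by auto
    ultimately have "(LINT s:A|lebesgue. g s) = (LINT s:B|lebesgue. g s)"
      unfolding set_lebesgue_integral_def
      using si[of A] si[of B] by (intro integral_cong_AE) (auto simp: set_integrable_def)
    also have "B \<in> sigma_sets UNIV (range (\<lambda>a::real. {..a}))"
      using A(4) by (simp add: borel_eq_atMost)
    then have "(LINT s:B|lebesgue. g s) = 0"
      by (rule borel)
    finally show "(LINT s:A|M. h s) = 0"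
      by (simp add: set_lebesgue_integral_def integral_restrict_space g_def mult.commute)
  qed
qed

text \<open>\<open>h\<close> need not be continuous, so the result for continuous functions is
  applied to its primitive \<open>H\<close>. \<open>H\<close> has equal endpoint values since the
  zeroth coefficient of \<open>h\<close> is zero, its other coefficients vanish by integration by
  parts, and subtracting the mean \<open>m\<close> removes the zeroth one. Thus \<open>H\<close> is
  constant, hence zero because \<open>H 0 = 0\<close>.\<close>

lemma fourier_unique_scalar:
  fixes h :: "real \<Rightarrow> complex"
  assumes h: "integrable M h" and 0: "\<And>l. (LINT s|M. ex l s * h s) = 0"
  shows "AE s in M. h s = 0"
proof -
  define H where "H t = (LINT s|lebesgue_on {0..t}. h s)" for t
  have cont: "continuous_on {0..\<omega>} H"
    unfolding H_def by (rule continuous_on_indefinite_integral[OF h])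
  have H0: "H 0 = 0"
    by (simp add: H_def integral_eq_zero_null_sets)
  have H\<omega>: "H \<omega> = 0"
    using 0[of 0] by (simp add: H_def)
  define m where "m = (LINT s|M. H s) / \<omega>"
  have "null_fourier (\<lambda>s. H s - m)"
    unfolding null_fourier_def
  proof (intro conjI allI)
    show "continuous_on {0..\<omega>} (\<lambda>s. H s - m)"
      by (intro continuous_intros cont)
    fix l
    have "(LINT s|M. ex l s * (H s - m)) = (LINT s|M. ex l s * H s) - (LINT s|M. ex l s * m)"
      unfolding right_diff_distrib
      by (intro Bochner_Integration.integral_diff integrable_continuous_M continuous_intros cont)
    also have "(LINT s|M. ex l s * m) = (if l = 0 then \<omega> else 0) * m"
      by (simp add: integral_ex)
    finally have eq: "(LINT s|M. ex l s * (H s - m)) = (LINT s|M. ex l s * H s) - (if l = 0 then \<omega> else 0) * m" .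
    show "(LINT s|M. ex l s * (H s - m)) = 0"
    proof (cases "l = 0")
      case True
      then show ?thesis
        using eq \<omega> by (simp add: m_def)
    next
      case False
      have "(LINT s|M. freq l * ex l s * H s) = 0"
        using integral_by_parts_ex[OF h, of l] 0[of l] 0[of 0] by (simp add: H_def)
      then have "freq l * (LINT s|M. ex l s * H s) = 0"
        by (simp add: mult.assoc)
      with False eq show ?thesis by simp
    qed
  qed
  then have const: "H t - m = 0" if "t \<in> {0..\<omega>}" for t
    by (rule null_fourier_eq_0) (use that H0 H\<omega> in auto)
  then have "H t = 0" if "t \<in> {0..\<omega>}" for t
    using const[of 0] const[OF that] H0 \<omega> by simp
  then show ?thesis
    unfolding H_def by (intro AE_eq_0_if_indefinite_integral_eq_0[OF h])
qed

section \<open>Square integrable functions\<close>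

lemma square_integrableD:
  assumes "square_integrable \<omega> f"
  shows "strongly_measurable M f" "integrable M (\<lambda>s. (norm (f s))\<^sup>2)"
proof -
  interpret M: complete_measure M by (rule complete_M)
  show f: "strongly_measurable M f"
    using assms by (simp add: square_integrable_def)
  have "(\<lambda>s. norm (f s)) \<in> borel_measurable M"
    by (intro M.strongly_measurable_imp_borel_measurable strongly_measurable_norm f)
  then show "integrable M (\<lambda>s. (norm (f s))\<^sup>2)"
    using assms by (intro integrableI_bounded) (auto simp: square_integrable_def)
qed

lemma square_integrableI:
  assumes f: "strongly_measurable M f" and g: "integrable M g" "AE s in M. (norm (f s))\<^sup>2 \<le> g s"
  shows "square_integrable \<omega> f"
proof -
  have "(\<integral>\<^sup>+s. ennreal ((norm (f s))\<^sup>2) \<partial>M) \<le> (\<integral>\<^sup>+s. ennreal (norm (g s)) \<partial>M)"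
  proof (rule nn_integral_mono_AE)
    show "AE s in M. ennreal ((norm (f s))\<^sup>2) \<le> ennreal (norm (g s))"
      using g(2) by eventually_elim (auto intro!: ennreal_leI)
  qed
  also have "\<dots> < \<infinity>"
    using g(1) by (simp add: integrable_iff_bounded)
  finally show ?thesis
    using f by (simp add: square_integrable_def)
qed

lemma square_integrable_bounded:
  assumes "strongly_measurable M f" "\<And>s. s \<in> {0..\<omega>} \<Longrightarrow> norm (f s) \<le> B"
  shows "square_integrable \<omega> f"
proof (rule square_integrableI[OF assms(1)])
  show "AE s in M. (norm (f s))\<^sup>2 \<le> B\<^sup>2"
    by (rule AE_I2) (use assms(2) in \<open>auto intro: power_mono\<close>)
qed simp

lemma square_integrable_cong_AE:
  assumes "square_integrable \<omega> f" "AE s in M. f s = g s"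
  shows "square_integrable \<omega> g"
proof (rule square_integrableI)
  show "strongly_measurable M g"
    using square_integrableD(1)[OF assms(1)] assms(2) by (rule strongly_measurable_cong_AE)
  show "integrable M (\<lambda>s. (norm (f s))\<^sup>2)"
    by (rule square_integrableD[OF assms(1)])
  show "AE s in M. (norm (g s))\<^sup>2 \<le> (norm (f s))\<^sup>2"
    using assms(2) by eventually_elim simp
qed

lemma square_integrable_add:
  assumes f: "square_integrable \<omega> f" and g: "square_integrable \<omega> g"
  shows "square_integrable \<omega> (\<lambda>s. f s + g s)"
proof (rule square_integrableI)
  show "strongly_measurable M (\<lambda>s. f s + g s)"
    by (intro strongly_measurable_add square_integrableD f g)
  show "integrable M (\<lambda>s. 2 * (norm (f s))\<^sup>2 + 2 * (norm (g s))\<^sup>2)"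
    by (intro Bochner_Integration.integrable_add integrable_mult_right square_integrableD f g)
  show "AE s in M. (norm (f s + g s))\<^sup>2 \<le> 2 * (norm (f s))\<^sup>2 + 2 * (norm (g s))\<^sup>2"
  proof (rule AE_I2)
    fix s
    have "(norm (f s + g s))\<^sup>2 \<le> (norm (f s) + norm (g s))\<^sup>2"
      by (intro power_mono norm_triangle_ineq) simp
    also have "\<dots> \<le> 2 * (norm (f s))\<^sup>2 + 2 * (norm (g s))\<^sup>2"
      using zero_le_power2[of "norm (f s) - norm (g s)"] by (simp add: power2_eq_square algebra_simps)
    finally show "(norm (f s + g s))\<^sup>2 \<le> 2 * (norm (f s))\<^sup>2 + 2 * (norm (g s))\<^sup>2" .
  qed
qed

lemma square_integrable_scaleC:
  assumes f: "square_integrable \<omega> f"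
  shows "square_integrable \<omega> (\<lambda>s. c *\<^sub>C f s)"
proof (rule square_integrableI)
  show "strongly_measurable M (\<lambda>s. c *\<^sub>C f s)"
    by (intro strongly_measurable_scaleC strongly_measurable_const square_integrableD f)
  show "integrable M (\<lambda>s. (cmod c)\<^sup>2 * (norm (f s))\<^sup>2)"
    by (intro integrable_mult_right square_integrableD f)
qed (simp add: norm_scaleC power_mult_distrib)

lemma strongly_measurable_ex: "strongly_measurable M (ex l)"
  by (intro borel_measurable_imp_strongly_measurable continuous_imp_measurable_on_sets_lebesgue
      continuous_on_ex) auto

lemma square_integrable_ex_scaleC:
  assumes f: "square_integrable \<omega> f"
  shows "square_integrable \<omega> (\<lambda>s. ex l s *\<^sub>C f s)"
proof (rule square_integrableI)
  show "strongly_measurable M (\<lambda>s. ex l s *\<^sub>C f s)"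
    by (intro strongly_measurable_scaleC strongly_measurable_ex square_integrableD f)
  show "integrable M (\<lambda>s. (norm (f s))\<^sup>2)"
    by (rule square_integrableD[OF f])
qed (simp add: norm_scaleC)

lemma square_integrable_const: "square_integrable \<omega> (\<lambda>_. c)"
  by (rule square_integrable_bounded[of _ "norm c"]) (auto intro: strongly_measurable_const)

lemma square_integrable_sum:
  assumes "\<And>i. i \<in> I \<Longrightarrow> square_integrable \<omega> (f i)"
  shows "square_integrable \<omega> (\<lambda>s. \<Sum>i\<in>I. f i s)"
  using assms by (induction I rule: infinite_finite_induct)
    (auto intro: square_integrable_const square_integrable_add)

text \<open>The step functions \<open>s \<mapsto> f (\<lfloor>n s\<rfloor> / n)\<close> approximate a continuous \<open>f\<close>, without any
  separability assumption.\<close>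

lemma strongly_measurable_continuous:
  fixes f :: "real \<Rightarrow> 'b::real_normed_vector"
  assumes f: "continuous_on {0..\<omega>} f"
  shows "strongly_measurable M f"
proof (rule strongly_measurableI)
  let ?q = "\<lambda>n s. real_of_int \<lfloor>real (Suc n) * s\<rfloor> / real (Suc n)"
  show "simple_function M (\<lambda>s. f (?q n s))" for n
  proof (rule simple_function_compose1[where f = "?q n"], rule simple_function_borel_measurable)
    have "(\<lambda>s. real (Suc n) * s) \<in> borel_measurable M"
      by (rule continuous_imp_measurable_on_sets_lebesgue) (auto intro: continuous_intros)
    moreover have "(\<lambda>x::real. real_of_int \<lfloor>x\<rfloor> / real (Suc n)) \<in> borel_measurable borel"
      by measurable
    ultimately show "?q n \<in> borel_measurable M"
      by (rule measurable_compose)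
    have "?q n ` space M \<subseteq> (\<lambda>i. real_of_int i / real (Suc n)) ` {0..\<lfloor>real (Suc n) * \<omega>\<rfloor>}"
    proof
      fix y assume "y \<in> ?q n ` space M"
      then obtain s where s: "s \<in> {0..\<omega>}" "y = ?q n s" by auto
      then have "\<lfloor>real (Suc n) * s\<rfloor> \<in> {0..\<lfloor>real (Suc n) * \<omega>\<rfloor>}"
        by (auto intro!: floor_mono mult_left_mono)
      with s show "y \<in> (\<lambda>i. real_of_int i / real (Suc n)) ` {0..\<lfloor>real (Suc n) * \<omega>\<rfloor>}"
        by blast
    qed
    then show "finite (?q n ` space M)"
      by (rule finite_subset) simp
  qed
  show "AE s in M. (\<lambda>n. f (?q n s)) \<longlonglongrightarrow> f s"
  proof (rule AE_I2)
    fix s assume "s \<in> space M"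
    then have s: "s \<in> {0..\<omega>}" by simp
    have q_le: "?q n s \<le> s" "s - 1 / real (Suc n) \<le> ?q n s" "0 \<le> ?q n s" for n
    proof -
      define m where "m = real (Suc n)"
      have m: "0 < m" by (simp add: m_def)
      have "real_of_int \<lfloor>m * s\<rfloor> / m \<le> (m * s) / m"
        using m by (intro divide_right_mono of_int_floor_le) simp
      then show "?q n s \<le> s"
        using m unfolding m_def by simp
      have "(m * s - 1) / m \<le> real_of_int \<lfloor>m * s\<rfloor> / m"
        using m by (intro divide_right_mono) linarith+
      moreover have "(m * s - 1) / m = s - 1 / m"
        using m by (simp add: diff_divide_distrib)
      ultimately show "s - 1 / real (Suc n) \<le> ?q n s"
        unfolding m_def by simp
      show "0 \<le> ?q n s" using s by simp
    qed
    have "(\<lambda>n. ?q n s) \<longlonglongrightarrow> s"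
    proof (rule tendsto_sandwich)
      show "(\<lambda>n. s - 1 / real (Suc n)) \<longlonglongrightarrow> s"
        using tendsto_diff[OF tendsto_const LIMSEQ_inverse_real_of_nat, of s] by (simp add: inverse_eq_divide)
    qed (use q_le in auto)
    moreover have "?q n s \<in> {0..\<omega>}" for n
      using q_le[of n] s by auto
    ultimately show "(\<lambda>n. f (?q n s)) \<longlonglongrightarrow> f s"
      by (intro continuous_on_tendsto_compose[OF f]) (use s in auto)
  qed
qed

lemma square_integrable_continuous:
  fixes f :: "real \<Rightarrow> 'h::complex_hilbert"
  assumes f: "continuous_on {0..\<omega>} f"
  shows "square_integrable \<omega> f"
proof -
  have "bounded (f ` {0..\<omega>})"
    by (intro compact_imp_bounded compact_continuous_image f) simp
  then obtain B where "\<forall>s\<in>{0..\<omega>}. norm (f s) \<le> B"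
    unfolding bounded_iff by auto
  then show ?thesis
    by (intro square_integrable_bounded[OF strongly_measurable_continuous[OF f], of B]) blast
qed

lemma integrable_cinner:
  assumes f: "square_integrable \<omega> f" and g: "square_integrable \<omega> g"
  shows "integrable M (\<lambda>s. cinner (f s) (g s))"
proof (rule Bochner_Integration.integrable_bound)
  interpret M: complete_measure M by (rule complete_M)
  show "integrable M (\<lambda>s. (norm (f s))\<^sup>2 + (norm (g s))\<^sup>2)"
    by (intro Bochner_Integration.integrable_add square_integrableD f g)
  show "(\<lambda>s. cinner (f s) (g s)) \<in> borel_measurable M"
    by (intro M.strongly_measurable_imp_borel_measurable strongly_measurable_cinner square_integrableD f g)
  show "AE s in M. cmod (cinner (f s) (g s)) \<le> norm ((norm (f s))\<^sup>2 + (norm (g s))\<^sup>2)"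
  proof (rule AE_I2)
    fix s
    have "cmod (cinner (f s) (g s)) \<le> norm (f s) * norm (g s)"
      by (rule norm_cinner_le)
    also have "\<dots> \<le> (norm (f s))\<^sup>2 + (norm (g s))\<^sup>2"
    proof -
      have "2 * (norm (f s) * norm (g s)) \<le> (norm (f s))\<^sup>2 + (norm (g s))\<^sup>2"
        using zero_le_power2[of "norm (f s) - norm (g s)"] by (simp add: power2_eq_square algebra_simps)
      moreover have "0 \<le> norm (f s) * norm (g s)" by simp
      ultimately show ?thesis by linarith
    qed
    finally show "cmod (cinner (f s) (g s)) \<le> norm ((norm (f s))\<^sup>2 + (norm (g s))\<^sup>2)"
      by simp
  qed
qed

lemma integrable_norm_square_integrable:
  assumes f: "square_integrable \<omega> f"
  shows "integrable M (\<lambda>s. norm (f s))"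
proof (rule Bochner_Integration.integrable_bound)
  interpret M: complete_measure M by (rule complete_M)
  interpret finite_measure M by (rule finite_measure_M)
  show "integrable M (\<lambda>s. 1 + (norm (f s))\<^sup>2)"
    by (intro Bochner_Integration.integrable_add square_integrableD f) simp
  show "(\<lambda>s. norm (f s)) \<in> borel_measurable M"
    by (intro M.strongly_measurable_imp_borel_measurable strongly_measurable_norm square_integrableD f)
  show "AE s in M. norm (norm (f s)) \<le> norm (1 + (norm (f s))\<^sup>2)"
  proof (rule AE_I2)
    fix s
    have "2 * norm (f s) \<le> 1 + (norm (f s))\<^sup>2"
      using zero_le_power2[of "norm (f s) - 1"] by (simp add: power2_eq_square algebra_simps)
    then have "norm (f s) \<le> 1 + (norm (f s))\<^sup>2"
      using norm_ge_zero[of "f s"] by linarith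
    then show "norm (norm (f s)) \<le> norm (1 + (norm (f s))\<^sup>2)"
      by simp
  qed
qed

lemma has_bint_subinterval:
  assumes f: "square_integrable \<omega> f" and "t \<le> \<omega>"
  shows "has_bint (lebesgue_on {0..t}) f (bint (lebesgue_on {0..t}) f)"
proof -
  interpret complete_measure "lebesgue_on {0..t}"
    by (rule complete_lebesgue_on) simp
  show ?thesis
  proof (rule has_bint_bint)
    show "strongly_measurable (lebesgue_on {0..t}) f"
      by (rule strongly_measurable_subset[OF square_integrableD(1)[OF f]]) (use \<open>t \<le> \<omega>\<close> in auto)
    have "(\<integral>\<^sup>+s. ennreal (norm (f s)) \<partial>lebesgue_on {0..t}) \<le> (\<integral>\<^sup>+s. ennreal (norm (f s)) \<partial>M)"
      using \<open>t \<le> \<omega>\<close> by (simp add: nn_integral_restrict_space) (auto intro!: nn_integral_mono simp: indicator_def)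
    also have "\<dots> < \<infinity>"
      using integrable_norm_square_integrable[OF f] by (simp add: integrable_iff_bounded)
    finally show "(\<integral>\<^sup>+s. ennreal (norm (f s)) \<partial>lebesgue_on {0..t}) < \<infinity>" .
  qed
qed

end

lemma has_bint_cong_AE:
  assumes "AE x in M. f x = g x"
  shows "has_bint M f I \<longleftrightarrow> has_bint M g I"
proof -
  have "strongly_measurable M f \<longleftrightarrow> strongly_measurable M g"
    using assms strongly_measurable_cong_AE[of M f g] strongly_measurable_cong_AE[of M g f]
    by (auto simp: eq_commute)
  moreover have "(\<integral>\<^sup>+x. ennreal (norm (f x - s x)) \<partial>M) = (\<integral>\<^sup>+x. ennreal (norm (g x - s x)) \<partial>M)" for s
  proof (rule nn_integral_cong_AE)
    show "AE x in M. ennreal (norm (f x - s x)) = ennreal (norm (g x - s x))"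
      using assms by eventually_elim simp
  qed
  ultimately show ?thesis
    by (simp add: has_bint_def)
qed

context interval
begin

subsection \<open>Fourier coefficients\<close>

lemma fcoeff_eq_ex: "fcoeff \<omega> f l = complex_of_real (1 / \<omega>) *\<^sub>C bint M (\<lambda>s. ex (- l) s *\<^sub>C f s)"
  unfolding fcoeff_def exp_minus_eq_ex ..

text \<open>The passage from vector to scalar integrals: together with \<open>cinner_eqI\<close> it
  reduces identities between coefficients to properties of the scalar integral.\<close>

lemma cinner_fcoeff:
  assumes f: "square_integrable \<omega> f"
  shows "cinner (fcoeff \<omega> f l) y = (1 / \<omega>) * (LINT s|M. ex (- l) s * cinner (f s) y)"
proof -
  interpret M: complete_measure M by (rule complete_M)
  have "has_bint M (\<lambda>s. ex (- l) s *\<^sub>C f s) (bint M (\<lambda>s. ex (- l) s *\<^sub>C f s))"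
    by (rule has_bint_subinterval[OF square_integrable_ex_scaleC[OF f]]) simp
  from M.has_bint_cinner[OF this, of y] show ?thesis
    by (simp add: fcoeff_eq_ex cinner_scaleC_left has_bochner_integral_integral_eq)
qed

lemma fcoeff_cong_AE:
  assumes "AE s in M. f s = g s"
  shows "fcoeff \<omega> f l = fcoeff \<omega> g l"
proof -
  have "has_bint M (\<lambda>s. ex (- l) s *\<^sub>C f s) I \<longleftrightarrow> has_bint M (\<lambda>s. ex (- l) s *\<^sub>C g s) I" for I
    by (rule has_bint_cong_AE) (use assms in eventually_elim, simp)
  then show ?thesis
    by (simp add: fcoeff_eq_ex bint_def)
qed

lemma integrable_ex_cinner:
  assumes f: "square_integrable \<omega> f"
  shows "integrable M (\<lambda>s. ex l s * cinner (f s) y)"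
  by (intro integrable_ex_mult integrable_cinner f square_integrable_const)

lemma fcoeff_add:
  assumes f: "square_integrable \<omega> f" and g: "square_integrable \<omega> g"
  shows "fcoeff \<omega> (\<lambda>s. f s + g s) l = fcoeff \<omega> f l + fcoeff \<omega> g l"
proof (rule cinner_eqI)
  fix y
  have "(LINT s|M. ex (- l) s * cinner (f s + g s) y) =
      (LINT s|M. ex (- l) s * cinner (f s) y) + (LINT s|M. ex (- l) s * cinner (g s) y)"
    unfolding cinner_add_left distrib_left
    by (intro Bochner_Integration.integral_add integrable_ex_cinner f g)
  then show "cinner (fcoeff \<omega> (\<lambda>s. f s + g s) l) y = cinner (fcoeff \<omega> f l + fcoeff \<omega> g l) y"
    by (simp add: cinner_fcoeff f g square_integrable_add cinner_add_left distrib_left)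
qed

lemma fcoeff_scaleC:
  assumes f: "square_integrable \<omega> f"
  shows "fcoeff \<omega> (\<lambda>s. c *\<^sub>C f s) l = c *\<^sub>C fcoeff \<omega> f l"
proof (rule cinner_eqI)
  fix y
  have "(LINT s|M. ex (- l) s * cinner (c *\<^sub>C f s) y) = c * (LINT s|M. ex (- l) s * cinner (f s) y)"
    by (simp add: cinner_scaleC_left mult.left_commute)
  then show "cinner (fcoeff \<omega> (\<lambda>s. c *\<^sub>C f s) l) y = cinner (c *\<^sub>C fcoeff \<omega> f l) y"
    by (simp add: cinner_fcoeff f square_integrable_scaleC cinner_scaleC_left)
qed

lemma fcoeff_diff:
  assumes f: "square_integrable \<omega> f" and g: "square_integrable \<omega> g"
  shows "fcoeff \<omega> (\<lambda>s. f s - g s) l = fcoeff \<omega> f l - fcoeff \<omega> g l"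
  using fcoeff_add[OF f square_integrable_scaleC[OF g, of "-1"]] fcoeff_scaleC[OF g, of "-1"] by simp

lemma fcoeff_ex: "fcoeff \<omega> (\<lambda>s. ex m s *\<^sub>C c) l = (if l = m then c else 0)"
proof (rule cinner_eqI)
  fix y
  have "(LINT s|M. ex (- l) s * cinner (ex m s *\<^sub>C c) y) = (LINT s|M. ex (m - l) s * cinner c y)"
    using ex_add[of m "- l"] by (simp add: cinner_scaleC_left mult_ac)
  also have "\<dots> = (if l = m then \<omega> else 0) * cinner c y"
    by (simp add: integral_ex)
  finally show "cinner (fcoeff \<omega> (\<lambda>s. ex m s *\<^sub>C c) l) y = cinner (if l = m then c else 0) y"
    using \<omega> by (simp add: cinner_fcoeff square_integrable_ex_scaleC square_integrable_const)
qed

lemma fcoeff_sum: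
  assumes "finite I" "\<And>i. i \<in> I \<Longrightarrow> square_integrable \<omega> (f i)"
  shows "fcoeff \<omega> (\<lambda>s. \<Sum>i\<in>I. f i s) l = (\<Sum>i\<in>I. fcoeff \<omega> (f i) l)"
  using assms
proof (induction I rule: finite_induct)
  case empty
  show ?case
    using fcoeff_scaleC[OF square_integrable_const[of 0], of 0 l] by simp
next
  case (insert i I)
  then show ?case
    by (simp add: fcoeff_add square_integrable_sum)
qed

lemma fcoeff_trigonometric:
  assumes "finite F"
  shows "fcoeff \<omega> (\<lambda>s. \<Sum>l\<in>F. ex l s *\<^sub>C c l) m = (if m \<in> F then c m else 0)"
  using assms by (simp add: fcoeff_sum square_integrable_ex_scaleC square_integrable_const fcoeff_ex)

lemma integral_cinner_trigonometric:
  assumes f: "square_integrable \<omega> f" and "finite F"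
  shows "(LINT s|M. cinner (f s) (\<Sum>l\<in>F. ex l s *\<^sub>C c l)) = \<omega> * (\<Sum>l\<in>F. cinner (fcoeff \<omega> f l) (c l))"
proof -
  have "(LINT s|M. cinner (f s) (\<Sum>l\<in>F. ex l s *\<^sub>C c l)) = (LINT s|M. (\<Sum>l\<in>F. ex (- l) s * cinner (f s) (c l)))"
    by (simp add: cinner_sum_right cinner_scaleC_right cnj_ex)
  also have "\<dots> = (\<Sum>l\<in>F. (LINT s|M. ex (- l) s * cinner (f s) (c l)))"
    by (intro Bochner_Integration.integral_sum integrable_ex_cinner f)
  also have "\<dots> = (\<Sum>l\<in>F. \<omega> * cinner (fcoeff \<omega> f l) (c l))"
    using \<omega> by (intro sum.cong refl) (simp add: cinner_fcoeff f)
  finally show ?thesis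
    by (simp add: sum_distrib_left)
qed

text \<open>With \<open>g\<close> the partial Fourier sum over \<open>F\<close>, both
  \<open>cinner (f s) (g s)\<close> and \<open>(norm (g s))\<^sup>2\<close> integrate to
  \<open>\<omega> * S\<close>, so the claim amounts to the integral of
  \<open>(norm (f s - g s))\<^sup>2\<close> being nonnegative.\<close>

lemma bessel_inequality:
  assumes f: "square_integrable \<omega> f" and F: "finite F"
  shows "(\<Sum>l\<in>F. (norm (fcoeff \<omega> f l))\<^sup>2) \<le> (1 / \<omega>) * (LINT s|M. (norm (f s))\<^sup>2)"
proof -
  define g where "g s = (\<Sum>l\<in>F. ex l s *\<^sub>C fcoeff \<omega> f l)" for s
  define S where "S = (\<Sum>l\<in>F. (norm (fcoeff \<omega> f l))\<^sup>2)"
  have g: "square_integrable \<omega> g"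
    unfolding g_def by (intro square_integrable_sum square_integrable_ex_scaleC square_integrable_const)
  have S: "(\<Sum>l\<in>F. cinner (fcoeff \<omega> f l) (fcoeff \<omega> f l)) = complex_of_real S"
    by (simp add: cinner_self S_def)
  have fg: "(LINT s|M. cinner (f s) (g s)) = complex_of_real (\<omega> * S)"
    unfolding g_def integral_cinner_trigonometric[OF f F] S by simp
  have "(LINT s|M. cinner (g s) (g s)) = \<omega> * (\<Sum>l\<in>F. cinner (fcoeff \<omega> g l) (fcoeff \<omega> f l))"
    using integral_cinner_trigonometric[OF g F, of "fcoeff \<omega> f"] by (simp add: g_def)
  also have "\<dots> = complex_of_real (\<omega> * S)"
  proof -
    have "fcoeff \<omega> g l = fcoeff \<omega> f l" if "l \<in> F" for l
      using that fcoeff_trigonometric[OF F, of "fcoeff \<omega> f" l] by (simp add: g_def[abs_def])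
    then show ?thesis
      using S by simp
  qed
  finally have "(LINT s|M. cinner (g s) (g s)) = complex_of_real (\<omega> * S)" .
  moreover have "(LINT s|M. cinner (g s) (g s)) = complex_of_real (LINT s|M. (norm (g s))\<^sup>2)"
    unfolding cinner_self by (intro integral_of_real square_integrableD g)
  ultimately have gg: "(LINT s|M. (norm (g s))\<^sup>2) = \<omega> * S"
    by (metis of_real_eq_iff)
  have Re: "integrable M (\<lambda>s. Re (cinner (f s) (g s)))" "(LINT s|M. Re (cinner (f s) (g s))) = \<omega> * S"
    using integrable_cinner[OF f g] fg by (simp_all add: integrable_Re integral_Re)
  have "(LINT s|M. (norm (f s - g s))\<^sup>2) = (LINT s|M. (norm (f s))\<^sup>2 + (norm (g s))\<^sup>2 - 2 * Re (cinner (f s) (g s)))"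
    by (simp add: norm_diff_square)
  also have "\<dots> = (LINT s|M. (norm (f s))\<^sup>2) + (LINT s|M. (norm (g s))\<^sup>2) - 2 * (LINT s|M. Re (cinner (f s) (g s)))"
    using square_integrableD(2)[OF f] square_integrableD(2)[OF g] Re(1) by simp
  also have "\<dots> = (LINT s|M. (norm (f s))\<^sup>2) - \<omega> * S"
    by (simp add: gg Re(2))
  finally have "\<omega> * S \<le> (LINT s|M. (norm (f s))\<^sup>2)"
    using Bochner_Integration.integral_nonneg[of M "\<lambda>s. (norm (f s - g s))\<^sup>2"] by simp
  then show ?thesis
    using \<omega> by (simp add: S_def field_simps)
qed

text \<open>The single-index case of Bessel's inequality; it lets coefficients pass to uniform
  limits.\<close>

lemma norm_fcoeff_le:
  assumes f: "square_integrable \<omega> f" and B: "\<And>s. s \<in> {0..\<omega>} \<Longrightarrow> norm (f s) \<le> B"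
  shows "norm (fcoeff \<omega> f l) \<le> B"
proof -
  have "norm (f 0) \<le> B"
    using \<omega> by (intro B) simp
  then have "0 \<le> B"
    using norm_ge_zero[of "f 0"] by linarith
  interpret finite_measure M by (rule finite_measure_M)
  have "(norm (fcoeff \<omega> f l))\<^sup>2 \<le> (1 / \<omega>) * (LINT s|M. (norm (f s))\<^sup>2)"
    using bessel_inequality[OF f, of "{l}"] by simp
  also have "\<dots> \<le> (1 / \<omega>) * (LINT s|M. B\<^sup>2)"
    using \<omega> B by (intro mult_left_mono integral_mono square_integrableD f) (auto intro: power_mono)
  also have "\<dots> = B\<^sup>2"
    using \<omega> by (simp add: measure_restrict_space)
  finally show ?thesis
    using \<open>0 \<le> B\<close> by (rule power2_le_imp_le)
qed

lemma fourier_unique: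
  assumes f: "square_integrable \<omega> f" and 0: "\<And>l. fcoeff \<omega> f l = 0"
  shows "AE s in M. f s = 0"
proof -
  interpret M: complete_measure M by (rule complete_M)
  show ?thesis
  proof (rule M.AE_eq_0_if_cinner_AE_eq_0[OF square_integrableD(1)[OF f]])
    fix y
    show "AE s in M. cinner (f s) y = 0"
    proof (rule fourier_unique_scalar)
      show "integrable M (\<lambda>s. cinner (f s) y)"
        by (intro integrable_cinner f square_integrable_const)
      show "(LINT s|M. ex l s * cinner (f s) y) = 0" for l
        using cinner_fcoeff[OF f, of "- l" y] 0 \<omega> by simp
    qed
  qed
qed

text \<open>The partial sums converge uniformly by the Weierstrass test, so continuity and the
  values of the coefficients pass to the limit.\<close>

lemma fourier_series:
  fixes c :: "int \<Rightarrow> 'h::complex_hilbert"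
  assumes c: "(\<lambda>l. norm (c l)) summable_on UNIV"
  obtains f where "continuous_on {0..\<omega>} f" "\<And>l. fcoeff \<omega> f l = c l"
    "\<And>s. norm (f s) \<le> (\<Sum>\<^sub>\<infinity>l. norm (c l))"
proof -
  define f where "f s = (\<Sum>\<^sub>\<infinity>l. ex l s *\<^sub>C c l)" for s
  let ?S = "\<lambda>F s. \<Sum>l\<in>F. ex l s *\<^sub>C c l"
  have abs: "(\<lambda>l. norm (ex l s *\<^sub>C c l)) summable_on UNIV" for s
    using c by (simp add: norm_scaleC)
  have unif: "uniform_limit {0..\<omega>} ?S f (finite_subsets_at_top UNIV)"
    unfolding f_def by (rule Weierstrass_m_test_general[OF _ c]) (simp add: norm_scaleC)
  have cont_S: "continuous_on {0..\<omega>} (?S F)" for F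
    by (intro continuous_on_sum bounded_bilinear.continuous_on[OF bounded_bilinear_scaleC]
        continuous_on_ex continuous_on_const)
  have cont: "continuous_on {0..\<omega>} f"
    by (rule uniform_limit_theorem[OF _ unif]) (use cont_S in auto)
  have "fcoeff \<omega> f m = c m" for m
  proof -
    have "norm (fcoeff \<omega> f m - c m) \<le> 0"
    proof (rule field_le_epsilon)
      fix e :: real assume e: "0 < e"
      from uniform_limitD[OF unif e] obtain F where F: "finite F"
        "\<And>G. finite G \<Longrightarrow> F \<subseteq> G \<Longrightarrow> \<forall>s\<in>{0..\<omega>}. dist (?S G s) (f s) < e"
        unfolding eventually_finite_subsets_at_top by auto
      \<comment> \<open>Inserting \<open>m\<close> ensures that the truncated sum has coefficient
        \<open>c m\<close> at \<open>m\<close>.\<close>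
      define G where "G = insert m F"
      have G: "finite G" "m \<in> G" "\<forall>s\<in>{0..\<omega>}. dist (?S G s) (f s) < e"
        using F(1) F(2)[of G] by (auto simp: G_def)
      have f: "square_integrable \<omega> f" and S: "square_integrable \<omega> (?S G)"
        by (intro square_integrable_continuous cont cont_S)+
      have "norm (fcoeff \<omega> (\<lambda>s. f s - ?S G s) m) \<le> e"
      proof (rule norm_fcoeff_le)
        show "square_integrable \<omega> (\<lambda>s. f s - ?S G s)"
          by (intro square_integrable_continuous continuous_on_diff cont cont_S)
        show "norm (f s - ?S G s) \<le> e" if "s \<in> {0..\<omega>}" for s
          using G(3) that by (force simp: dist_norm norm_minus_commute)
      qed
      then show "norm (fcoeff \<omega> f m - c m) \<le> 0 + e"
        using G by (simp add: fcoeff_diff[OF f S] fcoeff_trigonometric)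
    qed
    then show ?thesis by simp
  qed
  moreover have "norm (f s) \<le> (\<Sum>\<^sub>\<infinity>l. norm (c l))" for s
    using norm_infsum_bound[OF abs[of s]] by (simp add: f_def norm_scaleC)
  ultimately show thesis
    using that cont by blast
qed

section \<open>The space of square integrable classes\<close>

definition hat :: "'h::complex_hilbert aefun \<Rightarrow> int \<Rightarrow> 'h" where
  "hat x l = fcoeff \<omega> (rep_aefun x) l"

lemma AE_M_iff: "(AE s in M. Q s) \<longleftrightarrow> (AE s in lebesgue. s \<in> {0..\<omega>} \<longrightarrow> Q s)"
  by (rule AE_restrict_space_iff) simp

lemma cls_eq_iff: "cls \<omega> f = cls \<omega> g \<longleftrightarrow> (AE s in M. f s = g s)"
proof -
  have "cls \<omega> f = cls \<omega> g \<longleftrightarrow>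
      (AE s in lebesgue. (if s \<in> {0..\<omega>} then f s else 0) = (if s \<in> {0..\<omega>} then g s else 0))"
    unfolding cls_def by (rule aefun.abs_eq_iff)
  also have "\<dots> \<longleftrightarrow> (AE s in M. f s = g s)"
    unfolding AE_M_iff by (rule AE_cong) auto
  finally show ?thesis .
qed

lemma AE_rep_cls: "AE s in M. rep_aefun (cls \<omega> f) s = f s"
proof -
  have "AE s in lebesgue. rep_aefun (cls \<omega> f) s = (if s \<in> {0..\<omega>} then f s else 0)"
    unfolding cls_def by (rule Quotient3_rep_abs[OF Quotient3_aefun]) simp
  then show ?thesis
    unfolding AE_M_iff by eventually_elim simp
qed

lemma square_integrable_rep_cls:
  "square_integrable \<omega> f \<Longrightarrow> square_integrable \<omega> (rep_aefun (cls \<omega> f))"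
  by (erule square_integrable_cong_AE) (use AE_rep_cls[of f] in eventually_elim, simp)

lemma cls_in_L2: "square_integrable \<omega> f \<Longrightarrow> cls \<omega> f \<in> L2 \<omega>"
  by (auto simp: L2_def)

lemma L2D:
  assumes "x \<in> L2 \<omega>"
  shows "square_integrable \<omega> (rep_aefun x)" "cls \<omega> (rep_aefun x) = x"
proof -
  obtain f where f: "x = cls \<omega> f" "square_integrable \<omega> f"
    using assms by (auto simp: L2_def)
  show "square_integrable \<omega> (rep_aefun x)"
    unfolding f(1) by (rule square_integrable_rep_cls[OF f(2)])
  show "cls \<omega> (rep_aefun x) = x"
    unfolding f(1) cls_eq_iff by (rule AE_rep_cls)
qed

lemma hat_cls: "hat (cls \<omega> f) l = fcoeff \<omega> f l"
  unfolding hat_def by (rule fcoeff_cong_AE[OF AE_rep_cls])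

lemma cls_add: "cls \<omega> f + cls \<omega> g = cls \<omega> (\<lambda>s. f s + g s)"
  unfolding cls_def plus_aefun.abs_eq by (rule arg_cong[where f = abs_aefun]) auto

lemma cls_scaleC: "c *\<^sub>C cls \<omega> f = cls \<omega> (\<lambda>s. c *\<^sub>C f s)"
  unfolding cls_def scaleC_aefun.abs_eq by (rule arg_cong[where f = abs_aefun]) auto

lemma cls_zero: "cls \<omega> (\<lambda>_. 0) = 0"
  unfolding cls_def zero_aefun_def by (rule arg_cong[where f = abs_aefun]) auto

lemma l2_norm_eq:
  assumes "x \<in> L2 \<omega>"
  shows "l2_norm \<omega> x = sqrt ((1 / \<omega>) * (LINT s|M. (norm (rep_aefun x s))\<^sup>2))"
proof -
  have "(LINT s|M. cinner (rep_aefun x s) (rep_aefun x s)) = complex_of_real (LINT s|M. (norm (rep_aefun x s))\<^sup>2)"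
    unfolding cinner_self by (intro integral_of_real square_integrableD L2D assms)
  then show ?thesis
    by (simp add: l2_norm_def l2_inner_def)
qed

lemma l2_norm_nonneg: "x \<in> L2 \<omega> \<Longrightarrow> 0 \<le> l2_norm \<omega> x"
  using \<omega> by (simp add: l2_norm_eq)

lemma add_in_L2_hat:
  assumes "x \<in> L2 \<omega>" "y \<in> L2 \<omega>"
  shows "x + y \<in> L2 \<omega>" "hat (x + y) l = hat x l + hat y l"
proof -
  have eq: "x + y = cls \<omega> (\<lambda>s. rep_aefun x s + rep_aefun y s)"
    using assms L2D(2) by (metis cls_add)
  show "x + y \<in> L2 \<omega>"
    unfolding eq by (intro cls_in_L2 square_integrable_add L2D assms)
  have "hat (x + y) l = fcoeff \<omega> (\<lambda>s. rep_aefun x s + rep_aefun y s) l"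
    unfolding eq by (rule hat_cls)
  then show "hat (x + y) l = hat x l + hat y l"
    using assms by (simp add: hat_def fcoeff_add L2D)
qed

lemma scaleC_in_L2_hat:
  assumes "x \<in> L2 \<omega>"
  shows "c *\<^sub>C x \<in> L2 \<omega>" "hat (c *\<^sub>C x) l = c *\<^sub>C hat x l"
proof -
  have eq: "c *\<^sub>C x = cls \<omega> (\<lambda>s. c *\<^sub>C rep_aefun x s)"
    using assms L2D(2) by (metis cls_scaleC)
  show "c *\<^sub>C x \<in> L2 \<omega>"
    unfolding eq by (intro cls_in_L2 square_integrable_scaleC L2D assms)
  have "hat (c *\<^sub>C x) l = fcoeff \<omega> (\<lambda>s. c *\<^sub>C rep_aefun x s) l"
    unfolding eq by (rule hat_cls)
  then show "hat (c *\<^sub>C x) l = c *\<^sub>C hat x l"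
    using assms by (simp add: hat_def fcoeff_scaleC L2D)
qed

lemma diff_in_L2_hat:
  assumes "x \<in> L2 \<omega>" "y \<in> L2 \<omega>"
  shows "x - y \<in> L2 \<omega>" "hat (x - y) l = hat x l - hat y l"
  using add_in_L2_hat[OF assms(1) scaleC_in_L2_hat(1)[OF assms(2), of "-1"]]
    scaleC_in_L2_hat(2)[OF assms(2), of "-1"] by simp_all

lemma hat_unique:
  assumes "x \<in> L2 \<omega>" "\<And>l. hat x l = 0" shows "x = 0"
proof -
  have "AE s in M. rep_aefun x s = 0"
    using assms by (intro fourier_unique L2D) (simp_all add: hat_def)
  then have "cls \<omega> (rep_aefun x) = cls \<omega> (\<lambda>_. 0)"
    by (simp add: cls_eq_iff)
  then show ?thesis
    using assms by (simp add: L2D cls_zero)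
qed

lemma ex_L2_hat:
  assumes "(\<lambda>l. norm (c l)) summable_on UNIV"
  shows "\<exists>x\<in>L2 \<omega>. (\<forall>l. hat x l = c l) \<and> l2_norm \<omega> x \<le> (\<Sum>\<^sub>\<infinity>l. norm (c l))"
proof -
  obtain f where f: "continuous_on {0..\<omega>} f" "\<And>l. fcoeff \<omega> f l = c l"
    "\<And>s. norm (f s) \<le> (\<Sum>\<^sub>\<infinity>l. norm (c l))"
    using fourier_series[OF assms] by blast
  let ?B = "\<Sum>\<^sub>\<infinity>l. norm (c l)" and ?x = "cls \<omega> f"
  interpret finite_measure M by (rule finite_measure_M)
  have x: "?x \<in> L2 \<omega>"
    by (intro cls_in_L2 square_integrable_continuous f)
  have B: "0 \<le> ?B"
    by (rule infsum_nonneg) simp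
  have "(LINT s|M. (norm (rep_aefun ?x s))\<^sup>2) \<le> (LINT s|M. ?B\<^sup>2)"
  proof (rule integral_mono_AE)
    show "AE s in M. (norm (rep_aefun ?x s))\<^sup>2 \<le> ?B\<^sup>2"
      using AE_rep_cls[of f] by eventually_elim (simp add: f(3) power_mono)
  qed (auto intro: square_integrableD L2D x)
  then have "(1 / \<omega>) * (LINT s|M. (norm (rep_aefun ?x s))\<^sup>2) \<le> (1 / \<omega>) * (LINT s|M. ?B\<^sup>2)"
    using \<omega> by (intro mult_left_mono) auto
  also have "\<dots> = ?B\<^sup>2"
    using \<omega> by (simp add: measure_restrict_space)
  finally have "l2_norm \<omega> ?x \<le> ?B"
    unfolding l2_norm_eq[OF x] using B by (simp add: real_le_lsqrt)
  with x f(2) show ?thesis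
    by (intro bexI[of _ ?x]) (simp_all add: hat_cls)
qed

lemma bessel_L2:
  assumes "x \<in> L2 \<omega>" "finite F"
  shows "(\<Sum>l\<in>F. (norm (hat x l))\<^sup>2) \<le> (l2_norm \<omega> x)\<^sup>2"
  using bessel_inequality[OF L2D(1)[OF assms(1)] assms(2)] \<omega>
  by (simp add: l2_norm_eq[OF assms(1)] hat_def)

subsection \<open>The derivative\<close>

text \<open>Integration by parts, tested against \<open>y\<close>; the boundary term vanishes by
  periodicity. The primitive of \<open>h\<close> is \<open>cinner (f t) y\<close> minus a constant,
  and the constant contributes at \<open>l = 0\<close> alone, where \<open>freq l\<close>
  vanishes.\<close>

lemma hat_W21_deriv:
  assumes W: "W21_deriv \<omega> f z" and per: "f 0 = f \<omega>"
  shows "hat z l = freq l *\<^sub>C fcoeff \<omega> f l"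
proof (rule cinner_eqI)
  fix y
  have z: "square_integrable \<omega> (rep_aefun z)" and cont: "continuous_on {0..\<omega>} f"
    using W by (auto simp: W21_deriv_def L2D)
  have f: "square_integrable \<omega> f"
    by (rule square_integrable_continuous[OF cont])
  define h where "h s = cinner (rep_aefun z s) y" for s
  have h: "integrable M h"
    unfolding h_def by (intro integrable_cinner z square_integrable_const)
  have H: "(LINT s|lebesgue_on {0..t}. h s) = cinner (f t) y - cinner (f 0) y" if "t \<in> {0..\<omega>}" for t
  proof -
    interpret complete_measure "lebesgue_on {0..t}"
      by (rule complete_lebesgue_on) simp
    have "has_bint (lebesgue_on {0..t}) (rep_aefun z) (f t - f 0)"
      using W that by (simp add: W21_deriv_def)
    from has_bint_cinner[OF this, of y] show ?thesis
      unfolding h_def by (simp add: has_bochner_integral_integral_eq cinner_diff_left)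
  qed
  have cf: "integrable M (\<lambda>s. ex (- l) s * cinner (f s) y)"
    by (rule integrable_ex_cinner[OF f])
  have "- (LINT s|M. ex (- l) s * h s) = (LINT s|M. freq (- l) * ex (- l) s * (LINT t|lebesgue_on {0..s}. h t))"
    using integral_by_parts_ex[OF h, of "- l"] H[of \<omega>] per \<omega> by simp
  also have "\<dots> = (LINT s|M. freq (- l) * (ex (- l) s * cinner (f s) y - ex (- l) s * cinner (f 0) y))"
    by (rule Bochner_Integration.integral_cong) (simp_all add: H right_diff_distrib mult.assoc)
  also have "\<dots> = freq (- l) * ((LINT s|M. ex (- l) s * cinner (f s) y) - (LINT s|M. ex (- l) s * cinner (f 0) y))"
    by (subst Bochner_Integration.integral_diff[symmetric])
      (auto intro!: cf integrable_continuous_M continuous_intros)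
  also have "\<dots> = - freq l * (LINT s|M. ex (- l) s * cinner (f s) y)"
    by (cases "l = 0") (simp_all add: integral_ex freq_def)
  finally have "(LINT s|M. ex (- l) s * h s) = freq l * (LINT s|M. ex (- l) s * cinner (f s) y)"
    by simp
  then show "cinner (hat z l) y = cinner (freq l *\<^sub>C fcoeff \<omega> f l) y"
    by (simp add: hat_def cinner_fcoeff z f h_def cinner_scaleC_left)
qed

text \<open>Two continuous functions in one class agree on the whole interval, so a competing
  \<open>g\<close> inherits the periodicity of \<open>f\<close>. Then both derivatives have the same
  Fourier coefficients, which determine them.\<close>

lemma L0_eqI:
  fixes f :: "real \<Rightarrow> 'h::complex_hilbert"
  assumes W: "W21_deriv \<omega> f z" and per: "f 0 = f \<omega>"
  shows "L0 \<omega> (cls \<omega> f) = z"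
  unfolding L0_def
proof (rule the_equality)
  show "\<exists>g. cls \<omega> f = cls \<omega> g \<and> W21_deriv \<omega> g z"
    using W by blast
  fix z' assume "\<exists>g. cls \<omega> f = cls \<omega> g \<and> W21_deriv \<omega> g z'"
  then obtain g where g: "cls \<omega> f = cls \<omega> g" "W21_deriv \<omega> g z'"
    by blast
  have "continuous_on {0..\<omega>} (\<lambda>s. norm (f s - g s))"
    using W g(2) by (auto simp: W21_deriv_def intro!: continuous_intros)
  moreover have "(LINT s|M. norm (f s - g s)) = 0"
    using g(1) by (intro integral_eq_zero_AE) (auto simp: cls_eq_iff)
  ultimately have fg: "\<forall>s\<in>{0..\<omega>}. norm (f s - g s) = 0"
    using integralL_eq_0_iff[of 0 \<omega> "\<lambda>s. norm (f s - g s)"] \<omega> by simp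
  then have "f 0 = g 0" "f \<omega> = g \<omega>"
    using \<omega> by force+
  then have "hat z' l = hat z l" for l
    using hat_W21_deriv[OF W per] hat_W21_deriv[OF g(2)] per fcoeff_cong_AE[of f g l] g(1)
    by (simp add: cls_eq_iff)
  moreover have "z \<in> L2 \<omega>" "z' \<in> L2 \<omega>"
    using W g(2) by (simp_all add: W21_deriv_def)
  ultimately have "z' - z = 0"
    by (intro hat_unique) (simp_all add: diff_in_L2_hat)
  then show "z' = z" by simp
qed

text \<open>An increment of the vector primitive is bounded by that of the scalar primitive
  \<open>K\<close> of \<open>norm (z s)\<close>. This is seen by testing the increment
  \<open>y\<close> against itself, which gives
  \<open>(norm y)\<^sup>2 \<le> (K t - K s) * norm y\<close>.\<close>

lemma continuous_on_indefinite_bint: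
  assumes z: "square_integrable \<omega> z"
  shows "continuous_on {0..\<omega>} (\<lambda>t. bint (lebesgue_on {0..t}) z)"
proof -
  define F where "F t = bint (lebesgue_on {0..t}) z" for t
  define K where "K t = integral {0..t} (\<lambda>s. norm (z s))" for t
  have nz: "integrable M (\<lambda>s. norm (z s))"
    by (rule integrable_norm_square_integrable[OF z])
  have nz_on: "(\<lambda>s. norm (z s)) integrable_on {0..\<omega>}"
    by (rule integrable_on_lebesgue_on[OF nz]) simp
  have K: "continuous_on {0..\<omega>} K"
    unfolding K_def by (rule indefinite_integral_continuous_1[OF nz_on])
  have le: "norm (F t - F s) \<le> K t - K s" if st: "0 \<le> s" "s \<le> t" "t \<le> \<omega>" for s t
  proof -
    define y where "y = F t - F s"
    define h where "h s = cinner (z s) y" for s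
    have h: "integrable M h"
      unfolding h_def by (intro integrable_cinner z square_integrable_const)
    have h_on: "h integrable_on {0..\<omega>}"
      by (rule integrable_on_lebesgue_on[OF h]) simp
    have F: "cinner (F r) y = integral {0..r} h" if "r \<le> \<omega>" for r
    proof -
      interpret complete_measure "lebesgue_on {0..r}"
        by (rule complete_lebesgue_on) simp
      have "cinner (F r) y = (LINT s|lebesgue_on {0..r}. h s)"
        unfolding F_def h_def
        by (rule has_bochner_integral_integral_eq[symmetric], rule has_bint_cinner,
            rule has_bint_subinterval[OF z that])
      also have "\<dots> = integral {0..r} h"
        by (intro lebesgue_integral_eq_integral integrable_lebesgue_on_subset[OF h] that) simp
      finally show ?thesis .
    qed
    have sub: "h integrable_on {0..t}" "(\<lambda>s. norm (z s)) integrable_on {0..t}"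
      "h integrable_on {s..t}" "(\<lambda>s. norm (z s)) integrable_on {s..t}"
      using st by (auto intro: integrable_on_subinterval[OF h_on] integrable_on_subinterval[OF nz_on])
    have "complex_of_real ((norm y)\<^sup>2) = cinner (F t) y - cinner (F s) y"
      by (simp add: cinner_self[symmetric] y_def cinner_diff_left[symmetric] del: of_real_power)
    also have "\<dots> = integral {s..t} h"
      using Henstock_Kurzweil_Integration.integral_combine[OF st(1,2) sub(1)] F st by (simp add: diff_eq_eq add.commute)
    finally have "(norm y)\<^sup>2 = cmod (integral {s..t} h)"
      by (metis abs_of_nonneg norm_of_real zero_le_power2)
    also have "\<dots> \<le> integral {s..t} (\<lambda>s. norm (z s) * norm y)"
      using sub norm_cinner_le
      by (intro integral_norm_bound_integral integrable_on_mult_left) (auto simp: h_def)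
    also have "\<dots> = (K t - K s) * norm y"
      using Henstock_Kurzweil_Integration.integral_combine[OF st(1,2) sub(2)] by (simp add: K_def)
    finally have "norm y * norm y \<le> (K t - K s) * norm y"
      by (simp add: power2_eq_square)
    moreover have "0 \<le> integral {s..t} (\<lambda>s. norm (z s))"
      by (rule integral_nonneg[OF sub(4)]) simp
    then have "0 \<le> K t - K s"
      using Henstock_Kurzweil_Integration.integral_combine[OF st(1,2) sub(2)] by (simp add: K_def)
    ultimately show ?thesis
      unfolding y_def[symmetric] by (cases "y = 0") auto
  qed
  have "dist (F t) (F s) \<le> dist (K t) (K s)" if "s \<in> {0..\<omega>}" "t \<in> {0..\<omega>}" for s t
    using le[of s t] le[of t s] that
    by (cases "s \<le> t") (auto simp: dist_norm norm_minus_commute abs_minus_commute)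
  then have "continuous_on {0..\<omega>} F"
    using K unfolding continuous_on_iff by (meson le_less_trans)
  then show ?thesis
    by (simp add: F_def)
qed

text \<open>The candidate is the primitive of \<open>z\<close>, which is periodic because the zeroth
  coefficient of \<open>z\<close> is zero. Its coefficients at nonzero \<open>l\<close> are then
  forced to be those of \<open>x\<close>, and an additive constant adjusts the one at
  \<open>0\<close>.\<close>

lemma dom_L0_L0I:
  fixes x z :: "'h::complex_hilbert aefun"
  assumes x: "x \<in> L2 \<omega>" and z: "z \<in> L2 \<omega>" and hat: "\<And>l. hat z l = freq l *\<^sub>C hat x l"
  shows "x \<in> dom_L0 \<omega>" "L0 \<omega> x = z"
proof -
  note zs = L2D(1)[OF z]
  define F where "F t = bint (lebesgue_on {0..t}) (rep_aefun z)" for t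
  have F_cont: "continuous_on {0..\<omega>} F"
    unfolding F_def by (rule continuous_on_indefinite_bint[OF zs])
  have F_bint: "has_bint (lebesgue_on {0..t}) (rep_aefun z) (F t)" if "t \<le> \<omega>" for t
    unfolding F_def by (rule has_bint_subinterval[OF zs that])
  have F0: "F 0 = 0"
  proof (rule cinner_eqI)
    fix y
    interpret complete_measure "lebesgue_on {0..0::real}"
      by (rule complete_lebesgue_on) simp
    have "has_bochner_integral (lebesgue_on {0..0}) (\<lambda>s. cinner (rep_aefun z s) y) (cinner (F 0) y)"
      using \<omega> by (intro has_bint_cinner F_bint) simp
    then have "cinner (F 0) y = (LINT s|lebesgue_on {0..0}. cinner (rep_aefun z s) y)"
      by (simp add: has_bochner_integral_integral_eq)
    also have "\<dots> = 0"
      by (rule integral_eq_zero_null_sets) simp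
    finally show "cinner (F 0) y = cinner 0 y" by simp
  qed
  have F\<omega>: "F \<omega> = 0"
  proof -
    have "hat z 0 = complex_of_real (1 / \<omega>) *\<^sub>C F \<omega>"
      by (simp add: hat_def fcoeff_eq_ex F_def scaleC_one)
    then have "complex_of_real (1 / \<omega>) *\<^sub>C F \<omega> = 0"
      using hat[of 0] by (simp add: freq_def)
    then show ?thesis
      using \<omega> by simp
  qed
  define f where "f t = F t + (hat x 0 - fcoeff \<omega> F 0)" for t
  have per: "f 0 = f \<omega>"
    by (simp add: f_def F0 F\<omega>)
  have W: "W21_deriv \<omega> f z"
    unfolding W21_deriv_def
  proof (intro conjI ballI z)
    show "continuous_on {0..\<omega>} f"
      unfolding f_def by (intro continuous_intros F_cont)
    show "has_bint (lebesgue_on {0..t}) (rep_aefun z) (f t - f 0)" if "t \<in> {0..\<omega>}" for t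
      using F_bint[of t] that by (simp add: f_def F0)
  qed
  have f: "square_integrable \<omega> f"
    using W by (simp add: W21_deriv_def square_integrable_continuous)
  have "fcoeff \<omega> f l = hat x l" for l
  proof (cases "l = 0")
    case True
    have const: "fcoeff \<omega> (\<lambda>_. c) 0 = c" for c :: 'h
      using fcoeff_ex[of 0 c 0] by (simp add: scaleC_one)
    show ?thesis
      unfolding True f_def
      by (simp add: fcoeff_add square_integrable_continuous[OF F_cont] square_integrable_const const)
  next
    case False
    have "freq l *\<^sub>C fcoeff \<omega> f l = freq l *\<^sub>C hat x l"
      using hat_W21_deriv[OF W per, of l] hat[of l] by argo
    with False show ?thesis
      using complex_vector.scale_left_imp_eq[of "freq l"] by simp
  qed
  then have "x - cls \<omega> f = 0"
    using x cls_in_L2[OF f] by (intro hat_unique) (simp_all add: diff_in_L2_hat hat_cls)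
  then have xf: "x = cls \<omega> f" by simp
  show "x \<in> dom_L0 \<omega>"
    unfolding dom_L0_def xf using W per by blast
  show "L0 \<omega> x = z"
    unfolding xf by (rule L0_eqI[OF W per])
qed

lemma dom_L0D:
  assumes "x \<in> dom_L0 \<omega>"
  shows "x \<in> L2 \<omega>" "L0 \<omega> x \<in> L2 \<omega>" "hat (L0 \<omega> x) l = freq l *\<^sub>C hat x l"
proof -
  obtain f z where f: "x = cls \<omega> f" "W21_deriv \<omega> f z" "f 0 = f \<omega>"
    using assms by (auto simp: dom_L0_def)
  have L: "L0 \<omega> x = z"
    unfolding f(1) by (rule L0_eqI[OF f(2,3)])
  show "x \<in> L2 \<omega>"
    unfolding f(1) using f(2) by (intro cls_in_L2 square_integrable_continuous) (simp add: W21_deriv_def)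
  show "L0 \<omega> x \<in> L2 \<omega>"
    unfolding L using f(2) by (simp add: W21_deriv_def)
  show "hat (L0 \<omega> x) l = freq l *\<^sub>C hat x l"
    using hat_W21_deriv[OF f(2,3)] unfolding L by (simp add: f(1) hat_cls)
qed

end

section \<open>Block diagonal perturbations of the derivative\<close>

context interval
begin

sublocale L2: coefficient_space "L2 \<omega> :: 'h::complex_hilbert aefun set" "l2_norm \<omega>" hat
  by standard (use ex_L2_hat in \<open>auto intro: add_in_L2_hat scaleC_in_L2_hat l2_norm_nonneg hat_unique bessel_L2\<close>)

section \<open>The spectral projections and their ranges\<close>

lemma P_eq_cls: "P \<omega> l x = cls \<omega> (\<lambda>s. ex l s *\<^sub>C hat x l)"
  by (simp add: P_def ex_def hat_def)

lemma P_in_L2: "P \<omega> l x \<in> L2 \<omega>"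
  unfolding P_eq_cls by (intro cls_in_L2 square_integrable_ex_scaleC square_integrable_const)

lemma hat_P: "hat (P \<omega> l x) j = (if j = l then hat x l else 0)"
  unfolding P_eq_cls hat_cls by (rule fcoeff_ex)

lemma P_in_span_of: "P \<omega> l x \<in> L2.span_of {l}"
  by (simp add: L2.span_of_def P_in_L2 hat_P)

lemma P_eq_self: "x \<in> L2.span_of {l} \<Longrightarrow> P \<omega> l x = x"
  by (rule L2.hat_inject) (auto simp: P_in_L2 hat_P L2.span_of_def)

lemma l2_norm_P_le: "x \<in> L2 \<omega> \<Longrightarrow> l2_norm \<omega> (P \<omega> l x) \<le> l2_norm \<omega> x"
  using L2.N_single[OF P_in_span_of[of l x]] L2.norm_hat_le[of x l] by (simp add: hat_P)

lemma Hsub_eq: "Hsub \<omega> l = L2.span_of {l}"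
proof
  show "Hsub \<omega> l \<subseteq> L2.span_of {l}"
    using P_in_span_of by (auto simp: Hsub_def)
  show "L2.span_of {l} \<subseteq> Hsub \<omega> l"
  proof
    fix x assume x: "x \<in> L2.span_of {l}"
    then show "x \<in> Hsub \<omega> l"
      unfolding Hsub_def using P_eq_self[OF x] L2.span_ofD(1)[OF x] by (metis image_eqI)
  qed
qed

lemma hat_sum_P:
  assumes "finite F"
  shows "(\<Sum>l\<in>F. P \<omega> l x) \<in> L2 \<omega> \<and> hat (\<Sum>l\<in>F. P \<omega> l x) j = (if j \<in> F then hat x j else 0)"
  using assms by (induction F rule: finite_induct) (auto simp: add_in_L2_hat P_in_L2 hat_P)

lemma Hsub_upto_eq: "(Hsub_upto \<omega> k :: 'h::complex_hilbert aefun set) = L2.span_of {l. \<bar>l\<bar> \<le> int k}"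
proof -
  have "{l. \<bar>l\<bar> \<le> int k} = {- int k..int k}"
    by auto
  then have fin: "finite {l. \<bar>l\<bar> \<le> int k}"
    by simp
  have P: "P_upto \<omega> k x \<in> L2 \<omega>" "hat (P_upto \<omega> k x) j = (if \<bar>j\<bar> \<le> int k then hat x j else 0)" for x :: "'h aefun" and j
    using hat_sum_P[OF fin, of x j] by (simp_all add: P_upto_def)
  show ?thesis
  proof
    show "(Hsub_upto \<omega> k :: 'h aefun set) \<subseteq> L2.span_of {l. \<bar>l\<bar> \<le> int k}"
      by (auto simp: Hsub_upto_def L2.span_of_def P)
    show "L2.span_of {l. \<bar>l\<bar> \<le> int k} \<subseteq> (Hsub_upto \<omega> k :: 'h aefun set)"
    proof
      fix x :: "'h aefun" assume x: "x \<in> L2.span_of {l. \<bar>l\<bar> \<le> int k}"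
      have "P_upto \<omega> k x = x"
        by (rule L2.hat_inject) (use x in \<open>auto simp: P L2.span_of_def\<close>)
      then show "x \<in> Hsub_upto \<omega> k"
        unfolding Hsub_upto_def using L2.span_ofD(1)[OF x] by (metis image_eqI)
    qed
  qed
qed

section \<open>Operator norms and conjugation\<close>

lemma bounded_opsE:
  fixes X :: "'h::complex_hilbert aefun \<Rightarrow> 'h aefun"
  assumes "X \<in> bounded_ops \<omega>"
  obtains C where "0 \<le> C" "\<And>x. x \<in> L2 \<omega> \<Longrightarrow> l2_norm \<omega> (X x) \<le> C * l2_norm \<omega> x"
proof -
  obtain C where C: "\<And>x. x \<in> L2 \<omega> \<Longrightarrow> l2_norm \<omega> (X x) \<le> C * l2_norm \<omega> x"
    using assms unfolding bounded_ops_def by blast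
  show thesis
  proof (rule that[of "\<bar>C\<bar>"])
    fix x :: "'h aefun" assume x: "x \<in> L2 \<omega>"
    have "C * l2_norm \<omega> x \<le> \<bar>C\<bar> * l2_norm \<omega> x"
      using l2_norm_nonneg[OF x] by (intro mult_right_mono) auto
    with C[OF x] show "l2_norm \<omega> (X x) \<le> \<bar>C\<bar> * l2_norm \<omega> x" by linarith
  qed simp
qed

text \<open>By invariance \<open>P \<omega> l \<circ> V \<circ> P \<omega> l\<close> acts on the
  subspace as \<open>V\<close>, and scaling a vector to norm one compares it with the supremum.
  Boundedness of \<open>V\<close> is what makes the supremum an upper bound.\<close>

lemma op_norm_block:
  fixes V :: "'h::complex_hilbert aefun \<Rightarrow> 'h aefun"
  assumes V: "V \<in> bounded_ops \<omega>" and inv: "V ` L2.span_of {l} \<subseteq> L2.span_of {l}"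
  defines "v \<equiv> op_norm \<omega> (P \<omega> l \<circ> V \<circ> P \<omega> l)"
  shows "0 \<le> v" "x \<in> L2.span_of {l} \<Longrightarrow> l2_norm \<omega> (V x) \<le> v * l2_norm \<omega> x"
proof -
  let ?X = "P \<omega> l \<circ> V \<circ> P \<omega> l" and ?S = "{x \<in> L2 \<omega> :: 'h aefun set. l2_norm \<omega> x \<le> 1}"
  obtain C where C: "0 \<le> C" "\<And>x. x \<in> L2 \<omega> \<Longrightarrow> l2_norm \<omega> (V x) \<le> C * l2_norm \<omega> x"
    using V by (rule bounded_opsE) blast
  have V_in: "V x \<in> L2 \<omega>" if "x \<in> L2 \<omega>" for x
    using V that by (auto simp: bounded_ops_def)
  have "l2_norm \<omega> (?X u) \<le> C * 1" if "u \<in> ?S" for u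
  proof -
    have "l2_norm \<omega> (?X u) \<le> l2_norm \<omega> (V (P \<omega> l u))"
      using V_in[OF P_in_L2] by (simp add: l2_norm_P_le)
    also have "\<dots> \<le> C * l2_norm \<omega> (P \<omega> l u)"
      by (rule C(2)[OF P_in_L2])
    also have "\<dots> \<le> C * 1"
      using that l2_norm_P_le[of u l] C(1) by (intro mult_left_mono) auto
    finally show ?thesis .
  qed
  then have bdd: "bdd_above ((\<lambda>u. l2_norm \<omega> (?X u)) ` ?S)"
    by (intro bdd_aboveI2)
  have le: "l2_norm \<omega> (?X u) \<le> v" if "u \<in> ?S" for u
    unfolding v_def op_norm_def by (rule cSUP_upper[OF that bdd])
  have "l2_norm \<omega> (0 :: 'h aefun) = 0"
    using L2.N_le_sum[of "0 :: 'h aefun" "{}"] l2_norm_nonneg[of "0 :: 'h aefun"] by simp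
  then have "0 \<in> ?S" by simp
  moreover have "0 \<le> l2_norm \<omega> (?X 0)"
    by (simp add: l2_norm_nonneg P_in_L2)
  ultimately show "0 \<le> v"
    using le by (meson order_trans)
  show "l2_norm \<omega> (V x) \<le> v * l2_norm \<omega> x" if x: "x \<in> L2.span_of {l}"
  proof (cases "l2_norm \<omega> x = 0")
    case True
    then show ?thesis
      using C(2)[OF L2.span_ofD(1)[OF x]] by simp
  next
    case False
    let ?a = "complex_of_real (1 / l2_norm \<omega> x)"
    have xL: "x \<in> L2 \<omega>" using x L2.span_ofD by blast
    have N: "0 < l2_norm \<omega> x"
      using False l2_norm_nonneg[OF xL] by simp
    have scale: "?a *\<^sub>C y \<in> L2.span_of {l}" "l2_norm \<omega> (?a *\<^sub>C y) = l2_norm \<omega> y / l2_norm \<omega> x"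
      if y: "y \<in> L2.span_of {l}" for y
    proof -
      show ay: "?a *\<^sub>C y \<in> L2.span_of {l}"
        using y by (auto simp: L2.span_of_def L2.scaleC_in L2.hat_scaleC)
      show "l2_norm \<omega> (?a *\<^sub>C y) = l2_norm \<omega> y / l2_norm \<omega> x"
        using L2.N_single[OF ay] L2.N_single[OF y] N L2.span_ofD(1)[OF y]
        by (simp add: L2.hat_scaleC norm_scaleC norm_divide)
    qed
    have Vx: "V x \<in> L2.span_of {l}"
      using inv x by blast
    have "V (?a *\<^sub>C x) = ?a *\<^sub>C V x"
      using V xL by (auto simp: bounded_ops_def)
    then have "?X (?a *\<^sub>C x) = ?a *\<^sub>C V x"
      using P_eq_self[OF scale(1)[OF x]] P_eq_self[OF scale(1)[OF Vx]] by simp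
    moreover have "l2_norm \<omega> (?X (?a *\<^sub>C x)) \<le> v"
      using scale[OF x] N by (intro le) (auto dest: L2.span_ofD)
    ultimately have "l2_norm \<omega> (V x) / l2_norm \<omega> x \<le> v"
      using scale(2)[OF Vx] by simp
    then show ?thesis
      using N by (simp add: divide_le_eq)
  qed
qed

lemma spectrum_conjugate:
  fixes U :: "'h::complex_hilbert aefun \<Rightarrow> 'h aefun"
  assumes U: "U \<in> bounded_ops \<omega>" "continuously_invertible \<omega> U" "U ` D = D" and "D \<subseteq> L2 \<omega>"
    and BU: "\<And>x. x \<in> D \<Longrightarrow> B (U x) = U (A x)" and A: "\<And>x. x \<in> D \<Longrightarrow> A x \<in> L2 \<omega>"
  shows "spectrum (l2_norm \<omega>) (L2 \<omega>) D B = spectrum (l2_norm \<omega>) (L2 \<omega>) D A"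
proof -
  obtain Y where Y: "Y \<in> bounded_ops \<omega>" "\<And>x. x \<in> L2 \<omega> \<Longrightarrow> Y (U x) = x" "\<And>x. x \<in> L2 \<omega> \<Longrightarrow> U (Y x) = x"
    using U(2) by (auto simp: continuously_invertible_def)
  obtain C where C: "0 \<le> C" "\<And>x. x \<in> L2 \<omega> \<Longrightarrow> l2_norm \<omega> (U x) \<le> C * l2_norm \<omega> x"
    using U(1) by (rule bounded_opsE) blast
  obtain C' where C': "0 \<le> C'" "\<And>x. x \<in> L2 \<omega> \<Longrightarrow> l2_norm \<omega> (Y x) \<le> C' * l2_norm \<omega> x"
    using Y(1) by (rule bounded_opsE) blast
  have in_L2: "U x \<in> L2 \<omega>" "Y x \<in> L2 \<omega>" if "x \<in> L2 \<omega>" for x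
    using U(1) Y(1) that by (auto simp: bounded_ops_def)
  show ?thesis
  \<comment> \<open>The sum \<open>C + C'\<close> dominates both the bound of \<open>U\<close> and
    that of its inverse.\<close>
  proof (rule spectrum_similar[where U = U and c = "C + C'"])
    show "inj_on U (L2 \<omega>)"
      using Y(2) by (rule inj_on_inverseI)
    show "U ` L2 \<omega> = L2 \<omega>"
    proof
      show "L2 \<omega> \<subseteq> U ` L2 \<omega>"
        using Y(3) in_L2(2) by (metis image_eqI subsetI)
    qed (use in_L2 in auto)
    fix x :: "'h aefun" assume x: "x \<in> L2 \<omega>"
    show "l2_norm \<omega> (U x) \<le> (C + C') * l2_norm \<omega> x"
      using C(2)[OF x] mult_nonneg_nonneg[OF C'(1) l2_norm_nonneg[OF x]] by (simp add: distrib_right)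
    show "l2_norm \<omega> x \<le> (C + C') * l2_norm \<omega> (U x)"
      using C'(2)[OF in_L2(1)[OF x]] mult_nonneg_nonneg[OF C(1) l2_norm_nonneg[OF in_L2(1)[OF x]]] Y(2)[OF x]
      by (simp add: distrib_right)
    show "0 \<le> l2_norm \<omega> x"
      by (rule l2_norm_nonneg[OF x])
  next
    fix z and x :: "'h aefun" assume x: "x \<in> D"
    then have xL: "x \<in> L2 \<omega>"
      using \<open>D \<subseteq> L2 \<omega>\<close> by blast
    \<comment> \<open>Written as a sum because \<open>bounded_ops\<close> provides additivity and
      homogeneity.\<close>
    have "U (A x + (- z) *\<^sub>C x) = U (A x) + (- z) *\<^sub>C U x"
      using U(1) xL A[OF x] L2.scaleC_in[OF xL, of "- z"] by (simp add: bounded_ops_def del: complex_vector.scale_minus_left)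
    then show "B (U x) - z *\<^sub>C U x = U (A x - z *\<^sub>C x)"
      by (simp add: BU x)
    show "A x - z *\<^sub>C x \<in> L2 \<omega>"
      by (intro L2.diff_in L2.scaleC_in A x xL)
  qed (use U(3) \<open>D \<subseteq> L2 \<omega>\<close> C(1) C'(1) in simp_all)
qed

lemma block_operator_L0:
  fixes V0 :: "'h::complex_hilbert aefun \<Rightarrow> 'h aefun"
  assumes V0: "V0 \<in> bounded_ops \<omega>"
    and upto: "V0 ` Hsub_upto \<omega> k \<subseteq> Hsub_upto \<omega> k"
    and single: "\<And>l. \<bar>l\<bar> > int k \<Longrightarrow> V0 ` Hsub \<omega> l \<subseteq> Hsub \<omega> l"
  obtains b where "block_operator (L2 \<omega>) (l2_norm \<omega>) hat (dom_L0 \<omega>) (L0 \<omega>) V0 freq (2 * pi / \<omega>) b k"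
proof -
  obtain b where b: "0 \<le> b" "\<And>x. x \<in> L2 \<omega> \<Longrightarrow> l2_norm \<omega> (V0 x) \<le> b * l2_norm \<omega> x"
    using V0 by (rule bounded_opsE) blast
  have "block_operator (L2 \<omega>) (l2_norm \<omega>) hat (dom_L0 \<omega>) (L0 \<omega>) V0 freq (2 * pi / \<omega>) b k"
  proof
    show "0 < 2 * pi / \<omega>"
      using \<omega> by simp
    show "2 * pi / \<omega> * \<bar>of_int l\<bar> \<le> cmod (freq l)" for l
      using \<omega> by (simp add: freq_def norm_mult norm_divide)
    show "x \<in> dom_L0 \<omega> \<longleftrightarrow> x \<in> L2 \<omega> \<and> (\<exists>z\<in>L2 \<omega>. \<forall>l. hat z l = freq l *\<^sub>C hat x l)" for x :: "'h aefun"
      using dom_L0D[of x] dom_L0_L0I(1)[of x] by blast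
    show "V0 ` L2.span_of {l. \<bar>l\<bar> \<le> int k} \<subseteq> L2.span_of {l. \<bar>l\<bar> \<le> int k}"
      using upto by (simp add: Hsub_upto_eq)
    show "V0 ` L2.span_of {l} \<subseteq> L2.span_of {l}" if "\<bar>l\<bar> > int k" for l
      using single[OF that] by (simp add: Hsub_eq)
  qed (use V0 b dom_L0D in \<open>auto simp: bounded_ops_def\<close>)
  then show thesis by (rule that)
qed

end

theorem theorem2p7:
  fixes \<omega> :: real
    and \<V> :: "real \<Rightarrow> 'h::complex_hilbert \<Rightarrow> 'h"
    and k :: nat
    and U W V0 :: "'h aefun \<Rightarrow> 'h aefun"
  assumes "\<omega> > 0"
    and "\<exists>x::'h. x \<noteq> 0"
    and "admissible_potential \<omega> \<V>"
    and "U \<in> bounded_ops \<omega>"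
    and "continuously_invertible \<omega> U"
    and "W \<in> S2 \<omega>"
    and "\<forall>x\<in>L2 \<omega>. U x = x + W x"
    and "V0 \<in> S2 \<omega>"
    and "U ` dom_L0 \<omega> = dom_L0 \<omega>"
    and "\<forall>x\<in>dom_L0 \<omega>. L_op \<omega> \<V> (U x) = U (L0 \<omega> x - V0 x)"
    and "V0 ` Hsub_upto \<omega> k \<subseteq> Hsub_upto \<omega> k"
    and "\<forall>l. \<bar>l\<bar> > int k \<longrightarrow> V0 ` Hsub \<omega> l \<subseteq> Hsub \<omega> l"
  defines "\<sigma>_upto \<equiv> spectrum (l2_norm \<omega>) (Hsub_upto \<omega> k) (Hsub_upto \<omega> k) (\<lambda>x. L0 \<omega> x - V0 x)"
    and "\<sigma> \<equiv> (\<lambda>l. spectrum (l2_norm \<omega>) (Hsub \<omega> l) (Hsub \<omega> l) (\<lambda>x. - V0 x))"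
  shows "spectrum (l2_norm \<omega>) (L2 \<omega>) (dom_L0 \<omega>) (L_op \<omega> \<V>) =
           \<sigma>_upto \<union> (\<Union>l\<in>{l. \<bar>l\<bar> > int k}.
             (\<lambda>z. \<i> * complex_of_real (2 * pi * of_int l / \<omega>) + z) ` \<sigma> l)
       \<and> (\<forall>l. \<bar>l\<bar> > int k \<longrightarrow> (\<exists>z\<in>\<sigma> l. \<forall>z'\<in>\<sigma> l. cmod z' \<le> cmod z))
       \<and> (\<lambda>l. (max_modulus (\<sigma> l))\<^sup>2) summable_on {l. \<bar>l\<bar> > int k}"
proof -
  interpret interval \<omega>
    by standard (rule assms)
  have V0: "V0 \<in> bounded_ops \<omega>"
    using \<open>V0 \<in> S2 \<omega>\<close> by (simp add: S2_def)
  obtain b where "block_operator (L2 \<omega>) (l2_norm \<omega>) hat (dom_L0 \<omega>) (L0 \<omega>) V0 freq (2 * pi / \<omega>) b k"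
    using block_operator_L0[OF V0 assms(11)] assms(12) by blast
  then interpret block_operator "L2 \<omega>" "l2_norm \<omega>" hat "dom_L0 \<omega>" "L0 \<omega>" V0 freq "2 * pi / \<omega>" b k .
  have "spectrum (l2_norm \<omega>) (L2 \<omega>) (dom_L0 \<omega>) (L_op \<omega> \<V>) =
      spectrum (l2_norm \<omega>) (L2 \<omega>) (dom_L0 \<omega>) (\<lambda>x. L0 \<omega> x - V0 x)"
    by (rule spectrum_conjugate[OF assms(4,5,9)]) (use assms(10) in \<open>auto simp: D_iff L_in V_in L2.diff_in\<close>)
  also have "\<dots> = \<sigma>_upto \<union> (\<Union>l\<in>{l. \<bar>l\<bar> > int k}. (\<lambda>z. freq l + z) ` \<sigma> l)"
    unfolding \<sigma>_upto_def \<sigma>_def Hsub_eq Hsub_upto_eq by (rule spectrum_blocks)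
  finally have spec: "spectrum (l2_norm \<omega>) (L2 \<omega>) (dom_L0 \<omega>) (L_op \<omega> \<V>) =
      \<sigma>_upto \<union> (\<Union>l\<in>{l. \<bar>l\<bar> > int k}. (\<lambda>z. freq l + z) ` \<sigma> l)" .
  define v where "v l = op_norm \<omega> (P \<omega> l \<circ> V0 \<circ> P \<omega> l)" for l
  have v: "0 \<le> v l" "\<And>x. x \<in> L2.span_of {l} \<Longrightarrow> l2_norm \<omega> (V0 x) \<le> v l * l2_norm \<omega> x"
    if "\<bar>l\<bar> > int k" for l
    using op_norm_block[OF V0 V_single[OF that]] unfolding v_def by blast+
  have max: "\<exists>z\<in>\<sigma> l. \<forall>z'\<in>\<sigma> l. cmod z' \<le> cmod z" and bound: "\<sigma> l \<subseteq> cball 0 (v l)"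
    if l: "\<bar>l\<bar> > int k" for l
    unfolding \<sigma>_def Hsub_eq
    using spectrum_single[OF l v(2)[OF l] v(1)[OF l] assms(2)] by blast+
  have "(\<lambda>(j, l). (op_norm \<omega> (P \<omega> j \<circ> V0 \<circ> P \<omega> l))\<^sup>2) summable_on (UNIV :: (int \<times> int) set)"
    using \<open>V0 \<in> S2 \<omega>\<close> by (simp add: S2_def)
  \<comment> \<open>Only the diagonal terms \<open>j = l\<close> of the double sum bound the
    \<open>\<sigma> l\<close>; they are picked out for indices outside the ball and then re-indexed
    by \<open>l\<close>.\<close>
  then have "(\<lambda>(j, l). (op_norm \<omega> (P \<omega> j \<circ> V0 \<circ> P \<omega> l))\<^sup>2) summable_on (\<lambda>l. (l, l)) ` {l. \<bar>l\<bar> > int k}"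
    by (rule summable_on_subset_banach) simp
  then have "(\<lambda>l. (v l)\<^sup>2) summable_on {l. \<bar>l\<bar> > int k}"
    by (subst (asm) summable_on_reindex) (simp_all add: inj_on_def comp_def v_def)
  then have "(\<lambda>l. (max_modulus (\<sigma> l))\<^sup>2) summable_on {l. \<bar>l\<bar> > int k}"
  proof (rule summable_on_comparison_test)
    fix l assume "l \<in> {l. \<bar>l\<bar> > int k}"
    then have l: "\<bar>l\<bar> > int k" by simp
    obtain z where z: "z \<in> \<sigma> l" "\<And>z'. z' \<in> \<sigma> l \<Longrightarrow> cmod z' \<le> cmod z"
      using max[OF l] by blast
    \<comment> \<open>\<open>GREATEST\<close> denotes the maximum only if one exists; attainment at
      \<open>z\<close> provides it.\<close>
    have "max_modulus (\<sigma> l) = cmod z"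
      unfolding max_modulus_def by (rule Greatest_equality) (use z in auto)
    moreover have "cmod z \<le> v l"
      using bound[OF l] z(1) by auto
    ultimately show "(max_modulus (\<sigma> l))\<^sup>2 \<le> (v l)\<^sup>2"
      by (simp add: power_mono)
  qed simp
  with spec max show ?thesis
    unfolding freq_def by blast
qed

end
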